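(* Let $\gamma_1,\gamma_2\in\mathbb{R}$, let $s\ge2$, let $z_0=(u_0,\rho_0)\in H^s(\mathbb{S})\times H^{s-1}(\mathbb{S})$ with $z_0\not\equiv0$, and let $T\in(0,\infty]$ be the maximal existence time of the corresponding solution $z=(u,\rho)$ to the periodic 2-component $\mu$-Hunter-Saxton system with initial data $z_0$. Put $\mu_0=\int_{\mathbb{S}}u_0\,dx$. If $\gamma_1=2\gamma_2$, $\mu_0=0$, and there exists a point $x_0\in\mathbb{S}$ such that $\rho_0(-x_0)=0$, then the solution $z$ blows up in finite time.
   Context: $\mathbb{S}=\mathbb{R}/\mathbb{Z}$; all functions of $x$ are 1-periodic; $\mu(u)=\int_{\mathbb{S}}u\,dx$. The periodic 2-component $\mu$-Hunter-Saxton system with parameters $\gamma_1,\gamma_2\in\mathbb{R}$ is $$-u_{txx}=2\mu(u)u_x-2u_xu_{xx}-uu_{xxx}+\rho\rho_x-\gamma_1u_{xxx},\qquad \rho_t=(\rho u)_x+2\gamma_2\rho_x,$$ with $u(0,x)=u_0(x)$, $\rho(0,x)=\rho_0(x)$, studied under the standing assumption $\mu(u_t)=\mu(u)_t=0$. Under this assumption it is equivalent to the form $$u_t-(u+\gamma_1)u_x=\partial_x(\mu-\partial_x^2)^{-1}\Big(2\mu(u)u+\tfrac12u_x^2+\tfrac12\rho^2\Big),\qquad \rho_t-(u+2\gamma_2)\rho_x=u_x\rho,$$ where $(\mu-\partial_x^2)f:=\mu(f)-f_{xx}$ is an isomorphism $H^{r}(\mathbb{S})\to H^{r-2}(\mathbb{S})$.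 Solutions and maximal existence time: for $s\ge2$ and $z_0=(u_0,\rho_0)\in H^s\times H^{s-1}$ there is a maximal $T\in(0,\infty]$ and a unique solution $z=(u,\rho)\in C([0,T);H^s\times H^{s-1})\cap C^1([0,T);H^{s-1}\times H^{s-2})$ of this system (in the nonlocal form above) with $z(0)=z_0$; "the corresponding solution" is this one and $T$ is its maximal existence time. The solution blows up in finite time if $T<\infty$. *)

theory Defs
  imports "HOL-Analysis.Analysis"
begin

text \<open>Functions on the circle R/Z are 1-periodic functions on the real line, integrated over one
  period.\<close>

abbreviation circle :: "real measure" where
  "circle \<equiv> lebesgue_on {0..1}"

definition periodic1 :: "(real \<Rightarrow> real) \<Rightarrow> bool" where
  "periodic1 f \<longleftrightarrow> (\<forall>x. f (x + 1) = f x)"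

definition mean :: "(real \<Rightarrow> real) \<Rightarrow> real" where
  "mean f = integral\<^sup>L circle f"

definition L2_circle :: "(real \<Rightarrow> real) set" where
  "L2_circle = {f. periodic1 f \<and> f \<in> borel_measurable circle \<and> integrable circle (\<lambda>x. (f x)\<^sup>2)}"

definition fourier_coeff :: "(real \<Rightarrow> real) \<Rightarrow> int \<Rightarrow> complex" where
  "fourier_coeff f k = integral\<^sup>L circle (\<lambda>x. of_real (f x) * cis (- 2 * pi * of_int k * x))"

text \<open>Only orders \<open>r \<ge> 0\<close> are used, so all elements are square integrable functions.
  For \<open>r > 1/2\<close> each class has exactly one continuous representative, and membership refers to
  that representative; point values are therefore meaningful. For smaller \<open>r\<close> elements
  matter only up to null sets.\<close>

definition sobolev :: "real \<Rightarrow> (real \<Rightarrow> real) set" where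
  "sobolev r = {f \<in> L2_circle.
     (\<lambda>k::int. (1 + (of_int k)\<^sup>2) powr r * (cmod (fourier_coeff f k))\<^sup>2) summable_on UNIV \<and>
     (r > 1/2 \<longrightarrow> continuous_on UNIV f)}"

definition sobolev_norm :: "real \<Rightarrow> (real \<Rightarrow> real) \<Rightarrow> real" where
  "sobolev_norm r f =
     sqrt (\<Sum>\<^sub>\<infinity>k::int. (1 + (of_int k)\<^sup>2) powr r * (cmod (fourier_coeff f k))\<^sup>2)"

definition test_function :: "(real \<Rightarrow> real) \<Rightarrow> bool" where
  "test_function \<phi> \<longleftrightarrow> periodic1 \<phi> \<and> (\<forall>n x. (deriv ^^ n) \<phi> field_differentiable at x)"

text \<open>\<open>weak_deriv f g\<close>: the distributional derivative of \<open>f\<close> on the circle is (the class of) \<open>g\<close>.\<close>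

definition weak_deriv :: "(real \<Rightarrow> real) \<Rightarrow> (real \<Rightarrow> real) \<Rightarrow> bool" where
  "weak_deriv f g \<longleftrightarrow> f \<in> L2_circle \<and> g \<in> L2_circle \<and>
     (\<forall>\<phi>. test_function \<phi> \<longrightarrow>
        integral\<^sup>L circle (\<lambda>x. f x * deriv \<phi> x) = - integral\<^sup>L circle (\<lambda>x. g x * \<phi> x))"

text \<open>\<open>mu_dxx_inverse r f p\<close>: \<open>p\<close> is the image of \<open>f\<close> under the inverse of the isomorphism
  \<open>\<mu> - \<partial>\<^sub>x\<^sup>2\<close> from order \<open>r\<close> to order \<open>r - 2\<close>.\<close>

definition mu_dxx_inverse :: "real \<Rightarrow> (real \<Rightarrow> real) \<Rightarrow> (real \<Rightarrow> real) \<Rightarrow> bool" where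
  "mu_dxx_inverse r f p \<longleftrightarrow> p \<in> sobolev r \<and>
     (\<exists>px pxx. weak_deriv p px \<and> weak_deriv px pxx \<and> (AE x in circle. mean p - pxx x = f x))"

definition time_interval :: "ereal \<Rightarrow> real set" where
  "time_interval T = {t. 0 \<le> t \<and> ereal t < T}"

text \<open>\<open>C([0,T); H\<^sup>r)\<close>\<close>

definition sobolev_continuous :: "real \<Rightarrow> ereal \<Rightarrow> (real \<Rightarrow> real \<Rightarrow> real) \<Rightarrow> bool" where
  "sobolev_continuous r T v \<longleftrightarrow>
     (\<forall>t \<in> time_interval T. v t \<in> sobolev r \<and>
        ((\<lambda>\<tau>. sobolev_norm r (\<lambda>x. v \<tau> x - v t x)) \<longlongrightarrow> 0) (at t within time_interval T))"

text \<open>\<open>v\<close> is in \<open>C\<^sup>1([0,T); H\<^sup>r)\<close> with time derivative \<open>v'\<close> (one-sided at \<open>t = 0\<close>).\<close>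

definition sobolev_C1 ::
  "real \<Rightarrow> ereal \<Rightarrow> (real \<Rightarrow> real \<Rightarrow> real) \<Rightarrow> (real \<Rightarrow> real \<Rightarrow> real) \<Rightarrow> bool" where
  "sobolev_C1 r T v v' \<longleftrightarrow> sobolev_continuous r T v \<and> sobolev_continuous r T v' \<and>
     (\<forall>t \<in> time_interval T.
        ((\<lambda>\<tau>. sobolev_norm r (\<lambda>x. (v \<tau> x - v t x) / (\<tau> - t) - v' t x)) \<longlongrightarrow> 0)
          (at t within time_interval T))"

text \<open>The two equations in nonlocal form, at a fixed time: \<open>u\<close>, \<open>\<rho>\<close> are the states, \<open>ut\<close>, \<open>\<rho>t\<close> their
  time derivatives. All spatial derivatives are weak, so the equations are identities between
  classes modulo null sets. The order of \<open>p\<close> is \<open>s + 1\<close> since the right-hand side lies in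
  the space of order \<open>s - 1\<close>.\<close>

definition mu_HS_equations ::
  "real \<Rightarrow> real \<Rightarrow> real \<Rightarrow> (real \<Rightarrow> real) \<Rightarrow> (real \<Rightarrow> real) \<Rightarrow> (real \<Rightarrow> real) \<Rightarrow> (real \<Rightarrow> real) \<Rightarrow> bool"
where
  "mu_HS_equations \<gamma>1 \<gamma>2 s u \<rho> ut \<rho>t \<longleftrightarrow>
     (\<exists>ux \<rho>x p px. weak_deriv u ux \<and> weak_deriv \<rho> \<rho>x \<and>
        mu_dxx_inverse (s + 1) (\<lambda>x. 2 * mean u * u x + (ux x)\<^sup>2 / 2 + (\<rho> x)\<^sup>2 / 2) p \<and>
        weak_deriv p px \<and>
        (AE x in circle. ut x - (u x + \<gamma>1) * ux x = px x) \<and>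
        (AE x in circle. \<rho>t x - (u x + 2 * \<gamma>2) * \<rho>x x = ux x * \<rho> x))"

definition mu_HS_solution ::
  "real \<Rightarrow> real \<Rightarrow> real \<Rightarrow> (real \<Rightarrow> real) \<Rightarrow> (real \<Rightarrow> real) \<Rightarrow> ereal \<Rightarrow>
   (real \<Rightarrow> real \<Rightarrow> real) \<Rightarrow> (real \<Rightarrow> real \<Rightarrow> real) \<Rightarrow> bool"
where
  "mu_HS_solution \<gamma>1 \<gamma>2 s u0 \<rho>0 T u \<rho> \<longleftrightarrow>
     0 < T \<and> u 0 = u0 \<and> \<rho> 0 = \<rho>0 \<and>
     sobolev_continuous s T u \<and> sobolev_continuous (s - 1) T \<rho> \<and>
     (\<exists>ut \<rho>t. sobolev_C1 (s - 1) T u ut \<and> sobolev_C1 (s - 2) T \<rho> \<rho>t \<and>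
        (\<forall>t \<in> time_interval T. mu_HS_equations \<gamma>1 \<gamma>2 s (u t) (\<rho> t) (ut t) (\<rho>t t)))"

text \<open>\<open>(u, \<rho>)\<close> is the solution on \<open>[0,T)\<close> and \<open>T\<close> is the maximal existence time. The values of \<open>u\<close>, \<open>\<rho>\<close>
  at times outside \<open>[0,T)\<close> carry no meaning.\<close>

definition mu_HS_maximal_solution ::
  "real \<Rightarrow> real \<Rightarrow> real \<Rightarrow> (real \<Rightarrow> real) \<Rightarrow> (real \<Rightarrow> real) \<Rightarrow> ereal \<Rightarrow>
   (real \<Rightarrow> real \<Rightarrow> real) \<Rightarrow> (real \<Rightarrow> real \<Rightarrow> real) \<Rightarrow> bool"
where
  "mu_HS_maximal_solution \<gamma>1 \<gamma>2 s u0 \<rho>0 T u \<rho> \<longleftrightarrow>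
     mu_HS_solution \<gamma>1 \<gamma>2 s u0 \<rho>0 T u \<rho> \<and>
     (\<forall>T' u' \<rho>'. mu_HS_solution \<gamma>1 \<gamma>2 s u0 \<rho>0 T' u' \<rho>' \<longrightarrow> T' \<le> T)"

end

theory Submission imports Defs begin

text \<open>Suppose that the solution is global. In Lagrangian coordinates, along a characteristic
  \<open>q' = - (u + \<gamma>\<^sub>1)(t, q)\<close>, the slope \<open>m = u\<^sub>x(t, q)\<close> and the density \<open>r = \<rho>(t, q)\<close> satisfy
  \<open>m' = (m\<^sup>2 - r\<^sup>2 + E) / 2\<close> and \<open>r' = m r\<close>, where \<open>E\<close>, the integral of \<open>u\<^sub>x\<^sup>2 + \<rho>\<^sup>2\<close>, is conserved
  and positive (here \<open>\<mu>(u) = 0\<close> and \<open>\<gamma>\<^sub>1 = 2 \<gamma>\<^sub>2\<close> enter). Starting the characteristic at a zero of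
  \<open>\<rho>\<^sub>0\<close> gives \<open>r = 0\<close>, so \<open>m\<close> solves a Riccati equation and cannot live longer than \<open>2 \<pi> / \<surd>E\<close>.

  For \<open>s = 2\<close> neither \<open>u\<^sub>x\<close> nor \<open>\<rho>\<close> is differentiable in the classical sense, so both are treated as
  \<open>x\<close>-derivatives of \<open>C\<^sup>1\<close> functions (\<open>u\<close> itself and a primitive of \<open>\<rho>\<close>): the evolution of difference
  quotients in \<open>x\<close> is classical, and the step size tends to zero uniformly in time.\<close>

section \<open>Periodic functions and ordinary differential equations\<close>

text \<open>The condition \<gamma>1 = 2 \<gamma>2 gives both equations the same transport velocity,
  so u_x and \<rho> can be followed along one curve. The constant E comes from the nonlocal term:
  with mean zero the pressure solves \<mu>(p) - p_xx = (u_x^2 + \<rho>^2) / 2, and integrating over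
  the circle removes p_xx and forces \<mu>(p) = E / 2. Without E the slope would obey m' = m^2 / 2,
  which has global solutions when m(0) \<le> 0; a positive E makes the blow-up independent of the
  sign of the initial slope. The rest is a matter of regularity. Sobolev norms are Fourier series,
  derivatives are weak and the equations hold almost everywhere, whereas a characteristic is a
  single curve that such statements do not see. So every term needs a continuous representative:
  order 1 controls point values, order 2 controls slopes, and order 0, all that is known of \<rho>_t
  when s = 2, controls integrals over [0, x]. That is why a primitive of \<rho> is evolved in time
  instead of \<rho>.\<close>

lemma periodic1_of_nat: "periodic1 f \<Longrightarrow> f (x + of_nat n) = f x"
proof (induction n)
  case (Suc n)
  have "f (x + of_nat (Suc n)) = f ((x + of_nat n) + 1)" by (simp add: algebra_simps)
  then show ?case using Suc by (simp add: periodic1_def)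
qed simp

lemma periodic1_of_int: "periodic1 f \<Longrightarrow> f (x + of_int n) = f x"
proof (cases n)
  case (neg m)
  assume "periodic1 f"
  from periodic1_of_nat[OF this, of "x + of_int n" "Suc m"] show ?thesis
    unfolding neg by (simp add: algebra_simps)
qed (auto simp: periodic1_of_nat)

lemma periodic1_frac: "periodic1 f \<Longrightarrow> f (frac x) = f x"
  using periodic1_of_int[of f x "- \<lfloor>x\<rfloor>"] by (simp add: frac_def)

text \<open>Picard iteration in the sup norm weighted by \<open>exp (- 2 * L * t)\<close>. The
  weight makes the integral operator a contraction on all of \<open>{0..T}\<close> at once, so no
  short-time solutions have to be glued.\<close>

lemma bounded_ODE_solution:
  fixes f :: "real \<Rightarrow> real \<Rightarrow> real"
  assumes T: "0 < T" and L: "0 < L"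
    and cont: "continuous_on ({0..T} \<times> UNIV) (\<lambda>(t, x). f t x)"
    and lip: "\<And>t x y. t \<in> {0..T} \<Longrightarrow> \<bar>f t x - f t y\<bar> \<le> L * \<bar>x - y\<bar>"
    and bnd: "\<And>t x. t \<in> {0..T} \<Longrightarrow> \<bar>f t x\<bar> \<le> M"
  obtains q where "q 0 = x0"
    "\<And>t. t \<in> {0..T} \<Longrightarrow> (q has_real_derivative f t (q t)) (at t within {0..T})"
proof -
  \<comment> \<open>Bounded continuous functions live on the whole line; clamping the time freezes
    them outside \<open>{0..T}\<close> and keeps the space complete.\<close>
  define cl where "cl t = max 0 (min T t)" for t :: real
  have cl: "cl t \<in> {0..T}" for t using T by (auto simp: cl_def)
  have clid: "cl t = t" if "t \<in> {0..T}" for t using that by (auto simp: cl_def)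
  have clc: "continuous_on UNIV cl" unfolding cl_def by (intro continuous_intros)
  \<comment> \<open>The unknown \<open>w\<close> is the weighted displacement: the curve is x0 +
    \<open>exp (2 * L * t)\<close> times \<open>w t\<close>.\<close>
  define F where "F w = (\<lambda>\<tau>. f \<tau> (x0 + exp (2 * L * \<tau>) * apply_bcontfun w \<tau>))" for w :: "real \<Rightarrow>\<^sub>C real"
  have Fc: "continuous_on {0..T} (F w)" for w
    unfolding F_def
    by (rule continuous_on_compose2[OF cont, of _ "\<lambda>\<tau>. (\<tau>, _ \<tau>)", simplified])
       (auto intro!: continuous_intros)
  have Fcs: "continuous_on {0..t} (F w)" if "t \<in> {0..T}" for w t
    using that by (intro continuous_on_subset[OF Fc]) auto
  have Fi: "F w integrable_on {0..t}" if "t \<in> {0..T}" for w t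
    using Fcs[OF that] by (rule integrable_continuous_interval)
  define \<Psi> where "\<Psi> w t = exp (- (2 * L * cl t)) * integral {0..cl t} (F w)" for w t
  have Mn: "0 \<le> M" using bnd[of 0 0] T by auto
  have bI: "\<bar>integral {0..t} (F w)\<bar> \<le> M * T" if "t \<in> {0..T}" for w t
  proof -
    have "norm (integral {0..t} (F w)) \<le> M * (t - 0)"
      by (rule integral_bound) (use that bnd Fcs in \<open>auto simp: F_def\<close>)
    also have "\<dots> \<le> M * T" using that Mn by (intro mult_left_mono) auto
    finally show ?thesis by simp
  qed
  have "\<Psi> w \<in> bcontfun" for w
  proof (rule bcontfun_normI)
    show "continuous_on UNIV (\<Psi> w)" unfolding \<Psi>_def
      by (intro continuous_intros continuous_on_compose2[OF indefinite_integral_continuous_1[OF Fi[of T]] clc] clc)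
         (use cl T in auto)
    show "norm (\<Psi> w t) \<le> M * T" for t
    proof -
      have "\<bar>\<Psi> w t\<bar> = exp (- (2 * L * cl t)) * \<bar>integral {0..cl t} (F w)\<bar>"
        by (simp add: \<Psi>_def abs_mult)
      also have "\<dots> \<le> 1 * (M * T)"
        by (intro mult_mono bI cl) (use cl[of t] L in auto)
      finally show ?thesis by simp
    qed
  qed
  then have \<Psi>B: "apply_bcontfun (Bcontfun (\<Psi> w)) = \<Psi> w" for w
    by (simp add: Bcontfun_inverse)
  have "\<exists>!w. Bcontfun (\<Psi> w) = w"
  proof (rule banach_fix_type[of "1/2"])
    show "\<forall>v w. dist (Bcontfun (\<Psi> v)) (Bcontfun (\<Psi> w)) \<le> 1/2 * dist v w"
    proof (intro allI dist_bound)
      fix v w and t :: real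
      let ?s = "cl t"
      have s: "?s \<in> {0..T}" by (rule cl)
      have "integral {0..?s} (F v) - integral {0..?s} (F w) = integral {0..?s} (\<lambda>\<tau>. F v \<tau> - F w \<tau>)"
        using Fi[OF s] by (simp add: integral_diff)
      also have "\<bar>\<dots>\<bar> \<le> integral {0..?s} (\<lambda>\<tau>. L * dist v w * exp (2 * L * \<tau>))"
      proof (rule integral_norm_bound_integral[where 'a=real, unfolded real_norm_def])
        show "(\<lambda>\<tau>. F v \<tau> - F w \<tau>) integrable_on {0..?s}" using Fi[OF s] by (intro integrable_diff)
        show "(\<lambda>\<tau>. L * dist v w * exp (2 * L * \<tau>)) integrable_on {0..?s}"
          by (intro integrable_continuous_interval continuous_intros)
        fix \<tau> assume \<tau>: "\<tau> \<in> {0..?s}"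
        have "\<bar>F v \<tau> - F w \<tau>\<bar> \<le> L * \<bar>exp (2 * L * \<tau>) * (apply_bcontfun v \<tau> - apply_bcontfun w \<tau>)\<bar>"
          unfolding F_def using lip[of \<tau> "x0 + exp (2 * L * \<tau>) * apply_bcontfun v \<tau>" "x0 + exp (2 * L * \<tau>) * apply_bcontfun w \<tau>"] \<tau> s
          by (simp add: algebra_simps)
        also have "\<dots> = L * (exp (2 * L * \<tau>) * dist (apply_bcontfun v \<tau>) (apply_bcontfun w \<tau>))"
          by (simp add: abs_mult dist_real_def)
        also have "\<dots> \<le> L * (exp (2 * L * \<tau>) * dist v w)"
          using L by (intro mult_left_mono dist_bounded) auto
        finally show "\<bar>F v \<tau> - F w \<tau>\<bar> \<le> L * dist v w * exp (2 * L * \<tau>)" by (simp add: mult_ac)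
      qed
      \<comment> \<open>The exponent 2 L is twice the Lipschitz constant, so this integral produces
        the contraction factor 1/2.\<close>
      also have "integral {0..?s} (\<lambda>\<tau>. L * dist v w * exp (2 * L * \<tau>)) =
          dist v w / 2 * exp (2 * L * ?s) - dist v w / 2 * exp (2 * L * 0)"
      proof (intro integral_unique fundamental_theorem_of_calculus)
        show "((\<lambda>\<tau>. dist v w / 2 * exp (2 * L * \<tau>)) has_vector_derivative L * dist v w * exp (2 * L * \<tau>)) (at \<tau> within {0..?s})" for \<tau>
          unfolding has_real_derivative_iff_has_vector_derivative[symmetric]
          by (auto intro!: derivative_eq_intros)
      qed (use s in auto)
      also have "\<dots> \<le> dist v w / 2 * exp (2 * L * ?s)" by simp
      finally have *: "\<bar>integral {0..?s} (F v) - integral {0..?s} (F w)\<bar> \<le> dist v w / 2 * exp (2 * L * ?s)" .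
      have "dist (\<Psi> v t) (\<Psi> w t) = exp (- (2 * L * ?s)) * \<bar>integral {0..?s} (F v) - integral {0..?s} (F w)\<bar>"
        by (simp add: \<Psi>_def dist_real_def abs_mult flip: right_diff_distrib)
      also have "\<dots> \<le> exp (- (2 * L * ?s)) * (dist v w / 2 * exp (2 * L * ?s))"
        by (intro mult_left_mono *) auto
      also have "\<dots> = 1/2 * dist v w" by (simp add: exp_minus)
      finally show "dist (apply_bcontfun (Bcontfun (\<Psi> v)) t) (apply_bcontfun (Bcontfun (\<Psi> w)) t) \<le> 1/2 * dist v w"
        by (simp add: \<Psi>B)
    qed
  qed auto
  then obtain w where "Bcontfun (\<Psi> w) = w" by auto
  then have w: "apply_bcontfun w = \<Psi> w" by (metis \<Psi>B)
  define q where "q t = x0 + integral {0..t} (F w)" for t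
  have Fq: "F w t = f t (q t)" if "t \<in> {0..T}" for t
  proof -
    have "apply_bcontfun w t = exp (- (2 * L * t)) * integral {0..t} (F w)"
      by (subst w) (simp add: \<Psi>_def clid[OF that])
    then have "x0 + exp (2 * L * t) * apply_bcontfun w t = q t"
      by (simp add: q_def exp_minus)
    then show ?thesis by (simp add: F_def)
  qed
  show thesis
  proof (rule that)
    show "q 0 = x0" by (simp add: q_def)
    show "(q has_real_derivative f t (q t)) (at t within {0..T})" if t: "t \<in> {0..T}" for t
      unfolding Fq[OF t, symmetric] unfolding q_def
      using integral_has_real_derivative[OF Fc t, of w] by (auto intro!: derivative_eq_intros)
  qed
qed

text \<open>Multiplying by the integrating factor \<open>exp (- A t)\<close>, with \<open>A\<close>
  a primitive of \<open>m\<close>, turns \<open>r\<close> into a constant.\<close>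

lemma vanishing_linear_ODE:
  fixes r m :: "real \<Rightarrow> real"
  assumes m: "continuous_on {0..T} m"
    and r: "\<And>t. t \<in> {0..T} \<Longrightarrow> (r has_real_derivative m t * r t) (at t within {0..T})"
    and r0: "r 0 = 0" and t: "t \<in> {0..T}"
  shows "r t = 0"
proof -
  define A where "A t = integral {0..t} m" for t
  define g where "g t = r t * exp (- A t)" for t
  have "(g has_real_derivative 0) (at t within {0..T})" if "t \<in> {0..T}" for t
  proof -
    have A: "(A has_real_derivative m t) (at t within {0..T})"
      unfolding A_def by (rule integral_has_real_derivative[OF m that])
    show ?thesis unfolding g_def
      using DERIV_mult[OF r[OF that] DERIV_exp[THEN DERIV_chain2, OF DERIV_minus[OF A]]]
      by (simp add: algebra_simps)
  qed
  then obtain c where "\<And>s. s \<in> {0..T} \<Longrightarrow> g s = c"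
    using has_field_derivative_zero_constant[of "{0..T}" g] by auto
  then have "g t = g 0" using t by auto
  then show ?thesis by (simp add: g_def r0)
qed

text \<open>The angle arctan (m / sqrt E) advances at the constant rate sqrt E / 2, while all values
  of arctan lie in an open interval of length pi.\<close>

lemma Riccati_time_bound:
  fixes m :: "real \<Rightarrow> real"
  assumes E: "0 < E" and T: "0 < T"
    and m: "\<And>t. t \<in> {0..T} \<Longrightarrow> (m has_real_derivative (E + (m t)\<^sup>2) / 2) (at t within {0..T})"
  shows "sqrt E * T < 2 * pi"
proof -
  define \<theta> where "\<theta> t = arctan (m t / sqrt E)" for t
  have "(\<theta> has_real_derivative sqrt E / 2) (at t within {0..T})" if "t \<in> {0..T}" for t
  proof -
    have "(\<theta> has_real_derivative inverse (1 + (m t / sqrt E)\<^sup>2) * ((E + (m t)\<^sup>2) / 2 / sqrt E)) (at t within {0..T})"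
      unfolding \<theta>_def by (rule DERIV_chain2[OF DERIV_arctan]) (intro DERIV_cdivide m that)
    moreover have "inverse (1 + (m t / sqrt E)\<^sup>2) * ((E + (m t)\<^sup>2) / 2 / sqrt E) = sqrt E / 2"
    proof -
      have "1 + (m t / sqrt E)\<^sup>2 = (E + (m t)\<^sup>2) / E" using E by (simp add: power_divide field_simps)
      moreover have "E + (m t)\<^sup>2 > 0" using E by (simp add: add_pos_nonneg)
      ultimately have "inverse (1 + (m t / sqrt E)\<^sup>2) * ((E + (m t)\<^sup>2) / 2 / sqrt E) = E / (2 * sqrt E)"
        using E by (simp add: divide_simps)
      also have "\<dots> = sqrt E / 2" using E by (simp add: real_div_sqrt)
      finally show ?thesis .
    qed
    ultimately show ?thesis by metis
  qed
  then have "((\<lambda>t. \<theta> t - sqrt E / 2 * t) has_real_derivative 0) (at t within {0..T})" if "t \<in> {0..T}" for t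
    using that by (auto intro!: derivative_eq_intros)
  then obtain c where "\<And>t. t \<in> {0..T} \<Longrightarrow> \<theta> t - sqrt E / 2 * t = c"
    using has_field_derivative_zero_constant[of "{0..T}" "\<lambda>t. \<theta> t - sqrt E / 2 * t"] by auto
  from this[of 0] this[of T] T have "sqrt E / 2 * T = \<theta> T - \<theta> 0" by simp
  also have "\<dots> < pi" unfolding \<theta>_def using arctan_bounded[of "m T / sqrt E"] arctan_bounded[of "m 0 / sqrt E"] by linarith
  finally show ?thesis by simp
qed

section \<open>Transport along characteristics\<close>

text \<open>Periodicity in space reduces the unbounded strip to a compact rectangle, so these
  functions are bounded and uniformly continuous in x, uniformly in time.\<close>

definition strip :: "real \<Rightarrow> (real \<Rightarrow> real \<Rightarrow> real) \<Rightarrow> bool" where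
  "strip T f \<longleftrightarrow> continuous_on ({0..T} \<times> UNIV) (\<lambda>(t, x). f t x) \<and> (\<forall>t\<in>{0..T}. periodic1 (f t))"

lemma strip_continuous:
  assumes "strip T f"
  shows "continuous_on ({0..T} \<times> UNIV) (\<lambda>(t, x). f t x)"
  using assms by (simp add: strip_def)

lemma strip_continuous_compose:
  assumes "strip T f" "continuous_on S p" "continuous_on S r" "\<And>y. y \<in> S \<Longrightarrow> p y \<in> {0..T}"
  shows "continuous_on S (\<lambda>y. f (p y) (r y))"
proof -
  have "(\<lambda>y. (p y, r y)) ` S \<subseteq> {0..T} \<times> UNIV" using assms(4) by auto
  from continuous_on_compose2[OF strip_continuous[OF assms(1)] continuous_on_Pair[OF assms(2,3)] this]
  show ?thesis by simp
qed

lemma strip_continuous_slice: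
  assumes "strip T f" "t \<in> {0..T}"
  shows "continuous_on S (f t)"
  using assms by (intro strip_continuous_compose[OF assms(1)] continuous_intros) auto

lemma strip_bounded:
  assumes f: "strip T f"
  obtains M where "0 < M" "\<And>t x. t \<in> {0..T} \<Longrightarrow> \<bar>f t x\<bar> \<le> M"
proof -
  have "compact ((\<lambda>(t, x). f t x) ` ({0..T} \<times> {0..1}))"
    by (intro compact_continuous_image compact_Times continuous_on_subset[OF strip_continuous[OF f]]) auto
  from compact_imp_bounded[OF this] obtain M where M0: "M > 0"
    and b: "\<forall>y\<in>(\<lambda>(t, x). f t x) ` ({0..T} \<times> {0..1}). norm y \<le> M"
    unfolding bounded_pos by blast
  have M: "\<bar>f t x\<bar> \<le> M" if "t \<in> {0..T}" "x \<in> {0..1}" for t x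
    using b that by force
  have "\<bar>f t x\<bar> \<le> M" if t: "t \<in> {0..T}" for t x
  proof -
    have "f t (frac x) = f t x" using f t by (intro periodic1_frac) (simp add: strip_def)
    moreover have "frac x \<in> {0..1}" using frac_lt_1[of x] by (simp add: less_imp_le)
    ultimately show ?thesis using M[OF t, of "frac x"] by simp
  qed
  with M0 show thesis by (rule that)
qed

lemma strip_uniformly_continuous:
  assumes f: "strip T f" and e: "0 < e"
  obtains d where "0 < d" "\<And>t x y. t \<in> {0..T} \<Longrightarrow> \<bar>x - y\<bar> < d \<Longrightarrow> \<bar>f t x - f t y\<bar> < e"
proof -
  \<comment> \<open>The window is larger than one period: after shifting x into [0,1), a point y at
    distance less than 1 may leave [0,1] but stays in [-1,2].\<close>
  have "uniformly_continuous_on ({0..T} \<times> {-1..2}) (\<lambda>(t, x). f t x)"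
    by (intro compact_uniformly_continuous compact_Times continuous_on_subset[OF strip_continuous[OF f]]) auto
  then obtain d where d: "d > 0"
    "\<And>p p'. p \<in> {0..T} \<times> {-1..2} \<Longrightarrow> p' \<in> {0..T} \<times> {-1..2} \<Longrightarrow> dist p' p < d \<Longrightarrow>
       dist (case p' of (t, x) \<Rightarrow> f t x) (case p of (t, x) \<Rightarrow> f t x) < e"
    using e unfolding uniformly_continuous_on_def by metis
  show thesis
  proof (rule that)
    show "0 < min d 1" using d(1) by simp
    fix t x y :: real assume t: "t \<in> {0..T}" and xy: "\<bar>x - y\<bar> < min d 1"
    let ?n = "\<lfloor>x\<rfloor>"
    have x: "x - of_int ?n \<in> {-1..2}" and y: "y - of_int ?n \<in> {-1..2}"
      using xy by (auto; linarith)+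
    have "f t (x - of_int ?n) = f t x" "f t (y - of_int ?n) = f t y"
      using periodic1_of_int[of "f t" _ "- ?n"] f t by (auto simp: strip_def)
    moreover have "dist (f t (x - of_int ?n)) (f t (y - of_int ?n)) < e"
      using d(2)[of "(t, y - of_int ?n)" "(t, x - of_int ?n)"] t x y xy
      by (simp add: dist_Pair_Pair dist_real_def)
    ultimately show "\<bar>f t x - f t y\<bar> < e" by (simp add: dist_real_def)
  qed
qed

lemma strip_uniform_limit_shift:
  assumes f: "strip T f" and h: "h \<longlonglongrightarrow> 0"
  shows "uniform_limit ({0..T} \<times> UNIV) (\<lambda>n (t, x). f t (x + h n)) (\<lambda>(t, x). f t x) sequentially"
proof (rule uniform_limitI)
  fix e :: real assume "0 < e"
  then obtain d where d: "0 < d" "\<And>t x y. t \<in> {0..T} \<Longrightarrow> \<bar>x - y\<bar> < d \<Longrightarrow> \<bar>f t x - f t y\<bar> < e"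
    using strip_uniformly_continuous[OF f] by metis
  have "\<forall>\<^sub>F n in sequentially. \<bar>h n\<bar> < d"
    using tendstoD[OF h d(1)] by (simp add: dist_real_def)
  then show "\<forall>\<^sub>F n in sequentially. \<forall>p\<in>{0..T} \<times> UNIV.
      dist (case p of (t, x) \<Rightarrow> f t (x + h n)) (case p of (t, x) \<Rightarrow> f t x) < e"
    by eventually_elim (auto simp: dist_real_def intro!: d(2))
qed

text \<open>By the mean value theorem the quotient equals \<open>f'\<close> at a point closer than
  \<open>h n\<close> to x, so the uniform continuity of \<open>f'\<close> in x gives the rate for
  all times together.\<close>

lemma strip_uniform_limit_quotient:
  assumes f': "strip T f'" and h: "h \<longlonglongrightarrow> 0" "\<And>n. 0 < h n"
    and der: "\<And>t x. t \<in> {0..T} \<Longrightarrow> (f t has_real_derivative f' t x) (at x)"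
  shows "uniform_limit ({0..T} \<times> UNIV) (\<lambda>n (t, x). (f t (x + h n) - f t x) / h n) (\<lambda>(t, x). f' t x) sequentially"
proof (rule uniform_limitI)
  fix e :: real assume "0 < e"
  then obtain d where d: "0 < d" "\<And>t x y. t \<in> {0..T} \<Longrightarrow> \<bar>x - y\<bar> < d \<Longrightarrow> \<bar>f' t x - f' t y\<bar> < e"
    using strip_uniformly_continuous[OF f'] by metis
  have "\<forall>\<^sub>F n in sequentially. \<bar>h n\<bar> < d"
    using tendstoD[OF h(1) d(1)] by (simp add: dist_real_def)
  then show "\<forall>\<^sub>F n in sequentially. \<forall>p\<in>{0..T} \<times> UNIV.
      dist (case p of (t, x) \<Rightarrow> (f t (x + h n) - f t x) / h n) (case p of (t, x) \<Rightarrow> f' t x) < e"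
  proof (eventually_elim, clarsimp)
    fix n t x assume n: "\<bar>h n\<bar> < d" and t: "0 \<le> t" "t \<le> T"
    obtain z where z: "x < z" "z < x + h n" "f t (x + h n) - f t x = (x + h n - x) * f' t z"
      using MVT2[of x "x + h n" "f t" "f' t"] h(2)[of n] der t by (metis atLeastAtMost_iff less_add_same_cancel1)
    have "\<bar>f' t z - f' t x\<bar> < e" using n z t by (intro d(2)) auto
    moreover have "(f t (x + h n) - f t x) / h n = f' t z" using z(3) h(2)[of n] by simp
    ultimately show "dist ((f t (x + h n) - f t x) / h n) (f' t x) < e" by (simp add: dist_real_def)
  qed
qed

lemma strip_image_bounded:
  assumes "strip T f"
  shows "bounded ((\<lambda>(t, x). f t x) ` ({0..T} \<times> UNIV))"
proof -
  obtain M where "\<And>t x. t \<in> {0..T} \<Longrightarrow> \<bar>f t x\<bar> \<le> M" using strip_bounded[OF assms] by metis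
  then show ?thesis by (intro boundedI[of _ M]) auto
qed

section \<open>Passing to the limit in derivatives and integrals\<close>

lemma has_real_derivative_uniform_limit:
  fixes f f' :: "nat \<Rightarrow> real \<Rightarrow> real"
  assumes der: "\<And>n t. t \<in> {0..T} \<Longrightarrow> (f n has_real_derivative f' n t) (at t within {0..T})"
    and unif: "uniform_limit {0..T} f' g' sequentially"
    and lim: "\<And>t. t \<in> {0..T} \<Longrightarrow> (\<lambda>n. f n t) \<longlonglongrightarrow> g t"
    and t: "t \<in> {0..T}"
  shows "(g has_real_derivative g' t) (at t within {0..T})"
proof -
  have "\<exists>G. \<forall>s\<in>{0..T}. (\<lambda>n. f n s) \<longlonglongrightarrow> G s \<and> (G has_derivative (*) (g' s)) (at s within {0..T})"
  proof (rule has_derivative_sequence[where f' = "\<lambda>n s. (*) (f' n s)"])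
    show "(f n has_derivative (*) (f' n s)) (at s within {0..T})" if "s \<in> {0..T}" for n s
      using der[OF that, of n] by (simp add: has_field_derivative_def)
    show "(\<lambda>n. f n t) \<longlonglongrightarrow> g t" by (rule lim[OF t])
    fix e :: real assume "0 < e"
    from uniform_limitD[OF unif this]
    show "\<forall>\<^sub>F n in sequentially. \<forall>s\<in>{0..T}. \<forall>h. norm (f' n s * h - g' s * h) \<le> e * norm h"
    proof (eventually_elim, safe)
      fix n s h assume *: "\<forall>s\<in>{0..T}. dist (f' n s) (g' s) < e" and s: "s \<in> {0..T}"
      have "norm (f' n s * h - g' s * h) = dist (f' n s) (g' s) * norm h"
        by (simp only: dist_norm norm_mult[symmetric] left_diff_distrib[symmetric])
      also have "\<dots> \<le> e * norm h" using * s by (intro mult_right_mono) (auto intro: less_imp_le)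
      finally show "norm (f' n s * h - g' s * h) \<le> e * norm h" .
    qed
  qed (use t in auto)
  then obtain G where G: "\<And>s. s \<in> {0..T} \<Longrightarrow> (\<lambda>n. f n s) \<longlonglongrightarrow> G s"
    "(G has_real_derivative g' t) (at t within {0..T})"
    using t unfolding has_field_derivative_def by blast
  \<comment> \<open>The theorem on sequences of derivatives only provides some limit function;
    uniqueness of pointwise limits identifies it with \<open>g\<close>.\<close>
  have "G s = g s" if "s \<in> {0..T}" for s
    using G(1)[OF that] lim[OF that] by (rule LIMSEQ_unique)
  then show ?thesis
    unfolding has_field_derivative_def
    by (intro has_derivative_transform[OF t _ G(2)[unfolded has_field_derivative_def]]) auto
qed

lemma bounded_image_mult:
  fixes F G :: "'a \<Rightarrow> real"
  assumes "bounded (F ` S)" "bounded (G ` S)"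
  shows "bounded ((\<lambda>p. F p * G p) ` S)"
proof -
  obtain A where A: "\<And>p. p \<in> S \<Longrightarrow> \<bar>F p\<bar> \<le> A" using assms(1) by (auto simp: bounded_iff)
  obtain C where C: "\<And>p. p \<in> S \<Longrightarrow> \<bar>G p\<bar> \<le> C" using assms(2) by (auto simp: bounded_iff)
  have "norm (F p * G p) \<le> A * C" if "p \<in> S" for p
    using mult_mono'[OF A[OF that] C[OF that]] by (simp add: abs_mult)
  then show ?thesis by (intro boundedI[of _ "A * C"]) auto
qed

lemma uniform_limit_integral_strip:
  fixes F :: "nat \<Rightarrow> real \<Rightarrow> real \<Rightarrow> real"
  assumes F: "uniform_limit (S \<times> UNIV) (\<lambda>n (t, x). F n t x) (\<lambda>(t, x). F' t x) sequentially"
    and c: "\<And>n t. t \<in> S \<Longrightarrow> continuous_on {0..1} (F n t)"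
    and c': "\<And>t. t \<in> S \<Longrightarrow> continuous_on {0..1} (F' t)"
  shows "uniform_limit S (\<lambda>n t. integral {0..1} (F n t)) (\<lambda>t. integral {0..1} (F' t)) sequentially"
proof (rule uniform_limitI)
  fix e :: real assume "0 < e"
  then have "0 < e / 2" by simp
  from uniform_limitD[OF F this]
  show "\<forall>\<^sub>F n in sequentially. \<forall>t\<in>S. dist (integral {0..1} (F n t)) (integral {0..1} (F' t)) < e"
  proof (eventually_elim, safe)
    fix n t assume *: "\<forall>p\<in>S \<times> UNIV. dist (case p of (t, x) \<Rightarrow> F n t x) (case p of (t, x) \<Rightarrow> F' t x) < e / 2"
      and t: "t \<in> S"
    have "integral {0..1} (F n t) - integral {0..1} (F' t) = integral {0..1} (\<lambda>x. F n t x - F' t x)"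
      by (intro integral_diff[symmetric] integrable_continuous_interval c c' t)
    moreover have "norm (integral {0..1} (\<lambda>x. F n t x - F' t x)) \<le> e / 2 * (1 - 0)"
    proof (rule integral_bound)
      show "continuous_on {0..1} (\<lambda>x. F n t x - F' t x)" by (intro continuous_on_diff c c' t)
      show "norm (F n t x - F' t x) \<le> e / 2" for x
        using bspec[OF *, of "(t, x)"] t by (simp add: dist_real_def)
    qed simp
    ultimately show "dist (integral {0..1} (F n t)) (integral {0..1} (F' t)) < e"
      using \<open>0 < e\<close> by (simp add: dist_norm)
  qed
qed

text \<open>The pair \<open>(w, v)\<close> will be \<open>u\<close> and \<open>u\<^sub>x\<close>, or a primitive of \<open>\<rho>\<close> and \<open>\<rho>\<close>; only \<open>w\<close> is assumed to be
  differentiable in time.\<close>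

locale transport =
  fixes T :: real and a ax w v g k :: "real \<Rightarrow> real \<Rightarrow> real"
  assumes a: "strip T a" and ax: "strip T ax" and v: "strip T v" and k: "strip T k"
    and g: "continuous_on ({0..T} \<times> UNIV) (\<lambda>(t, x). g t x)"
    and a_x: "\<And>t x. t \<in> {0..T} \<Longrightarrow> (a t has_real_derivative ax t x) (at x)"
    and w_x: "\<And>t x. t \<in> {0..T} \<Longrightarrow> (w t has_real_derivative v t x) (at x)"
    and g_x: "\<And>t x. t \<in> {0..T} \<Longrightarrow> (g t has_real_derivative k t x) (at x)"
    and w_t: "\<And>t x. t \<in> {0..T} \<Longrightarrow>
      ((\<lambda>s. w s x) has_real_derivative a t x * v t x + g t x) (at t within {0..T})"
begin

text \<open>Joint differentiability follows from both partial derivatives and the continuity of one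
  of them; the continuous one is the space derivative \<open>v\<close>.\<close>

lemma joint_derivative:
  assumes t: "t \<in> {0..T}"
  shows "((\<lambda>(s, x). w s x) has_derivative
      (\<lambda>(ds, dx). (a t y * v t y + g t y) * ds + blinfun_apply (blinfun_mult_right (v t y)) dx))
      (at (t, y) within {0..T} \<times> UNIV)"
proof (rule has_derivative_partialsI)
  show "((\<lambda>s. w s y) has_derivative (*) (a t y * v t y + g t y)) (at t within {0..T})"
    using w_t[OF t, of y] by (simp add: has_field_derivative_def)
  show "(w s has_derivative blinfun_apply (blinfun_mult_right (v s z))) (at z within UNIV)" if "s \<in> {0..T}" for s z
    using w_x[OF that, of z] by (simp add: has_field_derivative_def)
  have "continuous_on ({0..T} \<times> UNIV) (\<lambda>(s, x). blinfun_mult_right (v s x))"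
    using bounded_linear.continuous_on[OF bounded_linear_blinfun_mult_right strip_continuous[OF v]]
    by (simp add: split_beta')
  then show "continuous (at (t, y) within {0..T} \<times> UNIV) (\<lambda>(s, x). blinfun_mult_right (v s x))"
    using t by (auto simp: continuous_on_eq_continuous_within)
qed auto

text \<open>The curve q + c moves with the velocity of q, so the transport term cancels only up to
  the difference of \<open>a\<close> at the two points. Divided by c, this difference becomes the
  factor \<open>ax\<close> as c tends to 0.\<close>

lemma along_shifted_characteristic:
  assumes q: "(q has_real_derivative - a t (q t)) (at t within {0..T})" and t: "t \<in> {0..T}"
  shows "((\<lambda>t. w t (q t + c)) has_real_derivative
    (a t (q t + c) - a t (q t)) * v t (q t + c) + g t (q t + c)) (at t within {0..T})"
proof -
  have "((\<lambda>s. (s, q s + c)) has_derivative (\<lambda>ds. (ds, - a t (q t) * ds))) (at t within {0..T})"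
    using q by (auto simp: has_field_derivative_def intro!: derivative_eq_intros)
  moreover have "(\<lambda>s. (s, q s + c)) ` {0..T} \<subseteq> {0..T} \<times> UNIV" by auto
  note has_derivative_subset[OF joint_derivative[OF t, of "q t + c"] this]
  ultimately have "((\<lambda>s. (\<lambda>(s, x). w s x) (s, q s + c)) has_derivative
      (\<lambda>ds. (\<lambda>(ds, dx). (a t (q t + c) * v t (q t + c) + g t (q t + c)) * ds + blinfun_apply (blinfun_mult_right (v t (q t + c))) dx) (ds, - a t (q t) * ds))) (at t within {0..T})"
    by (rule has_derivative_in_compose)
  then show ?thesis
    unfolding has_field_derivative_def prod.case by (rule has_derivative_eq_rhs) (simp add: algebra_simps fun_eq_iff)
qed

text \<open>Formally, differentiating w_t = a v + g in x gives v_t - a v_x = ax v + k, and the left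
  side is the derivative of v along q. Comparing \<open>w\<close> on the curves q and q + h yields
  the same result without v_x.\<close>

lemma along_characteristic:
  assumes q: "\<And>t. t \<in> {0..T} \<Longrightarrow> (q has_real_derivative - a t (q t)) (at t within {0..T})"
    and t: "t \<in> {0..T}"
  shows "((\<lambda>t. v t (q t)) has_real_derivative k t (q t) + ax t (q t) * v t (q t)) (at t within {0..T})"
proof -
  define h where "h n = inverse (real (Suc n))" for n
  have h: "h \<longlonglongrightarrow> 0" "\<And>n. 0 < h n"
    unfolding h_def using LIMSEQ_inverse_real_of_nat by simp_all
  show ?thesis
  proof (rule has_real_derivative_uniform_limit[OF _ _ _ t])
    fix t assume t: "t \<in> {0..T}"
    show "((\<lambda>t. (w t (q t + h n) - w t (q t)) / h n) has_real_derivative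
      ((g t (q t + h n) - g t (q t)) / h n + (a t (q t + h n) - a t (q t)) / h n * v t (q t + h n)))
        (at t within {0..T})" for n
      using DERIV_cdivide[OF DERIV_diff[OF along_shifted_characteristic[OF q[OF t] t, of "h n"]
        along_shifted_characteristic[OF q[OF t] t, of 0, simplified add_0_right]], of "h n"]
      by (rule DERIV_cong) (simp add: add_divide_distrib diff_divide_distrib left_diff_distrib)
    show "(\<lambda>n. (w t (q t + h n) - w t (q t)) / h n) \<longlonglongrightarrow> v t (q t)"
      using tendsto_uniform_limitI[OF strip_uniform_limit_quotient[OF v h w_x], of "(t, q t)"] t by simp
  next
    have "uniform_limit ({0..T} \<times> UNIV)
        (\<lambda>n p. (case p of (t, x) \<Rightarrow> (g t (x + h n) - g t x) / h n)
          + (case p of (t, x) \<Rightarrow> (a t (x + h n) - a t x) / h n) * (case p of (t, x) \<Rightarrow> v t (x + h n)))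
        (\<lambda>p. (case p of (t, x) \<Rightarrow> k t x) + (case p of (t, x) \<Rightarrow> ax t x) * (case p of (t, x) \<Rightarrow> v t x)) sequentially"
      by (intro uniform_limit_add uniform_lim_mult strip_uniform_limit_quotient strip_uniform_limit_shift
        strip_image_bounded a_x g_x h k ax v)
    then show "uniform_limit {0..T} (\<lambda>n t. (g t (q t + h n) - g t (q t)) / h n + (a t (q t + h n) - a t (q t)) / h n * v t (q t + h n))
       (\<lambda>t. k t (q t) + ax t (q t) * v t (q t)) sequentially"
      using uniform_limit_compose'[of _ _ _ _ "\<lambda>t. (t, q t)" "{0..T}"] by fastforce
  qed
qed

text \<open>Formally the derivative is the integral of 2 v (a v_x + ax v + k); integrating a (v^2)_x
  by parts over a period turns this into ax v^2 + 2 v k. The computation is made for the quotient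
  \<open>D n\<close> of \<open>w\<close>, which is differentiable in both variables, and then n
  tends to infinity.\<close>

lemma energy_derivative:
  assumes t: "t \<in> {0..T}"
  shows "((\<lambda>t. integral {0..1} (\<lambda>x. (v t x)\<^sup>2)) has_real_derivative
    integral {0..1} (\<lambda>x. ax t x * (v t x)\<^sup>2 + 2 * v t x * k t x)) (at t within {0..T})"
proof -
  define h where "h n = inverse (real (Suc n))" for n
  have h: "h \<longlonglongrightarrow> 0" "\<And>n. 0 < h n"
    unfolding h_def using LIMSEQ_inverse_real_of_nat by simp_all
  define D where "D n t x = (w t (x + h n) - w t x) / h n" for n t x
  define Da where "Da n t x = (a t (x + h n) - a t x) / h n" for n t x
  define Dg where "Dg n t x = (g t (x + h n) - g t x) / h n" for n t x
  define Dv where "Dv n t x = (v t (x + h n) - v t x) / h n" for n t x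
  \<comment> \<open>\<open>B\<close> is what remains of the time derivative of (D n)^2 after
    integration by parts. It no longer contains \<open>Dv n\<close>, whose limit would be the
    possibly missing v_x.\<close>
  define B where "B n t x = 2 * D n t x * v t x * Da n t x + 2 * D n t x * Dg n t x - ax t (x + h n) * (D n t x)\<^sup>2" for n t x
  have gc: "continuous_on S (\<lambda>y. g (p y) (r y))"
    if "continuous_on S p" "continuous_on S r" "\<And>y. y \<in> S \<Longrightarrow> p y \<in> {0..T}" for S :: "'z :: topological_space set" and p r
  proof -
    have "(\<lambda>y. (p y, r y)) ` S \<subseteq> {0..T} \<times> UNIV" using that(3) by auto
    from continuous_on_compose2[OF g continuous_on_Pair[OF that(1,2)] this] show ?thesis by simp
  qed
  have wc: "continuous_on S (\<lambda>y. w t (r y))"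
    if "continuous_on S r" "t \<in> {0..T}" for S :: "real set" and r t
    using continuous_on_compose2[OF DERIV_continuous_on[OF w_x[OF that(2), THEN DERIV_subset]] that(1)] by auto
  have wc2: "continuous_on ({0..T} \<times> UNIV) (\<lambda>(t, x). w t x)"
    unfolding continuous_on_eq_continuous_within
    using has_derivative_continuous[OF joint_derivative] by auto
  have wc': "continuous_on S (\<lambda>y. w (p y) (r y))"
    if "continuous_on S p" "continuous_on S r" "\<And>y. y \<in> S \<Longrightarrow> p y \<in> {0..T}" for S :: "(real \<times> real) set" and p r
  proof -
    have "(\<lambda>y. (p y, r y)) ` S \<subseteq> {0..T} \<times> UNIV" using that(3) by auto
    from continuous_on_compose2[OF wc2 continuous_on_Pair[OF that(1,2)] this] show ?thesis by simp
  qed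
  have hn: "h n \<noteq> 0" for n using h(2)[of n] by simp
  have Dc: "continuous_on S (D n t)" if "t \<in> {0..T}" for S n t
    unfolding D_def using that hn by (intro continuous_intros wc) auto
  have Bc: "continuous_on {0..1} (B n t)" if "t \<in> {0..T}" for n t
    unfolding B_def Da_def Dg_def using that hn
    by (intro continuous_intros gc strip_continuous_compose[OF a] strip_continuous_compose[OF v] strip_continuous_compose[OF ax] Dc) auto
  \<comment> \<open>\<open>w\<close> may be a primitive of \<rho> and hence not periodic, but its
    increment over one period does not depend on x, so its difference quotients are
    periodic.\<close>
  have D_per: "D n t (x + 1) = D n t x" if t: "t \<in> {0..T}" for n t x
  proof -
    have "((\<lambda>x. w t (x + 1) - w t x) has_real_derivative 0) (at x)" for x
    proof -
      have "((\<lambda>x. w t (x + 1) - w t x) has_real_derivative v t (x + 1) - v t x) (at x)"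
        by (intro DERIV_diff w_x[OF t] DERIV_shift[THEN iffD1])
      then show ?thesis using v t by (simp add: strip_def periodic1_def)
    qed
    then have "w t (x + h n + 1) - w t (x + h n) = w t (x + 1) - w t x"
      using DERIV_isconst_all[of "\<lambda>x. w t (x + 1) - w t x"] by blast
    then show ?thesis by (simp add: D_def algebra_simps)
  qed
  have D_x: "(D n t has_real_derivative Dv n t x) (at x)" if "t \<in> {0..T}" for n t x
    unfolding D_def Dv_def by (intro DERIV_cdivide DERIV_diff w_x[OF that] DERIV_shift[THEN iffD1])
  have parts: "integral {0..1} (\<lambda>x. 2 * D n t x * (a t (x + h n) * Dv n t x + v t x * Da n t x + Dg n t x))
      = integral {0..1} (B n t)" if t: "t \<in> {0..T}" for n t
  proof -
    have "((\<lambda>x. 2 * D n t x * (a t (x + h n) * Dv n t x) + ax t (x + h n) * (D n t x)\<^sup>2) has_integral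
        (a t (1 + h n) * (D n t 1)\<^sup>2 - a t (0 + h n) * (D n t 0)\<^sup>2)) {0..1}"
    proof (rule fundamental_theorem_of_calculus, simp)
      fix x
      have "((\<lambda>x. a t (x + h n)) has_real_derivative ax t (x + h n)) (at x)"
        using a_x[OF t, of "x + h n"] by (simp add: DERIV_shift)
      then have "((\<lambda>x. a t (x + h n) * (D n t x)\<^sup>2) has_real_derivative
        2 * D n t x * (a t (x + h n) * Dv n t x) + ax t (x + h n) * (D n t x)\<^sup>2) (at x)"
        by (rule DERIV_cong[OF DERIV_mult[OF _ DERIV_power[OF D_x[OF t], where n=2]]])
           (simp add: algebra_simps)
      then show "((\<lambda>x. a t (x + h n) * (D n t x)\<^sup>2) has_vector_derivative
        2 * D n t x * (a t (x + h n) * Dv n t x) + ax t (x + h n) * (D n t x)\<^sup>2) (at x within {0..1})"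
        by (simp add: has_real_derivative_iff_has_vector_derivative has_vector_derivative_at_within)
    qed
    moreover have "a t (1 + h n) * (D n t 1)\<^sup>2 - a t (0 + h n) * (D n t 0)\<^sup>2 = 0"
    proof -
      have "a t (h n + 1) = a t (h n)" using a t by (simp add: strip_def periodic1_def)
      then show ?thesis using D_per[OF t, of n 0] by (simp add: add.commute[of 1])
    qed
    ultimately have "((\<lambda>x. 2 * D n t x * (a t (x + h n) * Dv n t x) + ax t (x + h n) * (D n t x)\<^sup>2) has_integral 0) {0..1}"
      by simp
    moreover have "(B n t has_integral integral {0..1} (B n t)) {0..1}"
      using Bc[OF t] by (intro integrable_integral integrable_continuous_interval)
    ultimately have "((\<lambda>x. (2 * D n t x * (a t (x + h n) * Dv n t x) + ax t (x + h n) * (D n t x)\<^sup>2) + B n t x)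
        has_integral (0 + integral {0..1} (B n t))) {0..1}"
      by (rule has_integral_add)
    then show ?thesis by (intro integral_unique) (simp add: B_def algebra_simps)
  qed
  have D_unif: "uniform_limit ({0..T} \<times> UNIV) (\<lambda>n (t, x). D n t x) (\<lambda>(t, x). v t x) sequentially"
    unfolding D_def by (rule strip_uniform_limit_quotient[OF v h w_x])
  show ?thesis
  proof (rule has_real_derivative_uniform_limit[OF _ _ _ t])
    fix t assume t: "t \<in> {0..T}"
    show "((\<lambda>t. integral {0..1} (\<lambda>x. (D n t x)\<^sup>2)) has_real_derivative integral {0..1} (B n t)) (at t within {0..T})" for n
      unfolding parts[OF t, symmetric]
    proof (rule leibniz_rule_field_derivative[where a=0 and b="1::real", unfolded cbox_interval])
      fix s x :: real assume s': "s \<in> {0..T}"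
      have "((\<lambda>s. D n s x) has_real_derivative a s (x + h n) * Dv n s x + v s x * Da n s x + Dg n s x) (at s within {0..T})"
      proof -
        have "((\<lambda>s. D n s x) has_real_derivative ((a s (x + h n) * v s (x + h n) + g s (x + h n)) - (a s x * v s x + g s x)) / h n) (at s within {0..T})"
          unfolding D_def by (intro DERIV_cdivide DERIV_diff w_t s')
        \<comment> \<open>Discrete product rule: the shift is put on \<open>a\<close>, the quotient
          of \<open>a\<close> is paired with the unshifted \<open>v\<close>.\<close>
        moreover have "((a s (x + h n) * v s (x + h n) + g s (x + h n)) - (a s x * v s x + g s x)) / h n
            = a s (x + h n) * Dv n s x + v s x * Da n s x + Dg n s x"
          using hn[of n] by (simp add: Dv_def Da_def Dg_def field_simps)
        ultimately show ?thesis by simp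
      qed
      from DERIV_power[OF this, of 2]
      show "((\<lambda>s. (D n s x)\<^sup>2) has_real_derivative 2 * D n s x * (a s (x + h n) * Dv n s x + v s x * Da n s x + Dg n s x)) (at s within {0..T})"
        by (rule DERIV_cong) (simp add: mult_ac)
    next
      show "(\<lambda>x. (D n s x)\<^sup>2) integrable_on {0..1}" if "s \<in> {0..T}" for s
        using that by (intro integrable_continuous_interval continuous_intros Dc) auto
      show "continuous_on ({0..T} \<times> {0..1}) (\<lambda>(s, x). 2 * D n s x * (a s (x + h n) * Dv n s x + v s x * Da n s x + Dg n s x))"
        unfolding D_def Dv_def Da_def Dg_def split_beta' using hn
        by (intro continuous_intros gc wc' strip_continuous_compose[OF a] strip_continuous_compose[OF v]) auto
    qed (use t in auto)
    have "uniform_limit ({0..T} \<times> UNIV) (\<lambda>n (t, x). (D n t x)\<^sup>2) (\<lambda>(t, x). (v t x)\<^sup>2) sequentially"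
      using uniform_lim_mult[OF D_unif D_unif strip_image_bounded[OF v] strip_image_bounded[OF v]]
      by (simp add: split_beta' power2_eq_square)
    then have "uniform_limit {0..T} (\<lambda>n t. integral {0..1} (\<lambda>x. (D n t x)\<^sup>2)) (\<lambda>t. integral {0..1} (\<lambda>x. (v t x)\<^sup>2)) sequentially"
      by (rule uniform_limit_integral_strip) (intro continuous_intros Dc strip_continuous_slice[OF v]; assumption)+
    from tendsto_uniform_limitI[OF this t]
    show "(\<lambda>n. integral {0..1} (\<lambda>x. (D n t x)\<^sup>2)) \<longlonglongrightarrow> integral {0..1} (\<lambda>x. (v t x)\<^sup>2)" .
  next
    have Da: "uniform_limit ({0..T} \<times> UNIV) (\<lambda>n (t, x). Da n t x) (\<lambda>(t, x). ax t x) sequentially"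
      unfolding Da_def by (rule strip_uniform_limit_quotient[OF ax h a_x])
    have Dg: "uniform_limit ({0..T} \<times> UNIV) (\<lambda>n (t, x). Dg n t x) (\<lambda>(t, x). k t x) sequentially"
      unfolding Dg_def by (rule strip_uniform_limit_quotient[OF k h g_x])
    have "uniform_limit ({0..T} \<times> UNIV)
      (\<lambda>n p. (2 * (case p of (t, x) \<Rightarrow> D n t x) * (case p of (t, x) \<Rightarrow> v t x)) * (case p of (t, x) \<Rightarrow> Da n t x)
         + (2 * (case p of (t, x) \<Rightarrow> D n t x)) * (case p of (t, x) \<Rightarrow> Dg n t x)
         - (case p of (t, x) \<Rightarrow> ax t (x + h n)) * ((case p of (t, x) \<Rightarrow> D n t x) * (case p of (t, x) \<Rightarrow> D n t x)))
      (\<lambda>p. (2 * (case p of (t, x) \<Rightarrow> v t x) * (case p of (t, x) \<Rightarrow> v t x)) * (case p of (t, x) \<Rightarrow> ax t x)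
         + (2 * (case p of (t, x) \<Rightarrow> v t x)) * (case p of (t, x) \<Rightarrow> k t x)
         - (case p of (t, x) \<Rightarrow> ax t x) * ((case p of (t, x) \<Rightarrow> v t x) * (case p of (t, x) \<Rightarrow> v t x))) sequentially"
      by (intro uniform_limit_add uniform_limit_minus uniform_lim_mult D_unif Da Dg strip_uniform_limit_shift
          uniform_limit_const bounded_image_mult strip_image_bounded h a k ax v) (auto intro!: boundedI[of _ 2])
    moreover have "(\<lambda>n (t, x). B n t x) = (\<lambda>n p. (2 * (case p of (t, x) \<Rightarrow> D n t x) * (case p of (t, x) \<Rightarrow> v t x)) * (case p of (t, x) \<Rightarrow> Da n t x)
         + (2 * (case p of (t, x) \<Rightarrow> D n t x)) * (case p of (t, x) \<Rightarrow> Dg n t x)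
         - (case p of (t, x) \<Rightarrow> ax t (x + h n)) * ((case p of (t, x) \<Rightarrow> D n t x) * (case p of (t, x) \<Rightarrow> D n t x)))"
      by (simp add: B_def split_beta' power2_eq_square)
    moreover have "(\<lambda>(t, x). ax t x * (v t x)\<^sup>2 + 2 * v t x * k t x) =
      (\<lambda>p. (2 * (case p of (t, x) \<Rightarrow> v t x) * (case p of (t, x) \<Rightarrow> v t x)) * (case p of (t, x) \<Rightarrow> ax t x)
         + (2 * (case p of (t, x) \<Rightarrow> v t x)) * (case p of (t, x) \<Rightarrow> k t x)
         - (case p of (t, x) \<Rightarrow> ax t x) * ((case p of (t, x) \<Rightarrow> v t x) * (case p of (t, x) \<Rightarrow> v t x)))"
      by (simp add: split_beta' power2_eq_square algebra_simps)
    ultimately have "uniform_limit ({0..T} \<times> UNIV) (\<lambda>n (t, x). B n t x) (\<lambda>(t, x). ax t x * (v t x)\<^sup>2 + 2 * v t x * k t x) sequentially"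
      by metis
    then show "uniform_limit {0..T} (\<lambda>n t. integral {0..1} (B n t))
      (\<lambda>t. integral {0..1} (\<lambda>x. ax t x * (v t x)\<^sup>2 + 2 * v t x * k t x)) sequentially"
      by (rule uniform_limit_integral_strip)
         (intro Bc continuous_intros strip_continuous_slice[OF v] strip_continuous_slice[OF k] strip_continuous_slice[OF ax]; assumption)+
  qed
qed

end

section \<open>Lebesgue integration on an interval\<close>

lemma absolutely_integrable_continuous_mult:
  fixes a f :: "real \<Rightarrow> 'a::{euclidean_space, real_normed_algebra}"
  assumes a: "continuous_on {l..b} a" and f: "f absolutely_integrable_on {l..b}"
  shows "(\<lambda>z. a z * f z) absolutely_integrable_on {l..b}"
proof (rule absolutely_integrable_bounded_measurable_product[of "(*)"])
  show "bilinear ((*) :: 'a \<Rightarrow> 'a \<Rightarrow> 'a)"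
    using bounded_bilinear_mult bilinear_conv_bounded_bilinear by blast
  show "bounded (a ` {l..b})"
    using a by (intro compact_imp_bounded compact_continuous_image) auto
qed (use a f in \<open>auto intro: continuous_imp_measurable_on_sets_lebesgue\<close>)

text \<open>The difference \<open>Q\<close> of the two sides, as a function of the upper limit, has derivative zero: its
  increments are bounded by the product of the increments of the upper limit and of the integral
  of \<open>norm f\<close>.\<close>

lemma absolutely_integrable_by_parts:
  fixes a a' f :: "real \<Rightarrow> 'a::{euclidean_space, real_normed_algebra}"
  assumes lb: "l \<le> b" and f: "f absolutely_integrable_on {l..b}"
    and a: "\<And>z. z \<in> {l..b} \<Longrightarrow> (a has_vector_derivative a' z) (at z within {l..b})"
    and a': "continuous_on {l..b} a'"
    and G: "\<And>z. z \<in> {l..b} \<Longrightarrow> G z = c + integral {l..z} f"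
  shows "((\<lambda>z. a z * f z + a' z * G z) has_integral (a b * G b - a l * G l)) {l..b}"
proof -
  have ac: "continuous_on {l..b} a"
    using a has_vector_derivative_continuous continuous_on_eq_continuous_within by blast
  have fi: "f integrable_on {l..b}" and Nfi: "(\<lambda>z. norm (f z)) integrable_on {l..b}"
    using f by (auto simp: absolutely_integrable_on_def)
  have Gc: "continuous_on {l..b} G"
    by (rule continuous_on_eq[of _ "\<lambda>z. c + integral {l..z} f"])
       (auto intro!: continuous_intros indefinite_integral_continuous_1 fi simp: G)
  have afi: "(\<lambda>z. a z * f z) integrable_on {l..b}"
    using absolutely_integrable_continuous_mult[OF ac f] by (simp add: absolutely_integrable_on_def)
  have a'Gi: "(\<lambda>z. a' z * G z) integrable_on {l..b}"
    by (intro integrable_continuous_interval continuous_intros a' Gc)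
  define h where "h z = a z * f z + a' z * G z" for z
  have hi: "h integrable_on {l..b}" unfolding h_def by (rule integrable_add[OF afi a'Gi])
  define Q where "Q x = a x * G x - integral {l..x} h" for x
  define N where "N x = integral {l..x} (\<lambda>z. norm (f z))" for x
  obtain L where L: "0 \<le> L" "\<And>z. z \<in> {l..b} \<Longrightarrow> norm (a' z) \<le> L"
    using compact_imp_bounded[OF compact_continuous_image[OF a' compact_Icc]] unfolding bounded_pos
    by (metis imageI less_imp_le)
  have aL: "norm (a y - a x) \<le> L * \<bar>y - x\<bar>" if "x \<in> {l..b}" "y \<in> {l..b}" for x y
    using differentiable_bound[of "{l..b}" a "\<lambda>z h. h *\<^sub>R a' z" L y x] a that L
    by (auto simp: has_vector_derivative_def onorm_scaleR_left onorm_id bounded_linear_ident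
        intro!: onorm_le simp: mult.commute[of L] mult_right_mono)
  have main: "norm (Q y - Q x) \<le> 2 * L * (y - x) * (N y - N x)"
    if xy: "x \<in> {l..b}" "y \<in> {l..b}" "x \<le> y" for x y
  proof -
    have comb: "integral {l..y} F - integral {l..x} F = integral {x..y} F"
      if "F integrable_on {l..b}" for F :: "real \<Rightarrow> 'c::euclidean_space"
    proof -
      have "F integrable_on {l..y}" using that by (rule integrable_on_subinterval) (use xy in auto)
      from Henstock_Kurzweil_Integration.integral_combine[OF _ _ this, of x] xy show ?thesis by (simp add: algebra_simps)
    qed
    have sub: "F integrable_on {x..y}" if "F integrable_on {l..b}" for F :: "real \<Rightarrow> 'c::euclidean_space"
      using that by (rule integrable_on_subinterval) (use xy in auto)
    have Gd: "G y - G z = integral {z..y} f" if "z \<in> {x..y}" for z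
    proof -
      have "f integrable_on {l..y}" using fi by (rule integrable_on_subinterval) (use xy in auto)
      from Henstock_Kurzweil_Integration.integral_combine[OF _ _ this, of z] that xy show ?thesis by (simp add: G algebra_simps)
    qed
    have Nd: "norm (G y - G z) \<le> N y - N x" if "z \<in> {x..y}" for z
    proof -
      have i: "f integrable_on {z..y}" "(\<lambda>z. norm (f z)) integrable_on {z..y}"
        using fi Nfi that xy by (auto elim!: integrable_on_subinterval)
      have "norm (G y - G z) \<le> integral {z..y} (\<lambda>z. norm (f z))"
        unfolding Gd[OF that] by (rule integral_norm_bound_integral[OF i]) simp
      also have "\<dots> \<le> integral {x..y} (\<lambda>z. norm (f z))"
        by (rule integral_subset_le) (use that i sub[OF Nfi] in auto)
      also have "\<dots> = N y - N x" unfolding N_def by (rule comb[OF Nfi, symmetric])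
      finally show ?thesis .
    qed
    \<comment> \<open>With \<open>a\<close> frozen at x and \<open>G\<close> frozen at y, the two
      integrals add up exactly to a y * G y - a x * G x; \<open>R1\<close> and \<open>R2\<close> are
      the errors of the freezing, each a product of two small quantities.\<close>
    define R1 where "R1 = integral {x..y} (\<lambda>z. (a z - a x) * f z)"
    define R2 where "R2 = integral {x..y} (\<lambda>z. a' z * (G z - G y))"
    have i1: "(\<lambda>z. (a z - a x) * f z) integrable_on {x..y}"
      unfolding left_diff_distrib by (intro integrable_diff sub afi integrable_on_mult_right fi)
    have i2: "(\<lambda>z. a' z * (G z - G y)) integrable_on {x..y}"
      by (intro integrable_continuous_interval continuous_intros continuous_on_subset[OF a'] continuous_on_subset[OF Gc]) (use xy in auto)
    have "integral {x..y} (\<lambda>z. a z * f z) = integral {x..y} (\<lambda>z. (a z - a x) * f z + a x * f z)"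
      by (simp add: algebra_simps)
    also have "\<dots> = R1 + a x * (G y - G x)"
      unfolding R1_def using xy has_integral_mult_right[OF integrable_integral[OF sub[OF fi]], of "a x"]
      by (subst integral_add[OF i1]) (auto simp: Gd has_integral_iff)
    finally have e1: "integral {x..y} (\<lambda>z. a z * f z) = R1 + a x * (G y - G x)" .
    have a'i: "(a' has_integral (a y - a x)) {x..y}"
      using xy by (intro fundamental_theorem_of_calculus) (auto intro: has_vector_derivative_within_subset[OF a])
    have "integral {x..y} (\<lambda>z. a' z * G z) = integral {x..y} (\<lambda>z. a' z * (G z - G y) + a' z * G y)"
      by (simp add: algebra_simps)
    also have "\<dots> = R2 + (a y - a x) * G y"
      unfolding R2_def using has_integral_mult_left[OF a'i, of "G y"]
      by (subst integral_add[OF i2]) (auto simp: has_integral_iff)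
    finally have e2: "integral {x..y} (\<lambda>z. a' z * G z) = R2 + (a y - a x) * G y" .
    have "integral {x..y} h = (R1 + a x * (G y - G x)) + (R2 + (a y - a x) * G y)"
      unfolding h_def using sub[OF afi] sub[OF a'Gi] by (simp add: integral_add e1 e2)
    then have "Q y - Q x = - (R1 + R2)"
      using comb[OF hi] by (simp add: Q_def algebra_simps)
    then have "norm (Q y - Q x) \<le> norm R1 + norm R2" using norm_triangle_ineq[of R1 R2] by (metis norm_minus_cancel)
    also have "norm R1 \<le> integral {x..y} (\<lambda>z. L * (y - x) * norm (f z))"
      unfolding R1_def
    proof (rule integral_norm_bound_integral[OF i1])
      show "(\<lambda>z. L * (y - x) * norm (f z)) integrable_on {x..y}"
        by (intro integrable_on_mult_right sub Nfi)
      fix z assume z: "z \<in> {x..y}"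
      have "norm ((a z - a x) * f z) \<le> norm (a z - a x) * norm (f z)" by (rule norm_mult_ineq)
      also have "norm (a z - a x) \<le> L * \<bar>z - x\<bar>" using z xy by (intro aL) auto
      also have "\<dots> \<le> L * (y - x)" using z L(1) by (intro mult_left_mono) auto
      finally show "norm ((a z - a x) * f z) \<le> L * (y - x) * norm (f z)" by (simp add: mult_right_mono)
    qed
    also have "\<dots> = L * (y - x) * (N y - N x)"
      using comb[OF Nfi] by (simp add: N_def)
    also have "norm R2 \<le> L * (N y - N x) * (y - x)"
      unfolding R2_def
    proof (rule integral_bound[OF xy(3)])
      show "continuous_on {x..y} (\<lambda>z. a' z * (G z - G y))"
        by (intro continuous_intros continuous_on_subset[OF a'] continuous_on_subset[OF Gc]) (use xy in auto)
      fix z assume z: "z \<in> {x..y}"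
      have "norm (a' z * (G z - G y)) \<le> norm (a' z) * norm (G z - G y)" by (rule norm_mult_ineq)
      also have "\<dots> \<le> L * (N y - N x)"
        using z xy Nd[OF z] L by (intro mult_mono) (auto simp: norm_minus_commute)
      finally show "norm (a' z * (G z - G y)) \<le> L * (N y - N x)" .
    qed
    finally show ?thesis by (simp add: algebra_simps)
  qed
  have "\<exists>q. \<forall>x\<in>{l..b}. Q x = q"
  proof (rule has_derivative_zero_constant)
    fix x assume x: "x \<in> {l..b}"
    show "(Q has_derivative (\<lambda>h. 0)) (at x within {l..b})"
    proof (rule has_derivativeI_sandwich[of 1 _ _ _ _ "\<lambda>y. 2 * L * \<bar>N y - N x\<bar>"])
      fix y assume y: "y \<in> {l..b}" "y \<noteq> x"
      have "norm (Q y - Q x) \<le> 2 * L * \<bar>N y - N x\<bar> * \<bar>y - x\<bar>"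
      proof (cases "x \<le> y")
        case True
        note main[OF x y(1) True]
        also have "2 * L * (y - x) * (N y - N x) \<le> 2 * L * (y - x) * \<bar>N y - N x\<bar>"
          using True L(1) by (intro mult_left_mono) auto
        also have "\<dots> = 2 * L * \<bar>N y - N x\<bar> * \<bar>y - x\<bar>" using True by simp
        finally show ?thesis .
      next
        case False
        then have "y \<le> x" by simp
        have "norm (Q y - Q x) = norm (Q x - Q y)" by (rule norm_minus_commute)
        also note main[OF y(1) x \<open>y \<le> x\<close>]
        also have "2 * L * (x - y) * (N x - N y) \<le> 2 * L * (x - y) * \<bar>N x - N y\<bar>"
          using False L(1) by (intro mult_left_mono) auto
        also have "\<dots> = 2 * L * \<bar>N y - N x\<bar> * \<bar>y - x\<bar>"
          using False by (simp add: abs_minus_commute)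
        finally show ?thesis .
      qed
      then show "norm (Q y - Q x - 0) / norm (y - x) \<le> 2 * L * \<bar>N y - N x\<bar>"
        using y by (simp add: divide_le_eq)
    next
      have "(N \<longlongrightarrow> N x) (at x within {l..b})"
        using indefinite_integral_continuous_1[OF Nfi] x by (auto simp: N_def[abs_def] continuous_on_def)
      then show "((\<lambda>y. 2 * L * \<bar>N y - N x\<bar>) \<longlongrightarrow> 0) (at x within {l..b})"
        by (auto intro!: tendsto_eq_intros)
    qed auto
  qed auto
  then have "Q b = Q l" using lb by force
  then have "integral {l..b} h = a b * G b - a l * G l" by (simp add: Q_def algebra_simps)
  then show ?thesis using hi by (auto simp: h_def[abs_def] has_integral_iff)
qed

text \<open>Vanishing integrals over initial segments extend to all Borel sets, because half-lines
  are closed under intersection and generate the Borel sets. The sets where the function is positive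
  or negative then show that it is zero almost everywhere.\<close>

lemma AE_zero_if_indefinite_integral_zero:
  fixes f :: "real \<Rightarrow> real"
  assumes f: "integrable (lebesgue_on {a..b}) f"
    and z: "\<And>x. x \<in> {a..b} \<Longrightarrow> integral {a..x} f = 0"
  shows "AE x in lebesgue_on {a..b}. f x = 0"
proof (cases "a \<le> b")
  case False
  then show ?thesis by (simp add: AE_iff_null)
next
  case ab: True
  define F where "F x = indicator {a..b} x * f x" for x
  have "integrable lebesgue F"
    using f by (simp add: integrable_restrict_space F_def[abs_def])
  then have "F \<in> borel_measurable (completion lborel)" by auto
  \<comment> \<open>\<open>f\<close> is only Lebesgue measurable; its sign sets become accessible to
    the generator argument after passing to a Borel representative.\<close>
  from completion_ex_borel_measurable_real[OF this]
  obtain g where g [measurable]: "g \<in> borel_measurable lborel" and Fg: "AE x in lborel. F x = g x" by auto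
  have Fg': "AE x in lebesgue. F x = g x" by (rule AE_completion[OF Fg])
  have [measurable]: "g \<in> borel_measurable lebesgue" by (rule measurable_completion[OF g])
  have [measurable]: "F \<in> borel_measurable lebesgue" using \<open>integrable lebesgue F\<close> by auto
  have [measurable]: "{..y} \<in> sets lebesgue" for y :: real by simp
  have "integrable lebesgue g"
    using \<open>integrable lebesgue F\<close> Fg' by (subst integrable_cong_AE[symmetric, of F]) auto
  then have gi: "integrable lborel g" by (simp add: integrable_completion)
  have si: "set_integrable lborel A g" if "A \<in> sets lborel" for A
    unfolding set_integrable_def using gi that by (intro integrable_mult_indicator) 
  have half: "(LINT x:{..y}|lborel. g x) = 0" for y
  proof -
    have "(LINT x:{..y}|lborel. g x) = (LINT x|lebesgue. indicator {..y} x * g x)"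
      unfolding set_lebesgue_integral_def by (simp add: integral_completion)
    also have "\<dots> = (LINT x|lebesgue. indicator {..y} x * F x)"
      using Fg' by (intro integral_cong_AE) (measurable, auto)
    also have "\<dots> = (LINT x|lebesgue. indicator {a..min b y} x * f x)"
      by (intro Bochner_Integration.integral_cong) (auto simp: F_def indicator_def)
    also have "\<dots> = integral\<^sup>L (lebesgue_on {a..min b y}) f"
      by (simp add: integral_restrict_space)
    also have "\<dots> = 0"
    proof (cases "a \<le> y")
      case True
      have "integrable (lebesgue_on {a..min b y}) f"
        using f by (rule integrable_subinterval) (use True ab in auto)
      then show ?thesis
        using z[of "min b y"] True ab by (simp add: lebesgue_integral_eq_integral)
    qed (simp add: integral_restrict_space)
    finally show ?thesis .
  qed
  have tot: "(LINT x|lborel. g x) = 0"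
  proof -
    have "(LINT x|lborel. g x) = (LINT x|lebesgue. g x)" by (simp add: integral_completion)
    also have "\<dots> = (LINT x|lebesgue. F x)"
      using Fg' \<open>integrable lebesgue F\<close> by (intro integral_cong_AE) (auto elim: AE_mp)
    also have "\<dots> = integral\<^sup>L (lebesgue_on {a..b}) f"
      by (simp add: integral_restrict_space F_def)
    also have "\<dots> = 0" using z[of b] ab f by (simp add: lebesgue_integral_eq_integral)
    finally show ?thesis .
  qed
  have borel: "(LINT x:A|lborel. g x) = 0" if "A \<in> sets borel" for A
  proof -
    have "Int_stable (range (\<lambda>y::real. {..y}))"
      by (auto simp: Int_stable_def)
    moreover have "range (\<lambda>y::real. {..y}) \<subseteq> Pow UNIV" by simp
    moreover have "A \<in> sigma_sets UNIV (range (\<lambda>y::real. {..y}))"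
      using that by (simp add: borel_eq_atMost)
    ultimately show ?thesis
    proof (induction rule: sigma_sets_induct_disjoint)
      case (basic A)
      then show ?case using half by auto
    next
      case empty
      then show ?case by (simp add: set_lebesgue_integral_def)
    next
      case (compl A)
      then have "A \<in> sets borel" by (simp add: borel_eq_atMost)
      then have "(LINT x:A \<union> (UNIV - A)|lborel. g x) = (LINT x:A|lborel. g x) + (LINT x:UNIV - A|lborel. g x)"
        by (intro set_integral_Un si) auto
      then show ?case using compl tot by (simp add: set_lebesgue_integral_def)
    next
      case (union A)
      then have "A i \<in> sets borel" for i by (auto simp: borel_eq_atMost)
      then have "(LINT x:(\<Union>i. A i)|lborel. g x) = (\<Sum>i. (LINT x:(A i)|lborel. g x))"
        using union by (intro lebesgue_integral_countable_add si) (auto simp: disjoint_family_on_def)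
      then show ?case using union by simp
    qed
  qed
  have "AE x in lborel. indicator {x. 0 < g x} x * g x = 0"
    using borel[of "{x. 0 < g x}"] si[of "{x. 0 < g x}"]
    by (subst integral_nonneg_eq_0_iff_AE[symmetric])
       (auto simp: set_lebesgue_integral_def set_integrable_def indicator_def)
  moreover have "AE x in lborel. - (indicator {x. g x < 0} x * g x) = 0"
    using borel[of "{x. g x < 0}"] si[of "{x. g x < 0}"]
    by (subst integral_nonneg_eq_0_iff_AE[symmetric])
       (auto simp: set_lebesgue_integral_def set_integrable_def indicator_def)
  ultimately have "AE x in lborel. F x = 0"
    using Fg by eventually_elim (auto simp: indicator_def split: if_splits)
  then have "AE x in lebesgue. F x = 0" by (rule AE_completion)
  then show ?thesis
    by (simp add: AE_restrict_space_iff F_def) (auto elim!: eventually_mono)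
qed

section \<open>Fourier series on the circle\<close>

definition wave :: "int \<Rightarrow> real \<Rightarrow> complex" where
  "wave k x = cis (2 * pi * of_int k * x)"

lemma wave_add: "wave (j + k) x = wave j x * wave k x"
  by (simp add: wave_def cis_mult algebra_simps)

lemma wave_zero [simp]: "wave 0 x = 1"
  by (simp add: wave_def)

lemma wave_at_0 [simp]: "wave k 0 = 1"
  by (simp add: wave_def)

lemma wave_at_1 [simp]: "wave k 1 = 1"
  using cis_multiple_2pi[of "of_int k"] by (simp add: wave_def mult_ac)

lemma norm_wave [simp]: "norm (wave k x) = 1"
  by (simp add: wave_def)

lemma has_vector_derivative_wave:
  "(wave k has_vector_derivative (2 * pi * of_int k * \<i>) * wave k x) (at x within S)"
proof -
  have "wave k = (\<lambda>x. exp (x *\<^sub>R (2 * pi * of_int k * \<i>)))"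
    by (simp add: wave_def cis_conv_exp scaleR_conv_of_real fun_eq_iff mult_ac)
  then show ?thesis
    using exp_scaleR_has_vector_derivative_right[of "2 * pi * of_int k * \<i>" x S] by (simp add: mult_ac)
qed

lemma continuous_on_wave [continuous_intros]: "continuous_on S (wave k)"
  unfolding continuous_on_eq_continuous_within
  by (intro ballI has_vector_derivative_continuous[OF has_vector_derivative_wave])

lemma integral_wave: "integral {0..1} (wave k) = (if k = 0 then 1 else 0)"
proof (cases "k = 0")
  case False
  have "((\<lambda>x. (2 * pi * of_int k * \<i>) * wave k x) has_integral (wave k 1 - wave k 0)) {0..1}"
    by (rule fundamental_theorem_of_calculus) (simp, rule has_vector_derivative_wave)
  from integral_unique[OF this] have "(2 * pi * of_int k * \<i>) * integral {0..1} (wave k) = 0"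
    by simp
  then show ?thesis using False by simp
next
  case True
  then have "wave k = (\<lambda>x. 1)" by auto
  then show ?thesis using True by simp
qed

text \<open>Orthogonality to all frequencies at once is the property that survives multiplication by
  a trigonometric polynomial, since such a factor merely shifts frequencies.\<close>

definition wave_orthogonal :: "(real \<Rightarrow> complex) \<Rightarrow> bool" where
  "wave_orthogonal h \<longleftrightarrow> continuous_on {0..1} h \<and> (\<forall>k. integral {0..1} (\<lambda>x. h x * wave k x) = 0)"

text \<open>Induction over the polynomial with \<open>h\<close> generalised, so that a product is
  handled by applying the hypotheses one after the other. In the linear case the frequency moves by
  1 in both directions.\<close>

lemma wave_orthogonal_mult_polynomial:
  fixes g :: "complex \<Rightarrow> real"
  assumes "real_polynomial_function g" "wave_orthogonal h"
  shows "wave_orthogonal (\<lambda>x. h x * of_real (g (cis (2 * pi * x))))"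
  using assms
proof (induction arbitrary: h)
  case (linear g)
  then have hc: "continuous_on {0..1} h" and h0: "\<And>k. integral {0..1} (\<lambda>x. h x * wave k x) = 0"
    by (auto simp: wave_orthogonal_def)
  \<comment> \<open>On the unit circle a real linear functional is cos t * g 1 + sin t * g \<i>;
    \<open>A\<close> and \<open>B\<close> are its coefficients in terms of the exponentials of t and
    -t.\<close>
  define A where "A = (of_real (g 1) - \<i> * of_real (g \<i>)) / 2"
  define B where "B = (of_real (g 1) + \<i> * of_real (g \<i>)) / 2"
  have gcis: "of_real (g (cis (2 * pi * x))) = A * wave 1 x + B * wave (- 1) x" for x
  proof -
    let ?t = "2 * pi * x"
    have "g (cis ?t) = g (cos ?t *\<^sub>R 1 + sin ?t *\<^sub>R \<i>)"
      by (intro arg_cong[of _ _ g] complex_eqI) auto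
    also have "\<dots> = cos ?t * g 1 + sin ?t * g \<i>"
      using linear.hyps by (simp add: linear_add linear_cmul bounded_linear.linear)
    finally show ?thesis
      by (intro complex_eqI) (simp_all add: A_def B_def wave_def field_simps)
  qed
  have "integral {0..1} (\<lambda>x. h x * of_real (g (cis (2 * pi * x))) * wave k x) = 0" for k
  proof -
    have i: "((\<lambda>x. h x * wave j x) has_integral 0) {0..1}" for j
      using h0[of j] by (intro integrable_integral[THEN has_integral_eq_rhs])
        (auto intro!: integrable_continuous_interval continuous_intros hc)
    have "((\<lambda>x. A * (h x * wave (1 + k) x) + B * (h x * wave (-1 + k) x)) has_integral (A * 0 + B * 0)) {0..1}"
      by (intro has_integral_add has_integral_mult_right i)
    moreover have "A * (h x * wave (1 + k) x) + B * (h x * wave (-1 + k) x) = h x * of_real (g (cis (2 * pi * x))) * wave k x" for x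
      unfolding gcis wave_add by (simp add: algebra_simps)
    ultimately show ?thesis by (simp add: integral_unique)
  qed
  moreover have "continuous_on {0..1} (\<lambda>x. g (cis (2 * pi * x)))"
    by (intro bounded_linear.continuous_on[OF linear.hyps] continuous_intros)
  ultimately show ?case using hc by (auto simp: wave_orthogonal_def intro!: continuous_intros)
next
  case (const c)
  then show ?case
    by (auto simp: wave_orthogonal_def mult.commute[of _ "of_real c"] mult.assoc intro!: continuous_intros)
next
  case (add f g)
  have f: "wave_orthogonal (\<lambda>x. h x * of_real (f (cis (2 * pi * x))))"
    and g: "wave_orthogonal (\<lambda>x. h x * of_real (g (cis (2 * pi * x))))"
    using add by auto
  have i: "(\<lambda>x. u x * wave k x) integrable_on {0..1}" if "wave_orthogonal u" for u k
    using that by (intro integrable_continuous_interval continuous_intros) (simp add: wave_orthogonal_def)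
  show ?case
    using f g integral_add[OF i[OF f] i[OF g]] unfolding wave_orthogonal_def
    by (auto simp: algebra_simps intro!: continuous_on_add)
next
  case (mult f g)
  then have "wave_orthogonal (\<lambda>x. (h x * of_real (f (cis (2 * pi * x)))) * of_real (g (cis (2 * pi * x))))"
    by blast
  then show ?case by (simp add: mult_ac)
qed

text \<open>On \<open>{0..1}\<close> itself trigonometric polynomials do not separate the end points, so Stone-Weierstrass
  is applied on the unit circle.\<close>

lemma loop_factors_through_circle:
  fixes \<phi> :: "real \<Rightarrow> real"
  assumes c: "continuous_on {0..1} \<phi>" and e: "\<phi> 0 = \<phi> 1"
  obtains \<Phi> :: "complex \<Rightarrow> real" where "continuous_on (sphere 0 1) \<Phi>" "\<And>x. x \<in> {0..1} \<Longrightarrow> \<Phi> (cis (2 * pi * x)) = \<phi> x"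
proof
  \<comment> \<open>The trivial homotopy of the loop with itself supplies the continuity of the
    induced map at the point 1, where \<open>Arg2pi\<close> jumps.\<close>
  have "homotopic_loops UNIV \<phi> \<phi>"
    using c e by (simp add: homotopic_loops_refl path_def pathfinish_def pathstart_def)
  from homotopic_with_imp_continuous[OF homotopic_loops_imp_homotopic_circlemaps[OF this]]
  show "continuous_on (sphere 0 1) (\<phi> \<circ> (\<lambda>z. Arg2pi z / (2 * pi)))" by simp
  fix x :: real assume x: "x \<in> {0..1}"
  show "(\<phi> \<circ> (\<lambda>z. Arg2pi z / (2 * pi))) (cis (2 * pi * x)) = \<phi> x"
  proof (cases "x = 1")
    case True
    have "Arg2pi 1 = 0" using Arg2pi_of_real[of 1] by simp
    then show ?thesis using True e by simp
  next
    case False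
    have "Arg2pi (cis (2 * pi * x)) = 2 * pi * x"
      by (rule Arg2pi_unique[of 1]) (use x False in \<open>auto simp: cis_conv_exp\<close>)
    then show ?thesis by simp
  qed
qed

text \<open>Polynomials approximate the loop uniformly on the unit circle, and \<open>h\<close>
  integrates to zero against each of them.\<close>

lemma wave_orthogonal_mult_loop:
  fixes \<phi> :: "real \<Rightarrow> real"
  assumes h: "wave_orthogonal h" and c: "continuous_on {0..1} \<phi>" and e: "\<phi> 0 = \<phi> 1"
  shows "integral {0..1} (\<lambda>x. h x * of_real (\<phi> x)) = 0"
proof (rule ccontr)
  let ?I = "integral {0..1} (\<lambda>x. h x * of_real (\<phi> x))"
  assume "?I \<noteq> 0"
  obtain \<Phi> where \<Phi>: "continuous_on (sphere 0 1) \<Phi>" "\<And>x. x \<in> {0..1} \<Longrightarrow> \<Phi> (cis (2 * pi * x)) = \<phi> x"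
    using loop_factors_through_circle[OF c e] by metis
  have hc: "continuous_on {0..1} h" using h by (simp add: wave_orthogonal_def)
  from compact_imp_bounded[OF compact_continuous_image[OF hc compact_Icc]]
  obtain M where M: "0 < M" "\<forall>y\<in>h ` {0..1}. norm y \<le> M" unfolding bounded_pos by blast
  \<comment> \<open>Since \<open>h\<close> is bounded by M, this accuracy would bound the norm of
    the integral by half of itself.\<close>
  define \<epsilon> where "\<epsilon> = norm ?I / (2 * M)"
  have "0 < \<epsilon>" using \<open>?I \<noteq> 0\<close> M by (simp add: \<epsilon>_def)
  then obtain g where g: "real_polynomial_function g" "\<And>z. z \<in> sphere 0 1 \<Longrightarrow> \<bar>\<Phi> z - g z\<bar> < \<epsilon>"
    using Stone_Weierstrass_real_polynomial_function[OF compact_sphere \<Phi>(1)] by metis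
  let ?g = "\<lambda>x. g (cis (2 * pi * x))"
  have hg: "wave_orthogonal (\<lambda>x. h x * of_real (?g x))"
    by (rule wave_orthogonal_mult_polynomial[OF g(1) h])
  then have z: "integral {0..1} (\<lambda>x. h x * of_real (?g x)) = 0"
    unfolding wave_orthogonal_def by (auto dest: spec[of _ 0])
  have hgc: "continuous_on {0..1} (\<lambda>x. h x * of_real (?g x))"
    using hg by (simp add: wave_orthogonal_def)
  have h\<phi>c: "continuous_on {0..1} (\<lambda>x. h x * of_real (\<phi> x))"
    by (intro continuous_intros hc c)
  have "?I = integral {0..1} (\<lambda>x. h x * of_real (\<phi> x) - h x * of_real (?g x))"
    using z by (simp add: integral_diff integrable_continuous_interval hgc h\<phi>c)
  also have "norm \<dots> \<le> (M * \<epsilon>) * (1 - 0)"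
  proof (rule integral_bound)
    fix x :: real assume x: "x \<in> {0..1}"
    have "norm (h x * of_real (\<phi> x) - h x * of_real (?g x)) = norm (h x) * \<bar>\<phi> x - ?g x\<bar>"
      by (simp only: right_diff_distrib[symmetric] of_real_diff[symmetric] norm_mult norm_of_real)
    also have "\<dots> \<le> M * \<epsilon>"
      using M x g(2)[of "cis (2 * pi * x)"] \<Phi>(2)[OF x] by (intro mult_mono) auto
    finally show "norm (h x * of_real (\<phi> x) - h x * of_real (?g x)) \<le> M * \<epsilon>" .
  qed (auto intro!: continuous_on_diff hgc h\<phi>c)
  finally show False using \<open>?I \<noteq> 0\<close> M by (simp add: \<epsilon>_def)
qed

text \<open>The real and imaginary parts of \<open>h\<close> are themselves admissible loops;
  testing \<open>h\<close> against each one makes the integral of its square vanish.\<close>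

lemma fourier_uniqueness:
  assumes h: "wave_orthogonal h" and e: "h 0 = h 1" and x: "x \<in> {0..1}"
  shows "h x = 0"
proof -
  have hc: "continuous_on {0..1} h" using h by (simp add: wave_orthogonal_def)
  \<comment> \<open>\<open>F\<close> stands for Re or Im; the second assumption says that F of
    \<open>h\<close> times F h is the square of F h.\<close>
  have *: "\<forall>x\<in>{0..1}. F (h x) = 0" if F: "bounded_linear F"
    and FF: "\<And>z. F (z * of_real (F z)) = (F z)\<^sup>2" for F :: "complex \<Rightarrow> real"
  proof -
    have Fc: "continuous_on {0..1} (\<lambda>x. F (h x))" by (rule bounded_linear.continuous_on[OF F hc])
    have "integral {0..1} (\<lambda>x. (F (h x))\<^sup>2) = F (integral {0..1} (\<lambda>x. h x * of_real (F (h x))))"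
      using integral_linear[OF integrable_continuous_interval F, of 0 1 "\<lambda>x. h x * of_real (F (h x))"] hc Fc FF
      by (simp add: o_def continuous_on_mult continuous_on_of_real)
    also have "\<dots> = 0"
      using wave_orthogonal_mult_loop[OF h Fc] e F by (simp add: linear_0 bounded_linear.linear)
    finally show ?thesis
      using integral_eq_0_iff[of 0 1 "\<lambda>x. (F (h x))\<^sup>2"] continuous_on_power[OF Fc, of 2] by simp
  qed
  have "Re (h x) = 0" using *[of Re] bounded_linear_Re x by (simp add: power2_eq_square)
  moreover have "Im (h x) = 0" using *[of Im] bounded_linear_Im x by (simp add: power2_eq_square)
  ultimately show ?thesis by (simp add: complex_eq_iff)
qed

text \<open>Absolutely summable coefficients make the series converge uniformly to a continuous
  \<open>S\<close> with the same coefficients as \<open>h\<close>, and uniqueness applies to the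
  difference.\<close>

lemma fourier_series_has_sum:
  fixes h :: "real \<Rightarrow> complex" and c :: "int \<Rightarrow> complex"
  assumes hc: "continuous_on {0..1} h" and e: "h 0 = h 1"
    and c: "\<And>k. c k = integral {0..1} (\<lambda>x. h x * wave (- k) x)"
    and s: "(\<lambda>k. norm (c k)) summable_on UNIV" and x: "x \<in> {0..1}"
  shows "((\<lambda>k. c k * wave k x) has_sum h x) UNIV"
proof -
  define S where "S x = (\<Sum>\<^sub>\<infinity>k. c k * wave k x)" for x
  have ab: "(\<lambda>k. c k * wave k x) summable_on UNIV" for x
    by (rule abs_summable_summable) (use s in \<open>simp add: norm_mult\<close>)
  have u: "uniform_limit {0..1} (\<lambda>X x. \<Sum>k\<in>X. c k * wave k x) S (finite_subsets_at_top UNIV)"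
    unfolding S_def by (rule Weierstrass_m_test_general[OF _ s]) (simp add: norm_mult)
  have Sc: "continuous_on {0..1} S"
    by (rule uniform_limit_theorem[OF _ u]) (auto intro!: always_eventually continuous_intros)
  have "integral {0..1} (\<lambda>x. S x * wave j x) = c (- j)" for j
  proof -
    have "uniform_limit {0..1} (\<lambda>X x. (\<Sum>k\<in>X. c k * wave k x) * wave j x) (\<lambda>x. S x * wave j x) (finite_subsets_at_top UNIV)"
      by (intro uniform_lim_mult u uniform_limit_const compact_imp_bounded compact_continuous_image Sc continuous_intros) auto
    then obtain I J where I: "\<And>X. ((\<lambda>x. (\<Sum>k\<in>X. c k * wave k x) * wave j x) has_integral I X) {0..1}"
      and J: "((\<lambda>x. S x * wave j x) has_integral J) {0..1}" and lim: "(I \<longlongrightarrow> J) (finite_subsets_at_top UNIV)"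
      by (rule uniform_limit_integral) (auto intro!: continuous_intros)
    \<comment> \<open>Once the finite set contains - j, the integral of the partial sum against
      \<open>wave j\<close> no longer changes, so its limit can be read off.\<close>
    have "I X = c (- j)" if X: "finite X" "- j \<in> X" for X
    proof -
      have "((\<lambda>x. \<Sum>k\<in>X. c k * wave (k + j) x) has_integral (\<Sum>k\<in>X. c k * (if k + j = 0 then 1 else 0))) {0..1}"
        using X(1)
        by (intro has_integral_sum has_integral_mult_right)
           (simp_all add: has_integral_iff integral_wave integrable_continuous_interval continuous_on_wave
             flip: of_int_add)
      moreover have "(\<Sum>k\<in>X. c k * (if k + j = 0 then 1 else 0)) = c (- j)"
      proof -
        have "(\<Sum>k\<in>X. c k * (if k + j = 0 then 1 else 0)) = (\<Sum>k\<in>X. if k = - j then c k else 0)"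
          by (rule sum.cong) auto
        then show ?thesis using X by simp
      qed
      moreover have "(\<lambda>x. \<Sum>k\<in>X. c k * wave (k + j) x) = (\<lambda>x. (\<Sum>k\<in>X. c k * wave k x) * wave j x)"
        unfolding wave_add by (simp add: sum_distrib_right mult.assoc)
      ultimately have "((\<lambda>x. (\<Sum>k\<in>X. c k * wave k x) * wave j x) has_integral c (- j)) {0..1}" by simp
      with I[of X] show ?thesis by (rule has_integral_unique)
    qed
    then have "(I \<longlongrightarrow> c (- j)) (finite_subsets_at_top UNIV)"
      by (intro tendsto_eventually) (auto simp: eventually_finite_subsets_at_top intro!: exI[of _ "{- j}"])
    with lim have "J = c (- j)" by (intro tendsto_unique) auto
    with J show ?thesis by (simp add: integral_unique)
  qed
  moreover have "integral {0..1} (\<lambda>x. h x * wave j x) = c (- j)" for j by (simp add: c)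
  ultimately have "integral {0..1} (\<lambda>x. (h x - S x) * wave j x) = 0" for j
    by (simp add: left_diff_distrib integral_diff integrable_continuous_interval continuous_intros hc Sc)
  then have "wave_orthogonal (\<lambda>x. h x - S x)"
    by (auto simp: wave_orthogonal_def intro!: continuous_on_diff hc Sc)
  from fourier_uniqueness[OF this _ x] have "h x = S x"
    using e by (simp add: S_def)
  then show ?thesis using ab[of x] by (simp add: S_def has_sum_infsum)
qed

text \<open>Integration by parts against \<open>wave k\<close>, which equals 1 at both ends. It
  relates the coefficients of an integrable function to those of its primitive.\<close>

lemma indefinite_integral_fourier:
  fixes f :: "real \<Rightarrow> complex"
  assumes f: "f absolutely_integrable_on {0..1}"
    and G: "\<And>x. x \<in> {0..1} \<Longrightarrow> G x = c + integral {0..x} f"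
  shows "integral {0..1} (\<lambda>x. f x * wave k x) + 2 * pi * of_int k * \<i> * integral {0..1} (\<lambda>x. G x * wave k x) = G 1 - G 0"
proof -
  have Gc: "continuous_on {0..1} G"
  proof (rule continuous_on_eq)
    show "continuous_on {0..1} (\<lambda>z. c + integral {0..z} f)"
      using f by (intro continuous_intros indefinite_integral_continuous_1) (simp add: absolutely_integrable_on_def)
  qed (simp add: G)
  have "((\<lambda>z. wave k z * f z + (2 * pi * of_int k * \<i>) * wave k z * G z) has_integral (wave k 1 * G 1 - wave k 0 * G 0)) {0..1}"
    by (rule absolutely_integrable_by_parts[OF _ f has_vector_derivative_wave _ G])
       (auto intro!: continuous_intros)
  moreover have "((\<lambda>z. wave k z * f z + (2 * pi * of_int k * \<i>) * wave k z * G z) has_integral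
      (integral {0..1} (\<lambda>z. wave k z * f z) + (2 * pi * of_int k * \<i>) * integral {0..1} (\<lambda>z. wave k z * G z))) {0..1}"
    unfolding mult.assoc[of _ "wave k _"]
  proof (intro has_integral_add has_integral_mult_right integrable_integral)
    show "(\<lambda>z. wave k z * f z) integrable_on {0..1}"
      using absolutely_integrable_continuous_mult[OF continuous_on_wave f]
      by (simp add: absolutely_integrable_on_def)
    show "(\<lambda>z. wave k z * G z) integrable_on {0..1}"
      by (intro integrable_continuous_interval continuous_on_mult continuous_on_wave Gc)
  qed
  ultimately have "integral {0..1} (\<lambda>z. wave k z * f z) + (2 * pi * of_int k * \<i>) * integral {0..1} (\<lambda>z. wave k z * G z) = wave k 1 * G 1 - wave k 0 * G 0"
    using has_integral_unique by blast
  moreover have "(\<lambda>z. wave k z * f z) = (\<lambda>z. f z * wave k z)" "(\<lambda>z. wave k z * G z) = (\<lambda>z. G z * wave k z)"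
    by (simp_all add: fun_eq_iff)
  ultimately show ?thesis by simp
qed

section \<open>Sobolev spaces\<close>

lemma integrable_circle_imp:
  fixes f :: "real \<Rightarrow> 'a::euclidean_space"
  assumes "integrable circle f"
  shows "f absolutely_integrable_on {0..1}" "f integrable_on {0..1}" "integral\<^sup>L circle f = integral {0..1} f"
  using assms
  by (simp_all add: integrable_restrict_space absolutely_integrable_on_def set_integrable_def
      integrable_on_lebesgue_on lebesgue_integral_eq_integral)

lemma L2_circle_integrable:
  assumes "f \<in> L2_circle"
  shows "integrable circle f"
proof (rule Bochner_Integration.integrable_bound)
  show "integrable circle (\<lambda>x. 1 + (f x)\<^sup>2)"
    using assms continuous_imp_integrable_real[of 0 1 "\<lambda>x. 1 :: real"] by (auto simp: L2_circle_def)
  have "\<bar>y\<bar> \<le> 1 + y\<^sup>2" for y :: real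
    using sum_squares_ge_zero[of "\<bar>y\<bar> - 1" 0] zero_le_power2[of y] by (simp add: power2_eq_square algebra_simps; smt (verit) zero_le_square)
  then show "AE x in circle. norm (f x) \<le> norm (1 + (f x)\<^sup>2)"
    by (intro always_eventually) (auto intro: order_trans)
qed (use assms in \<open>auto simp: L2_circle_def\<close>)

lemma continuous_periodic_in_L2_circle:
  assumes "periodic1 f" "continuous_on {0..1} f"
  shows "f \<in> L2_circle"
  using assms
  by (auto simp: L2_circle_def continuous_imp_measurable_on_sets_lebesgue
      intro!: continuous_imp_integrable_real continuous_intros)

lemma L2_circle_linear:
  assumes f: "f \<in> L2_circle" and g: "g \<in> L2_circle"
  shows "(\<lambda>x. a * f x + b * g x) \<in> L2_circle"
proof -
  have [measurable]: "f \<in> borel_measurable circle" "g \<in> borel_measurable circle"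
    using f g by (auto simp: L2_circle_def)
  have "integrable circle (\<lambda>x. (a * f x + b * g x)\<^sup>2)"
  proof (rule Bochner_Integration.integrable_bound)
    show "integrable circle (\<lambda>x. 2 * a\<^sup>2 * (f x)\<^sup>2 + 2 * b\<^sup>2 * (g x)\<^sup>2)"
      using f g by (auto simp: L2_circle_def)
    have "(p + q)\<^sup>2 \<le> 2 * p\<^sup>2 + 2 * q\<^sup>2" for p q :: real
      using zero_le_power2[of "p - q"] by (simp add: power2_eq_square algebra_simps)
    from this[of "a * f _" "b * g _"]
    show "AE x in circle. norm ((a * f x + b * g x)\<^sup>2) \<le> norm (2 * a\<^sup>2 * (f x)\<^sup>2 + 2 * b\<^sup>2 * (g x)\<^sup>2)"
      by (intro always_eventually allI) (simp add: power_mult_distrib mult.assoc)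
  qed simp
  then show ?thesis using f g by (auto simp: L2_circle_def periodic1_def)
qed

lemma integrable_circle_wave:
  assumes "f \<in> L2_circle"
  shows "integrable circle (\<lambda>x. of_real (f x) * wave k x)"
proof (rule Bochner_Integration.integrable_bound[OF L2_circle_integrable[OF assms]])
  have [measurable]: "f \<in> borel_measurable circle" using assms by (simp add: L2_circle_def)
  have [measurable]: "wave k \<in> borel_measurable circle"
    by (intro continuous_imp_measurable_on_sets_lebesgue continuous_on_wave) simp
  show "(\<lambda>x. of_real (f x) * wave k x) \<in> borel_measurable circle" by measurable
qed (simp add: norm_mult)

lemma fourier_coeff_wave: "fourier_coeff f k = integral\<^sup>L circle (\<lambda>x. of_real (f x) * wave (- k) x)"
  by (simp add: fourier_coeff_def wave_def)

lemma fourier_coeff_integral: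
  "f \<in> L2_circle \<Longrightarrow> fourier_coeff f k = integral {0..1} (\<lambda>x. of_real (f x) * wave (- k) x)"
  unfolding fourier_coeff_wave by (rule integrable_circle_imp(3)[OF integrable_circle_wave])

lemma fourier_coeff_linear:
  assumes "f \<in> L2_circle" "g \<in> L2_circle"
  shows "fourier_coeff (\<lambda>x. a * f x + b * g x) k = of_real a * fourier_coeff f k + of_real b * fourier_coeff g k"
proof -
  have "fourier_coeff (\<lambda>x. a * f x + b * g x) k =
      integral\<^sup>L circle (\<lambda>x. of_real a * (of_real (f x) * wave (- k) x) + of_real b * (of_real (g x) * wave (- k) x))"
    by (simp add: fourier_coeff_wave algebra_simps)
  also have "\<dots> = of_real a * fourier_coeff f k + of_real b * fourier_coeff g k"
    using integrable_circle_wave[OF assms(1)] integrable_circle_wave[OF assms(2)] by (simp add: fourier_coeff_wave)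
  finally show ?thesis .
qed

lemma mean_integral: "f \<in> L2_circle \<Longrightarrow> mean f = integral {0..1} f"
  unfolding mean_def by (rule integrable_circle_imp(3)[OF L2_circle_integrable])

section \<open>Sobolev embedding by a weighted Cauchy-Schwarz inequality\<close>

definition weight :: "int \<Rightarrow> real" where
  "weight k = 1 + (of_int k)\<^sup>2"

lemma weight_ge_1: "1 \<le> weight k"
  by (simp add: weight_def)

lemma weight_pos [simp]: "0 < weight k" "weight k \<noteq> 0" "0 \<le> weight k"
  using weight_ge_1[of k] by auto

lemma summable_on_inverse_weight: "(\<lambda>k. inverse (weight k)) summable_on UNIV"
proof -
  have "(\<lambda>n. inverse (weight (int n))) summable_on UNIV"
  proof (rule norm_summable_imp_summable_on, rule summable_comparison_test_ev)
    show "summable (\<lambda>n. inverse ((real n)\<^sup>2))" using inverse_power_summable[of 2] by simp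
    show "\<forall>\<^sub>F n in sequentially. norm (norm (inverse (weight (int n)))) \<le> inverse ((real n)\<^sup>2)"
      using eventually_gt_at_top[of 0]
      by eventually_elim (auto simp: weight_def abs_of_pos intro!: le_imp_inverse_le)
  qed
  moreover have "(\<lambda>n. inverse (weight (int n))) = (\<lambda>k. inverse (weight k)) \<circ> int"
    "(\<lambda>n. inverse (weight (int n))) = (\<lambda>k. inverse (weight k)) \<circ> (\<lambda>n. - int n)"
    by (simp_all add: weight_def fun_eq_iff)
  ultimately have "(\<lambda>k. inverse (weight k)) summable_on (range int)"
    "(\<lambda>k. inverse (weight k)) summable_on (range (\<lambda>n. - int n))"
    using summable_on_reindex[of int UNIV "\<lambda>k. inverse (weight k)"]
      summable_on_reindex[of "\<lambda>n. - int n" UNIV "\<lambda>k. inverse (weight k)"] by (auto simp: inj_on_def)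
  then have "(\<lambda>k. inverse (weight k)) summable_on (range int \<union> range (\<lambda>n. - int n))"
    by (rule summable_on_union)
  moreover have "range int \<union> range (\<lambda>n. - int n) = UNIV"
    by (auto, metis int_cases2 rangeI)
  ultimately show ?thesis by simp
qed

text \<open>The norm of the sequence \<open>1 / sqrt (weight k)\<close> in l^2, that is, the factor
  by which order 1 controls the sum of the absolute Fourier coefficients.\<close>

definition embedding_const :: real where
  "embedding_const = sqrt (\<Sum>\<^sub>\<infinity>k. inverse (weight k))"

lemma embedding_const_nonneg: "0 \<le> embedding_const"
  by (simp add: embedding_const_def infsum_nonneg)

text \<open>Write d as the product of \<open>1 / sqrt (weight k)\<close> and
  \<open>sqrt (weight k) * d k\<close> and apply Cauchy-Schwarz on finite sets; the uniform bound
  yields summability as well as the estimate.\<close>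

lemma weighted_Cauchy_Schwarz:
  fixes d :: "int \<Rightarrow> real"
  assumes d: "\<And>k. 0 \<le> d k" and s: "(\<lambda>k. weight k * (d k)\<^sup>2) summable_on UNIV"
  shows "d summable_on UNIV" "infsum d UNIV \<le> embedding_const * sqrt (\<Sum>\<^sub>\<infinity>k. weight k * (d k)\<^sup>2)"
proof -
  have fin: "sum d F \<le> embedding_const * sqrt (\<Sum>\<^sub>\<infinity>k. weight k * (d k)\<^sup>2)" if F: "finite F" for F
  proof -
    have "sum d F = (\<Sum>k\<in>F. \<bar>inverse (sqrt (weight k))\<bar> * \<bar>sqrt (weight k) * d k\<bar>)"
      using d by (intro sum.cong) (auto simp: abs_mult)
    also have "\<dots> \<le> L2_set (\<lambda>k. inverse (sqrt (weight k))) F * L2_set (\<lambda>k. sqrt (weight k) * d k) F"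
      by (rule L2_set_mult_ineq)
    also have "\<dots> = sqrt (\<Sum>k\<in>F. inverse (weight k)) * sqrt (\<Sum>k\<in>F. weight k * (d k)\<^sup>2)"
      by (simp add: L2_set_def power_mult_distrib power_inverse)
    also have "\<dots> \<le> embedding_const * sqrt (\<Sum>\<^sub>\<infinity>k. weight k * (d k)\<^sup>2)"
      unfolding embedding_const_def
      by (intro mult_mono real_sqrt_le_mono finite_sum_le_infsum summable_on_inverse_weight s F)
         (auto intro!: sum_nonneg infsum_nonneg mult_nonneg_nonneg)
    finally show ?thesis .
  qed
  show *: "d summable_on UNIV"
    by (rule nonneg_bdd_above_summable_on[OF d]) (auto intro!: bdd_aboveI2 fin)
  show "infsum d UNIV \<le> embedding_const * sqrt (\<Sum>\<^sub>\<infinity>k. weight k * (d k)\<^sup>2)"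
    by (rule infsum_le_finite_sums[OF * fin])
qed

lemma sobolev_L2: "f \<in> sobolev r \<Longrightarrow> f \<in> L2_circle"
  and sobolev_periodic: "f \<in> sobolev r \<Longrightarrow> periodic1 f"
  and sobolev_continuous_on: "f \<in> sobolev r \<Longrightarrow> r > 1/2 \<Longrightarrow> continuous_on UNIV f"
  by (auto simp: sobolev_def L2_circle_def)

lemma sobolev_linear:
  assumes f: "f \<in> sobolev r" and g: "g \<in> sobolev r"
  shows "(\<lambda>x. a * f x + b * g x) \<in> sobolev r"
proof -
  note L2 = sobolev_L2[OF f] sobolev_L2[OF g]
  let ?W = "\<lambda>k::int. (1 + (of_int k)\<^sup>2 :: real) powr r"
  have "(\<lambda>k. ?W k * (cmod (fourier_coeff (\<lambda>x. a * f x + b * g x) k))\<^sup>2) summable_on UNIV"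
  proof (rule summable_on_comparison_test)
    show "(\<lambda>k. 2 * a\<^sup>2 * (?W k * (cmod (fourier_coeff f k))\<^sup>2) + 2 * b\<^sup>2 * (?W k * (cmod (fourier_coeff g k))\<^sup>2)) summable_on UNIV"
      using f g by (intro summable_on_add summable_on_cmult_right) (auto simp: sobolev_def)
    fix k
    have sq: "(p + q)\<^sup>2 \<le> 2 * p\<^sup>2 + 2 * q\<^sup>2" for p q :: real
      using zero_le_power2[of "p - q"] by (simp add: power2_eq_square algebra_simps)
    have "cmod (fourier_coeff (\<lambda>x. a * f x + b * g x) k) \<le> \<bar>a\<bar> * cmod (fourier_coeff f k) + \<bar>b\<bar> * cmod (fourier_coeff g k)"
      unfolding fourier_coeff_linear[OF L2] 
      using norm_triangle_ineq[of "of_real a * fourier_coeff f k" "of_real b * fourier_coeff g k"] by (simp add: norm_mult)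
    then have "(cmod (fourier_coeff (\<lambda>x. a * f x + b * g x) k))\<^sup>2 \<le> (\<bar>a\<bar> * cmod (fourier_coeff f k) + \<bar>b\<bar> * cmod (fourier_coeff g k))\<^sup>2"
      by (intro power_mono) auto
    also have "\<dots> \<le> 2 * a\<^sup>2 * (cmod (fourier_coeff f k))\<^sup>2 + 2 * b\<^sup>2 * (cmod (fourier_coeff g k))\<^sup>2"
      using sq[of "\<bar>a\<bar> * cmod (fourier_coeff f k)" "\<bar>b\<bar> * cmod (fourier_coeff g k)"] by (simp add: power_mult_distrib)
    finally have "?W k * (cmod (fourier_coeff (\<lambda>x. a * f x + b * g x) k))\<^sup>2 \<le> ?W k * (2 * a\<^sup>2 * (cmod (fourier_coeff f k))\<^sup>2 + 2 * b\<^sup>2 * (cmod (fourier_coeff g k))\<^sup>2)"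
      by (rule mult_left_mono) simp
    then show "?W k * (cmod (fourier_coeff (\<lambda>x. a * f x + b * g x) k))\<^sup>2 \<le> 2 * a\<^sup>2 * (?W k * (cmod (fourier_coeff f k))\<^sup>2) + 2 * b\<^sup>2 * (?W k * (cmod (fourier_coeff g k))\<^sup>2)"
      by (simp add: algebra_simps)
  qed simp
  then show ?thesis
    using f g L2_circle_linear[OF L2, of a b] by (auto simp: sobolev_def intro!: continuous_intros)
qed

text \<open>As \<open>weight k\<close> is at least 1, a real order dominates every smaller natural
  one. The orders 0, 1 and 2 serve for integrals, point values and slopes.\<close>

lemma sobolev_weighted_sum:
  assumes f: "f \<in> sobolev r" and r: "of_nat n \<le> r"
  shows "(\<lambda>k. weight k ^ n * (cmod (fourier_coeff f k))\<^sup>2) summable_on UNIV"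
    "(\<Sum>\<^sub>\<infinity>k. weight k ^ n * (cmod (fourier_coeff f k))\<^sup>2) \<le> (sobolev_norm r f)\<^sup>2"
proof -
  have le: "weight k ^ n * (cmod (fourier_coeff f k))\<^sup>2 \<le> (1 + (of_int k)\<^sup>2) powr r * (cmod (fourier_coeff f k))\<^sup>2" for k
    using powr_mono[OF r weight_ge_1[of k]] by (intro mult_right_mono) (simp_all add: powr_realpow weight_def[symmetric])
  have s: "(\<lambda>k. (1 + (of_int k)\<^sup>2) powr r * (cmod (fourier_coeff f k))\<^sup>2) summable_on UNIV"
    using f by (simp add: sobolev_def)
  show *: "(\<lambda>k. weight k ^ n * (cmod (fourier_coeff f k))\<^sup>2) summable_on UNIV"
    by (rule summable_on_comparison_test[OF s le]) simp
  have "(\<Sum>\<^sub>\<infinity>k. weight k ^ n * (cmod (fourier_coeff f k))\<^sup>2) \<le> (\<Sum>\<^sub>\<infinity>k. (1 + (of_int k)\<^sup>2) powr r * (cmod (fourier_coeff f k))\<^sup>2)"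
    by (rule infsum_mono[OF * s le])
  also have "\<dots> = (sobolev_norm r f)\<^sup>2"
    unfolding sobolev_norm_def by (subst real_sqrt_pow2) (auto intro!: infsum_nonneg)
  finally show "(\<Sum>\<^sub>\<infinity>k. weight k ^ n * (cmod (fourier_coeff f k))\<^sup>2) \<le> (sobolev_norm r f)\<^sup>2" .
qed

lemma sobolev_norm_nonneg: "0 \<le> sobolev_norm r f"
  by (simp add: sobolev_norm_def infsum_nonneg)

lemma sobolev_coeff_sum:
  assumes f: "f \<in> sobolev r" and r: "1 \<le> r"
  shows "(\<lambda>k. cmod (fourier_coeff f k)) summable_on UNIV"
    "(\<Sum>\<^sub>\<infinity>k. cmod (fourier_coeff f k)) \<le> embedding_const * sobolev_norm r f"
proof -
  have s: "(\<lambda>k. weight k * (cmod (fourier_coeff f k))\<^sup>2) summable_on UNIV"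
    and le: "(\<Sum>\<^sub>\<infinity>k. weight k * (cmod (fourier_coeff f k))\<^sup>2) \<le> (sobolev_norm r f)\<^sup>2"
    using sobolev_weighted_sum[OF f, of 1] r by auto
  show "(\<lambda>k. cmod (fourier_coeff f k)) summable_on UNIV"
    by (rule weighted_Cauchy_Schwarz(1)[OF norm_ge_zero s])
  have "sqrt (\<Sum>\<^sub>\<infinity>k. weight k * (cmod (fourier_coeff f k))\<^sup>2) \<le> sobolev_norm r f"
    by (rule real_le_lsqrt[OF sobolev_norm_nonneg le])
  then show "(\<Sum>\<^sub>\<infinity>k. cmod (fourier_coeff f k)) \<le> embedding_const * sobolev_norm r f"
    using weighted_Cauchy_Schwarz(2)[OF norm_ge_zero s] mult_left_mono[OF _ embedding_const_nonneg] by (meson order_trans)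
qed

lemma wave_periodic: "wave k (x + 1) = wave k x"
proof -
  have "wave k (x + 1) = wave k x * wave k 1"
    by (simp add: wave_def cis_mult algebra_simps)
  then show ?thesis by simp
qed

lemma wave_frac: "wave k (frac x) = wave k x"
proof -
  have "periodic1 (\<lambda>x. Re (wave k x))" "periodic1 (\<lambda>x. Im (wave k x))"
    by (simp_all add: periodic1_def wave_periodic)
  from this[THEN periodic1_frac] show ?thesis by (simp add: complex_eq_iff)
qed

lemma sobolev_fourier_series:
  assumes f: "f \<in> sobolev r" and r: "1 \<le> r"
  shows "((\<lambda>k. fourier_coeff f k * wave k x) has_sum of_real (f x)) UNIV"
proof -
  have c: "continuous_on {0..1} f" using sobolev_continuous_on[OF f] r by (auto intro: continuous_on_subset)
  have p: "periodic1 f" by (rule sobolev_periodic[OF f])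
  have "((\<lambda>k. fourier_coeff f k * wave k (frac x)) has_sum of_real (f (frac x))) UNIV"
  proof (rule fourier_series_has_sum)
    show "complex_of_real (f 0) = of_real (f 1)" using p unfolding periodic1_def by (metis add_0)
    show "frac x \<in> {0..1}" using frac_lt_1[of x] by (simp add: less_imp_le)
  qed (use c sobolev_coeff_sum(1)[OF f r] fourier_coeff_integral[OF sobolev_L2[OF f]] in \<open>auto intro!: continuous_intros\<close>)
  then show ?thesis using periodic1_frac[OF p, of x] by (simp add: wave_frac)
qed

lemma sobolev_sup_bound:
  assumes f: "f \<in> sobolev r" and r: "1 \<le> r"
  shows "\<bar>f x\<bar> \<le> embedding_const * sobolev_norm r f"
proof -
  have "norm (complex_of_real (f x)) \<le> (\<Sum>\<^sub>\<infinity>k. cmod (fourier_coeff f k))"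
    by (rule norm_has_sum_bound[OF _ sobolev_fourier_series[OF f r]])
       (use sobolev_coeff_sum(1)[OF f r] in \<open>simp add: norm_mult\<close>)
  then show ?thesis using sobolev_coeff_sum(2)[OF f r] by simp
qed

text \<open>Differentiating the Fourier series costs a factor k, hence one order; the remaining
  order makes the differentiated series absolutely and uniformly convergent.\<close>

lemma sobolev_derivative:
  assumes f: "f \<in> sobolev r" and r: "2 \<le> r"
  obtains f' where "continuous_on UNIV f'" "periodic1 f'" "\<And>x. (f has_real_derivative f' x) (at x)"
    "\<And>x. \<bar>f' x\<bar> \<le> 2 * pi * embedding_const * sobolev_norm r f"
proof -
  define c where "c k = (2 * pi * of_int k * \<i>) * fourier_coeff f k" for k
  define d where "d k = \<bar>of_int k\<bar> * cmod (fourier_coeff f k)" for k :: int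
  have nc: "norm (c k) = 2 * pi * d k" for k by (simp add: c_def d_def norm_mult)
  have s2: "(\<lambda>k. weight k ^ 2 * (cmod (fourier_coeff f k))\<^sup>2) summable_on UNIV"
    and le2: "(\<Sum>\<^sub>\<infinity>k. weight k ^ 2 * (cmod (fourier_coeff f k))\<^sup>2) \<le> (sobolev_norm r f)\<^sup>2"
    using sobolev_weighted_sum[OF f, of 2] r by auto
  have le: "weight k * (d k)\<^sup>2 \<le> weight k ^ 2 * (cmod (fourier_coeff f k))\<^sup>2" for k
  proof -
    have "weight k * ((of_int k)\<^sup>2 * (cmod (fourier_coeff f k))\<^sup>2) \<le> weight k * (weight k * (cmod (fourier_coeff f k))\<^sup>2)"
      by (intro mult_left_mono mult_right_mono) (auto simp: weight_def)
    then show ?thesis by (simp add: d_def power_mult_distrib power2_eq_square[of "weight k"] mult.assoc)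
  qed
  have s1: "(\<lambda>k. weight k * (d k)\<^sup>2) summable_on UNIV"
    by (rule summable_on_comparison_test[OF s2 le]) simp
  have "(\<Sum>\<^sub>\<infinity>k. weight k * (d k)\<^sup>2) \<le> (sobolev_norm r f)\<^sup>2"
    using infsum_mono[OF s1 s2 le] le2 by linarith
  then have "sqrt (\<Sum>\<^sub>\<infinity>k. weight k * (d k)\<^sup>2) \<le> sobolev_norm r f"
    by (rule real_le_lsqrt[OF sobolev_norm_nonneg])
  moreover have d0: "0 \<le> d k" for k by (simp add: d_def)
  ultimately have dle: "infsum d UNIV \<le> embedding_const * sobolev_norm r f"
    using weighted_Cauchy_Schwarz(2)[OF d0 s1] mult_left_mono[OF _ embedding_const_nonneg] by (meson order_trans)
  have ds: "d summable_on UNIV" by (rule weighted_Cauchy_Schwarz(1)[OF d0 s1])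
  have cs: "(\<lambda>k. norm (c k)) summable_on UNIV"
    unfolding nc by (intro summable_on_cmult_right ds)
  define V where "V x = (\<Sum>\<^sub>\<infinity>k. c k * wave k x)" for x
  have u: "uniform_limit UNIV (\<lambda>X x. \<Sum>k\<in>X. c k * wave k x) V (finite_subsets_at_top UNIV)"
    unfolding V_def by (rule Weierstrass_m_test_general[OF _ cs]) (simp add: norm_mult)
  have Vc: "continuous_on UNIV V"
    by (rule uniform_limit_theorem[OF _ u]) (auto intro!: always_eventually continuous_intros)
  \<comment> \<open>The sum \<open>V\<close> is identified as the derivative through its integrals,
    because a uniform limit passes under an integral.\<close>
  have Vi: "integral {a..b} V = of_real (f b - f a)" if ab: "a \<le> b" for a b
  proof -
    have u': "uniform_limit {a..b} (\<lambda>X x. \<Sum>k\<in>X. c k * wave k x) V (finite_subsets_at_top UNIV)"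
      by (rule uniform_limit_on_subset[OF u]) simp
    obtain I J where I: "\<And>X. ((\<lambda>x. \<Sum>k\<in>X. c k * wave k x) has_integral I X) {a..b}"
      and J: "(V has_integral J) {a..b}" and lim: "(I \<longlongrightarrow> J) (finite_subsets_at_top UNIV)"
      by (rule uniform_limit_integral[OF u']) (auto intro!: continuous_intros)
    have "I X = (\<Sum>k\<in>X. fourier_coeff f k * wave k b) - (\<Sum>k\<in>X. fourier_coeff f k * wave k a)" for X
    proof (rule has_integral_unique[OF I])
      have "((\<lambda>x. \<Sum>k\<in>X. fourier_coeff f k * wave k x) has_vector_derivative (\<Sum>k\<in>X. c k * wave k x)) (at x within {a..b})" for x
      proof (rule has_vector_derivative_sum)
        show "((\<lambda>x. fourier_coeff f k * wave k x) has_vector_derivative c k * wave k x) (at x within {a..b})" for k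
          using has_vector_derivative_mult_right[OF has_vector_derivative_wave[of k x "{a..b}"], of "fourier_coeff f k"]
          by (simp add: c_def mult_ac)
      qed
      then show "((\<lambda>x. \<Sum>k\<in>X. c k * wave k x) has_integral ((\<Sum>k\<in>X. fourier_coeff f k * wave k b) - (\<Sum>k\<in>X. fourier_coeff f k * wave k a))) {a..b}"
        by (intro fundamental_theorem_of_calculus ab)
    qed
    moreover have "((\<lambda>X. (\<Sum>k\<in>X. fourier_coeff f k * wave k b) - (\<Sum>k\<in>X. fourier_coeff f k * wave k a)) \<longlongrightarrow> of_real (f b) - of_real (f a)) (finite_subsets_at_top UNIV)"
      using r by (intro tendsto_diff sobolev_fourier_series[OF f, unfolded has_sum_def]) auto
    ultimately have "(I \<longlongrightarrow> of_real (f b) - of_real (f a)) (finite_subsets_at_top UNIV)" by presburger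
    with lim have "J = of_real (f b) - of_real (f a)" by (intro tendsto_unique) auto
    with J show ?thesis by (simp add: integral_unique)
  qed
  define f' where "f' x = Re (V x)" for x
  have f'c: "continuous_on S f'" for S
    unfolding f'_def by (intro continuous_intros continuous_on_subset[OF Vc]) auto
  show thesis
  proof
    show "continuous_on UNIV f'" by (rule f'c)
    show "periodic1 f'" by (simp add: periodic1_def f'_def V_def wave_periodic)
    show "(f has_real_derivative f' x) (at x)" for x
    proof -
      \<comment> \<open>The primitive starts at x - 1 so that x is an interior point and the
        derivative is two-sided.\<close>
      have eq: "f y = f (x - 1) + integral {x - 1..y} f'" if "y \<in> {x - 1..x + 1}" for y
      proof -
        have "V integrable_on {x - 1..y}" by (intro integrable_continuous_interval continuous_on_subset[OF Vc]) auto
        from integral_linear[OF this bounded_linear_Re] have "integral {x - 1..y} f' = Re (integral {x - 1..y} V)"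
          by (simp add: o_def f'_def[abs_def])
        then show ?thesis using Vi[of "x - 1" y] that by simp
      qed
      have "((\<lambda>y. f (x - 1) + integral {x - 1..y} f') has_real_derivative 0 + f' x) (at x within {x - 1..x + 1})"
        by (intro DERIV_add DERIV_const integral_has_real_derivative f'c) simp
      then have d: "((\<lambda>y. f (x - 1) + integral {x - 1..y} f') has_derivative (*) (f' x)) (at x within {x - 1..x + 1})"
        by (simp add: has_field_derivative_def)
      have "(f has_derivative (*) (f' x)) (at x within {x - 1..x + 1})"
        by (rule has_derivative_transform[OF _ eq d]) simp_all
      then show ?thesis
        by (simp add: has_field_derivative_def at_within_Icc_at)
    qed
    show "\<bar>f' x\<bar> \<le> 2 * pi * embedding_const * sobolev_norm r f" for x
    proof -
      have "\<bar>f' x\<bar> \<le> norm (V x)" unfolding f'_def by (rule abs_Re_le_cmod)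
      also have "\<dots> \<le> (\<Sum>\<^sub>\<infinity>k. norm (c k * wave k x))"
        unfolding V_def by (rule norm_infsum_bound) (use cs in \<open>simp add: norm_mult\<close>)
      also have "\<dots> = 2 * pi * infsum d UNIV" by (simp add: norm_mult nc infsum_cmult_right ds)
      also have "\<dots> \<le> 2 * pi * (embedding_const * sobolev_norm r f)"
        by (intro mult_left_mono dle) simp
      finally show ?thesis by simp
    qed
  qed
qed

text \<open>After subtraction of the mean the primitive is periodic, and its coefficients for k
  \<noteq> 0 are those of \<open>f\<close> divided by 2 pi \<i> k. This gains one order, so the
  primitive is the sum of its Fourier series. The summand 1 of the constant pays for the mean, the
  other for the primitive.\<close>

lemma sobolev_integral_bound:
  assumes f: "f \<in> sobolev r" and r: "0 \<le> r" and x: "x \<in> {0..1}"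
  shows "\<bar>integral {0..x} f\<bar> \<le> (1 + 2 * embedding_const) * sobolev_norm r f"
proof -
  note L2 = sobolev_L2[OF f]
  have fi: "f absolutely_integrable_on {0..1}"
    by (rule integrable_circle_imp(1)[OF L2_circle_integrable[OF L2]])
  define N where "N = sobolev_norm r f"
  define m where "m = integral {0..1} f"
  define F where "F z = complex_of_real (f z - m)" for z
  define G where "G z = integral {0..z} F" for z
  have s0: "(\<lambda>k. (cmod (fourier_coeff f k))\<^sup>2) summable_on UNIV"
    and le0: "(\<Sum>\<^sub>\<infinity>k. (cmod (fourier_coeff f k))\<^sup>2) \<le> N\<^sup>2"
    using sobolev_weighted_sum[OF f, of 0] r by (auto simp: N_def)
  have ci: "(\<lambda>z. complex_of_real (f z)) absolutely_integrable_on {0..1}"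
    using fi absolutely_integrable_linear[OF fi bounded_linear_of_real] by (simp add: o_def)
  have Fi: "F absolutely_integrable_on {0..1}"
    unfolding F_def of_real_diff by (intro set_integral_diff ci absolutely_integrable_on_const) auto
  have Fv: "integral {0..z} F = of_real (integral {0..z} f - z * m)" if "z \<in> {0..1}" for z
  proof -
    have i: "f integrable_on {0..z}"
      using fi that by (auto simp: absolutely_integrable_on_def elim: integrable_on_subinterval)
    have "((\<lambda>y. f y - m) has_integral (integral {0..z} f - z * m)) {0..z}"
      using that has_integral_const_real[of m 0 z] by (intro has_integral_diff integrable_integral i) auto
    from has_integral_linear[OF this bounded_linear_of_real] show ?thesis
      by (auto simp: F_def[abs_def] o_def intro!: integral_unique)
  qed
  have G0: "G 0 = 0" by (simp add: G_def)
  have G1: "G 1 = 0" by (simp add: G_def Fv m_def)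
  define c where "c k = integral {0..1} (\<lambda>x. G x * wave (- k) x)" for k
  define d where "d k = cmod (fourier_coeff f k) / sqrt (weight k)" for k
  have coef: "c k = fourier_coeff f k / (2 * pi * of_int k * \<i>)" if k: "k \<noteq> 0" for k
  proof -
    have "integral {0..1} (\<lambda>x. F x * wave (- k) x) = fourier_coeff f k"
    proof -
      have "((\<lambda>x. of_real (f x) * wave (- k) x - of_real m * wave (- k) x) has_integral (fourier_coeff f k - of_real m * 0)) {0..1}"
      proof (intro has_integral_diff has_integral_mult_right)
        show "((\<lambda>x. of_real (f x) * wave (- k) x) has_integral fourier_coeff f k) {0..1}"
          using integrable_circle_imp(2)[OF integrable_circle_wave[OF L2]] fourier_coeff_integral[OF L2]
          by (simp add: has_integral_iff)
        show "(wave (- k) has_integral 0) {0..1}"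
          using integral_wave[of "- k"] k by (auto simp: has_integral_iff intro!: integrable_continuous_interval continuous_on_wave)
      qed
      then show ?thesis by (auto simp: F_def left_diff_distrib intro: integral_unique)
    qed
    moreover have "integral {0..1} (\<lambda>x. F x * wave (- k) x) + 2 * pi * of_int (- k) * \<i> * c k = G 1 - G 0"
      unfolding c_def by (rule indefinite_integral_fourier[OF Fi, of G 0]) (simp add: G_def)
    ultimately have "fourier_coeff f k = (2 * pi * of_int k * \<i>) * c k"
      using G0 G1 by (simp add: algebra_simps)
    then show ?thesis using k by simp
  qed
  have cd: "norm (c k) \<le> d k" if k: "k \<noteq> 0" for k
  proof -
    have "norm (c k) = cmod (fourier_coeff f k) / (2 * pi * \<bar>of_int k\<bar>)"
      by (simp add: coef[OF k] norm_divide norm_mult)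
    also have "\<dots> \<le> cmod (fourier_coeff f k) / sqrt (weight k)"
    proof (rule divide_left_mono)
      have "1 \<le> \<bar>real_of_int k\<bar>" using k by linarith
      then have "1 \<le> (real_of_int k)\<^sup>2" by (simp add: one_le_power abs_le_square_iff[of 1, simplified])
      have "weight k \<le> (2 * \<bar>of_int k\<bar>)\<^sup>2"
        using \<open>1 \<le> (real_of_int k)\<^sup>2\<close> by (simp add: weight_def power_mult_distrib)
      then have "sqrt (weight k) \<le> 2 * \<bar>of_int k\<bar>" by (rule real_le_lsqrt[rotated]) simp
      also have "\<dots> \<le> 2 * pi * \<bar>of_int k\<bar>" using pi_gt3 by (intro mult_right_mono) auto
      finally show "sqrt (weight k) \<le> 2 * pi * \<bar>of_int k\<bar>" .
    qed (use k in auto)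
    finally show ?thesis by (simp add: d_def)
  qed
  have d0: "0 \<le> d k" for k by (simp add: d_def)
  have wd: "weight k * (d k)\<^sup>2 = (cmod (fourier_coeff f k))\<^sup>2" for k
    by (simp add: d_def power_divide)
  have ds: "d summable_on UNIV" and dle: "infsum d UNIV \<le> embedding_const * sqrt (\<Sum>\<^sub>\<infinity>k. (cmod (fourier_coeff f k))\<^sup>2)"
    using weighted_Cauchy_Schwarz[of d, OF d0] s0 by (simp_all add: wd)
  have "sqrt (\<Sum>\<^sub>\<infinity>k. (cmod (fourier_coeff f k))\<^sup>2) \<le> N"
    using le0 by (intro real_le_lsqrt) (auto simp: N_def sobolev_norm_nonneg)
  then have dle': "infsum d UNIV \<le> embedding_const * N"
    using dle mult_left_mono[OF _ embedding_const_nonneg] by (meson order_trans)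
  have cs: "(\<lambda>k. norm (c k)) summable_on UNIV"
  proof (rule summable_on_comparison_test)
    \<comment> \<open>\<open>d\<close> bounds \<open>c k\<close> only for nonzero k; the extra term
      covers the mean of the primitive.\<close>
    show "(\<lambda>k. d k + (if k = 0 then norm (c 0) else 0)) summable_on UNIV"
      by (intro summable_on_add ds finite_nonzero_values_imp_summable_on) (auto intro: finite_subset[of _ "{0}"])
  qed (use cd d0 in auto)
  have Gc: "continuous_on {0..1} G"
    unfolding G_def using Fi by (intro indefinite_integral_continuous_1) (simp add: absolutely_integrable_on_def)
  have hs: "((\<lambda>k. c k * wave k y) has_sum G y) UNIV" if "y \<in> {0..1}" for y
    by (rule fourier_series_has_sum[OF Gc _ c_def cs that]) (simp add: G0 G1)
  \<comment> \<open>Subtracting the value at 0, where \<open>G\<close> vanishes, cancels the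
    uncontrolled term k = 0 at the price of a factor 2 for the others.\<close>
  have "((\<lambda>k. c k * wave k x - c k * wave k 0) has_sum (G x - G 0)) UNIV"
    using has_sum_add[OF hs[OF x] has_sum_uminusI[OF hs[of 0]]] by simp
  then have "norm (G x - G 0) \<le> (\<Sum>\<^sub>\<infinity>k. 2 * d k)"
  proof (rule norm_infsum_le)
    show "((\<lambda>k. 2 * d k) has_sum (\<Sum>\<^sub>\<infinity>k. 2 * d k)) UNIV"
      by (intro has_sum_infsum summable_on_cmult_right ds)
    fix k
    show "norm (c k * wave k x - c k * wave k 0) \<le> 2 * d k"
    proof (cases "k = 0")
      case False
      have "norm (c k * wave k x - c k * wave k 0) \<le> norm (c k * wave k x) + norm (c k * wave k 0)"
        by (rule norm_triangle_ineq4)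
      also have "\<dots> \<le> 2 * d k" using cd[OF False] by (simp add: norm_mult)
      finally show ?thesis .
    qed (simp add: d0)
  qed
  also have "\<dots> = 2 * infsum d UNIV" by (rule infsum_cmult_right[OF ds])
  finally have "norm (G x) \<le> 2 * (embedding_const * N)" using dle' G0 by simp
  then have Gb: "\<bar>integral {0..x} f - x * m\<bar> \<le> 2 * (embedding_const * N)"
    unfolding G_def Fv[OF x] norm_of_real .
  have "(cmod (fourier_coeff f 0))\<^sup>2 \<le> N\<^sup>2"
    using finite_sum_le_infsum[OF s0, of "{0}"] le0 by simp
  then have "cmod (fourier_coeff f 0) \<le> N"
    by (rule power2_le_imp_le) (simp add: N_def sobolev_norm_nonneg)
  moreover have "fourier_coeff f 0 = of_real m"
    using has_integral_linear[OF integrable_integral bounded_linear_of_real, of f "{0..1}"] fi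
    by (auto simp: fourier_coeff_integral[OF L2] m_def o_def absolutely_integrable_on_def intro!: integral_unique)
  ultimately have "\<bar>m\<bar> \<le> N" by simp
  then have "\<bar>x * m\<bar> \<le> 1 * N" unfolding abs_mult using x by (intro mult_mono) auto
  then show ?thesis using Gb by (simp add: N_def algebra_simps)
qed

text \<open>The primitive is continuous with vanishing coefficients for k \<noteq> 0, so it is
  constant by \<open>fourier_uniqueness\<close>, and all integrals over [0, x] vanish.\<close>

lemma AE_zero_if_fourier_zero:
  assumes f: "integrable circle f" and z: "\<And>k. integral {0..1} (\<lambda>x. of_real (f x) * wave k x) = 0"
  shows "AE x in circle. f x = 0"
proof (rule AE_zero_if_indefinite_integral_zero[OF f])
  fix x :: real assume x: "x \<in> {0..1}"
  note fi = integrable_circle_imp[OF f]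
  define F where "F z = complex_of_real (f z)" for z
  define G where "G z = integral {0..z} F" for z
  have Fi: "F absolutely_integrable_on {0..1}"
    using absolutely_integrable_linear[OF fi(1) bounded_linear_of_real] by (simp add: o_def F_def[abs_def])
  have Gc: "continuous_on {0..1} G"
    unfolding G_def using Fi by (intro indefinite_integral_continuous_1) (simp add: absolutely_integrable_on_def)
  have G0: "G 0 = 0" by (simp add: G_def)
  have G1: "G 1 = 0" using z[of 0] by (simp add: G_def F_def[abs_def])
  define c where "c = integral {0..1} G"
  have "wave_orthogonal (\<lambda>y. G y - c)"
    unfolding wave_orthogonal_def
  proof (intro conjI allI)
    show "continuous_on {0..1} (\<lambda>y. G y - c)" by (intro continuous_intros Gc)
    fix k
    have "integral {0..1} (\<lambda>y. (G y - c) * wave k y) = integral {0..1} (\<lambda>y. G y * wave k y) - c * integral {0..1} (wave k)"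
      unfolding left_diff_distrib
      by (subst integral_diff) (auto intro!: integrable_continuous_interval continuous_intros Gc)
    also have "\<dots> = 0"
    proof (cases "k = 0")
      case False
      have "integral {0..1} (\<lambda>x. F x * wave k x) + 2 * pi * of_int k * \<i> * integral {0..1} (\<lambda>x. G x * wave k x) = G 1 - G 0"
        by (rule indefinite_integral_fourier[OF Fi, of G 0]) (simp add: G_def)
      then show ?thesis using z[of k] G0 G1 False by (simp add: F_def integral_wave)
    qed (simp add: c_def integral_wave)
    finally show "integral {0..1} (\<lambda>y. (G y - c) * wave k y) = 0" .
  qed
  from fourier_uniqueness[OF this, of 0] fourier_uniqueness[OF this _ x] have "G x = G 0"
    by (simp add: G0 G1)
  moreover have "G x = of_real (integral {0..x} f)"
  proof -
    have "f integrable_on {0..x}" using fi(2) x by (auto elim: integrable_on_subinterval)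
    from has_integral_linear[OF integrable_integral[OF this] bounded_linear_of_real] show ?thesis
      by (auto simp: G_def F_def[abs_def] o_def intro!: integral_unique)
  qed
  ultimately show "integral {0..x} f = 0" using G0 by simp
qed

section \<open>Weak derivatives\<close>

lemma test_function_trig: "test_function (\<lambda>x. a * cos (2 * pi * of_int k * x) + b * sin (2 * pi * of_int k * x))"
proof -
  let ?w = "2 * pi * of_int k"
  let ?\<phi> = "\<lambda>a b x. a * cos (?w * x) + b * sin (?w * x)"
  have d: "(?\<phi> a b has_real_derivative ?\<phi> (?w * b) (- ?w * a) x) (at x)" for a b x
    by (auto intro!: derivative_eq_intros)
  have "deriv (?\<phi> a b) = ?\<phi> (?w * b) (- ?w * a)" for a b
    using DERIV_imp_deriv[OF d] by (intro ext)
  note deriv = this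
  \<comment> \<open>Combinations of cosine and sine of one frequency are closed under
    differentiation, so the induction only tracks two coefficients.\<close>
  have "\<exists>a' b'. (deriv ^^ n) (?\<phi> a b) = ?\<phi> a' b'" for n
  proof (induction n)
    case 0
    show ?case by (intro exI[of _ a] exI[of _ b]) simp
  next
    case (Suc n)
    then obtain a' b' where "(deriv ^^ n) (?\<phi> a b) = ?\<phi> a' b'" by blast
    then have "(deriv ^^ Suc n) (?\<phi> a b) = ?\<phi> (?w * b') (- ?w * a')"
      by (simp only: funpow.simps o_apply deriv)
    then show ?case by blast
  qed
  then have "(deriv ^^ n) (?\<phi> a b) field_differentiable at x" for n x
  proof -
    obtain a' b' where "(deriv ^^ n) (?\<phi> a b) = ?\<phi> a' b'"
      using \<open>\<And>n. \<exists>a' b'. (deriv ^^ n) (?\<phi> a b) = ?\<phi> a' b'\<close> by blast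
    with d[of a' b' x] show ?thesis unfolding field_differentiable_def by (metis (no_types))
  qed
  moreover have "periodic1 (?\<phi> a b)"
  proof -
    have "cos (?w * (x + 1)) = Re (wave k (x + 1))" "sin (?w * (x + 1)) = Im (wave k (x + 1))" for x
      by (simp_all add: wave_def)
    then show ?thesis by (simp add: periodic1_def wave_periodic) (simp add: wave_def)
  qed
  ultimately show ?thesis by (simp add: test_function_def)
qed

text \<open>Test functions are real, so the exponential is split into cosine and sine. From here on
  a weak derivative acts through its Fourier coefficients.\<close>

lemma weak_deriv_fourier:
  assumes "weak_deriv f g"
  shows "(2 * pi * of_int k * \<i>) * integral {0..1} (\<lambda>x. of_real (f x) * wave k x) = - integral {0..1} (\<lambda>x. of_real (g x) * wave k x)"
proof -
  let ?w = "2 * pi * of_int k :: real"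
  let ?c = "\<lambda>x. cos (?w * x)" and ?s = "\<lambda>x. sin (?w * x)"
  have fg: "f \<in> L2_circle" "g \<in> L2_circle" using assms by (auto simp: weak_deriv_def)
  have split: "integral {0..1} (\<lambda>x. of_real (h x) * wave k x) = Complex (integral\<^sup>L circle (\<lambda>x. h x * ?c x)) (integral\<^sup>L circle (\<lambda>x. h x * ?s x))"
    if "h \<in> L2_circle" for h
  proof -
    have "integral\<^sup>L circle (\<lambda>x. of_real (h x) * wave k x) = Complex (integral\<^sup>L circle (\<lambda>x. h x * ?c x)) (integral\<^sup>L circle (\<lambda>x. h x * ?s x))"
      using integrable_circle_wave[OF that, of k] by (intro complex_eqI) (simp_all flip: integral_Re integral_Im, simp_all add: wave_def)
    then show ?thesis using integrable_circle_imp(3)[OF integrable_circle_wave[OF that, of k]] by simp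
  qed
  have "test_function ?c" "test_function ?s"
    using test_function_trig[of 1 k 0] test_function_trig[of 0 k 1] by simp_all
  moreover have "deriv ?c = (\<lambda>x. - ?w * ?s x)" "deriv ?s = (\<lambda>x. ?w * ?c x)"
    by (intro ext DERIV_imp_deriv; auto intro!: derivative_eq_intros)+
  moreover have weak: "integral\<^sup>L circle (\<lambda>x. f x * deriv \<phi> x) = - integral\<^sup>L circle (\<lambda>x. g x * \<phi> x)"
    if "test_function \<phi>" for \<phi>
    using assms that unfolding weak_deriv_def by blast
  ultimately have "integral\<^sup>L circle (\<lambda>x. f x * (- ?w * ?s x)) = - integral\<^sup>L circle (\<lambda>x. g x * ?c x)"
    "integral\<^sup>L circle (\<lambda>x. f x * (?w * ?c x)) = - integral\<^sup>L circle (\<lambda>x. g x * ?s x)"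
    using weak[of ?c] weak[of ?s] by simp_all
  moreover have "(\<lambda>x. f x * (- ?w * ?s x)) = (\<lambda>x. - ?w * (f x * ?s x))" "(\<lambda>x. f x * (?w * ?c x)) = (\<lambda>x. ?w * (f x * ?c x))"
    by (simp_all add: fun_eq_iff)
  ultimately have "- ?w * integral\<^sup>L circle (\<lambda>x. f x * ?s x) = - integral\<^sup>L circle (\<lambda>x. g x * ?c x)"
    "?w * integral\<^sup>L circle (\<lambda>x. f x * ?c x) = - integral\<^sup>L circle (\<lambda>x. g x * ?s x)"
    by (simp_all only: integral_mult_right_zero)
  then show ?thesis unfolding split[OF fg(1)] split[OF fg(2)]
    by (intro complex_eqI) simp_all
qed

text \<open>\<open>f\<close> and the primitive of \<open>g\<close> have the same coefficients for k
  \<noteq> 0, and the constant c accounts for k = 0. Testing with the constant function 1 gives the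
  vanishing integral of \<open>g\<close>, which makes the primitive periodic.\<close>

lemma weak_deriv_indefinite_integral:
  assumes w: "weak_deriv f g"
  obtains c where "AE x in circle. f x = c + integral {0..x} g" and "integral {0..1} g = 0"
proof -
  have fg: "f \<in> L2_circle" "g \<in> L2_circle" using w by (auto simp: weak_deriv_def)
  note gi = integrable_circle_imp[OF L2_circle_integrable[OF fg(2)]]
  define F where "F z = complex_of_real (g z)" for z
  have Fi: "F absolutely_integrable_on {0..1}"
    using absolutely_integrable_linear[OF gi(1) bounded_linear_of_real] by (simp add: o_def F_def[abs_def])
  define G where "G z = integral {0..z} g" for z
  have Gc: "continuous_on {0..1} G"
    unfolding G_def by (intro indefinite_integral_continuous_1 gi)
  have GF: "of_real (G z) = 0 + integral {0..z} F" if "z \<in> {0..1}" for z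
  proof -
    have "g integrable_on {0..z}" using gi(2) that by (auto elim: integrable_on_subinterval)
    from has_integral_linear[OF integrable_integral[OF this] bounded_linear_of_real] show ?thesis
      by (auto simp: G_def F_def[abs_def] o_def intro!: integral_unique[symmetric])
  qed
  have G0: "G 0 = 0" by (simp add: G_def)
  have "of_real (G 1) = (0 :: complex)"
    using weak_deriv_fourier[OF w, of 0] GF[of 1] by (simp add: F_def[abs_def])
  then have G1: "G 1 = 0" by simp
  define c where "c = integral {0..1} (\<lambda>x. f x - G x)"
  have Gi: "integrable circle G" by (rule continuous_imp_integrable_real[OF Gc])
  have fG: "integrable circle (\<lambda>x. f x - G x - c)"
    using L2_circle_integrable[OF fg(1)] Gi continuous_imp_integrable_real[of 0 1 "\<lambda>x. c"] by auto
  have fGi: "(\<lambda>x. f x - G x) integrable_on {0..1}"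
    using L2_circle_integrable[OF fg(1)] Gi by (intro integrable_circle_imp(2)) auto
  have "AE x in circle. f x - G x - c = 0"
  proof (rule AE_zero_if_fourier_zero[OF fG])
    fix k
    have i1: "(\<lambda>x. of_real (f x) * wave k x) integrable_on {0..1}"
      by (rule integrable_circle_imp(2)[OF integrable_circle_wave[OF fg(1)]])
    have i2: "(\<lambda>x. of_real (G x) * wave k x) integrable_on {0..1}"
      by (intro integrable_continuous_interval continuous_intros Gc)
    have i3: "(\<lambda>x. of_real c * wave k x) integrable_on {0..1}"
      by (intro integrable_continuous_interval continuous_intros)
    have "integral {0..1} (\<lambda>x. of_real (f x - G x - c) * wave k x) =
        integral {0..1} (\<lambda>x. of_real (f x) * wave k x) - integral {0..1} (\<lambda>x. of_real (G x) * wave k x) - of_real c * integral {0..1} (wave k)"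
      using integral_diff[OF integrable_diff[OF i1 i2] i3] integral_diff[OF i1 i2]
      by (simp add: left_diff_distrib)
    also have "\<dots> = 0"
    proof (cases "k = 0")
      case True
      have "((\<lambda>x. complex_of_real (f x - G x)) has_integral of_real c) {0..1}"
        using has_integral_linear[OF integrable_integral[OF fGi] bounded_linear_of_real] by (simp add: o_def c_def)
      moreover have "((\<lambda>x. complex_of_real (f x - G x)) has_integral integral {0..1} (\<lambda>x. of_real (f x) * wave k x) - integral {0..1} (\<lambda>x. of_real (G x) * wave k x)) {0..1}"
        using has_integral_diff[OF integrable_integral[OF i1] integrable_integral[OF i2]] True by simp
      ultimately have "of_real c = integral {0..1} (\<lambda>x. of_real (f x) * wave k x) - integral {0..1} (\<lambda>x. of_real (G x) * wave k x)"
        by (rule has_integral_unique)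
      then show ?thesis using True by (simp add: integral_wave)
    next
      case False
      have "integral {0..1} (\<lambda>x. F x * wave k x) + 2 * pi * of_int k * \<i> * integral {0..1} (\<lambda>x. of_real (G x) * wave k x) = of_real (G 1) - of_real (G 0)"
        by (rule indefinite_integral_fourier[OF Fi GF])
      then have "(2 * pi * of_int k * \<i>) * integral {0..1} (\<lambda>x. of_real (G x) * wave k x) = - integral {0..1} (\<lambda>x. of_real (g x) * wave k x)"
        using G0 G1 by (simp add: add_eq_0_iff F_def)
      then have "(2 * pi * of_int k * \<i>) * integral {0..1} (\<lambda>x. of_real (f x) * wave k x) = (2 * pi * of_int k * \<i>) * integral {0..1} (\<lambda>x. of_real (G x) * wave k x)"
        using weak_deriv_fourier[OF w, of k] by (simp only:)
      then show ?thesis using False by (simp add: integral_wave)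
    qed
    finally show "integral {0..1} (\<lambda>x. of_real (f x - G x - c) * wave k x) = 0" .
  qed
  then have "AE x in circle. f x = c + integral {0..x} g"
    by eventually_elim (simp add: G_def)
  moreover have "integral {0..1} g = 0" using G1 by (simp add: G_def)
  ultimately show thesis by (rule that)
qed

lemma continuous_AE_eq:
  fixes f g :: "real \<Rightarrow> real"
  assumes f: "continuous_on {0..1} f" and g: "continuous_on {0..1} g" and ae: "AE x in circle. f x = g x" and x: "x \<in> {0..1}"
  shows "f x = g x"
proof -
  have c: "continuous_on {0..1} (\<lambda>x. \<bar>f x - g x\<bar>)" by (intro continuous_intros f g)
  have "AE x in circle. \<bar>f x - g x\<bar> = 0" using ae by eventually_elim simp
  then have "integral\<^sup>L circle (\<lambda>x. \<bar>f x - g x\<bar>) = 0" by (rule integral_eq_zero_AE)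
  then show ?thesis using integralL_eq_0_iff[OF c] x by auto
qed

lemma weak_deriv_continuous:
  assumes w: "weak_deriv f g" and f: "continuous_on {0..1} f" and x: "x \<in> {0..1}"
  shows "f x = f 0 + integral {0..x} g" "integral {0..1} g = 0"
proof -
  obtain c where c: "AE x in circle. f x = c + integral {0..x} g" and g0: "integral {0..1} g = 0"
    using weak_deriv_indefinite_integral[OF w] by metis
  have "g integrable_on {0..1}"
    using w by (intro integrable_circle_imp(2) L2_circle_integrable) (simp add: weak_deriv_def)
  then have "continuous_on {0..1} (\<lambda>x. c + integral {0..x} g)"
    by (intro continuous_intros indefinite_integral_continuous_1)
  note eq = continuous_AE_eq[OF f this c]
  show "f x = f 0 + integral {0..x} g" using eq[OF x] eq[of 0] by simp
  show "integral {0..1} g = 0" by (rule g0)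
qed

text \<open>Both derivatives have the primitive f - f 0 on [0, x]. This replaces the weak slope in
  the equations by the classical one.\<close>

lemma weak_deriv_unique_classical:
  assumes w: "weak_deriv f g" and f: "\<And>x. x \<in> {0..1} \<Longrightarrow> (f has_real_derivative f' x) (at x within {0..1})"
    and f': "continuous_on {0..1} f'"
  shows "AE x in circle. g x = f' x"
proof -
  have fc: "continuous_on {0..1} f"
    by (rule DERIV_continuous_on[OF f])
  have g: "integrable circle g" using w by (intro L2_circle_integrable) (simp add: weak_deriv_def)
  have "AE x in circle. g x - f' x = 0"
  proof (rule AE_zero_if_indefinite_integral_zero)
    show "integrable circle (\<lambda>x. g x - f' x)"
      using g continuous_imp_integrable_real[OF f'] by auto
    fix x :: real assume x: "x \<in> {0..1}"
    have "(f' has_integral (f x - f 0)) {0..x}"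
      using x by (intro fundamental_theorem_of_calculus)
        (auto simp flip: has_real_derivative_iff_has_vector_derivative intro: DERIV_subset[OF f])
    moreover have "(g has_integral (f x - f 0)) {0..x}"
      using weak_deriv_continuous(1)[OF w fc x] integrable_on_subinterval[OF integrable_circle_imp(2)[OF g], of 0 x] x
      by (auto simp: has_integral_iff)
    ultimately have "((\<lambda>x. g x - f' x) has_integral (f x - f 0) - (f x - f 0)) {0..x}"
      by (intro has_integral_diff)
    then show "integral {0..x} (\<lambda>x. g x - f' x) = 0" by (simp add: integral_unique)
  qed
  then show ?thesis by eventually_elim simp
qed

section \<open>Time-dependent Sobolev functions\<close>

definition antiderivative :: "(real \<Rightarrow> real) \<Rightarrow> real \<Rightarrow> real" where
  "antiderivative f x = integral {0..x} f - integral {x..0} f"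

lemma antiderivative_nonneg: "0 \<le> x \<Longrightarrow> antiderivative f x = integral {0..x} f"
  by (cases "x = 0") (auto simp: antiderivative_def)

lemma antiderivative_has_derivative:
  assumes c: "continuous_on UNIV f"
  shows "(antiderivative f has_real_derivative f x) (at x)"
proof -
  define M where "M = \<bar>x\<bar> + 1"
  have M: "0 \<le> M" by (simp add: M_def)
  have i: "f integrable_on {a..b}" for a b
    by (intro integrable_continuous_interval continuous_on_subset[OF c]) auto
  have eq: "antiderivative f y = integral {-M..y} f - integral {-M..0} f" if "y \<in> {-M..M}" for y
  proof (cases "0 \<le> y")
    case True
    then show ?thesis
      using Henstock_Kurzweil_Integration.integral_combine[OF _ _ i, of "-M" 0 y] M by (simp add: antiderivative_nonneg)
  next
    case False
    then show ?thesis
      using Henstock_Kurzweil_Integration.integral_combine[OF _ _ i, of "-M" y 0] that by (simp add: antiderivative_def)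
  qed
  have "((\<lambda>y. integral {-M..y} f - integral {-M..0} f) has_real_derivative f x - 0) (at x within {-M..M})"
    by (intro DERIV_diff DERIV_const integral_has_real_derivative continuous_on_subset[OF c]) (auto simp: M_def)
  then have d: "((\<lambda>y. integral {-M..y} f - integral {-M..0} f) has_derivative (*) (f x)) (at x within {-M..M})"
    by (simp add: has_field_derivative_def)
  have "(antiderivative f has_derivative (*) (f x)) (at x within {-M..M})"
    by (rule has_derivative_transform[OF _ eq d]) (auto simp: M_def)
  moreover have "at x within {-M..M} = at x" by (rule at_within_Icc_at) (auto simp: M_def)
  ultimately show ?thesis by (simp add: has_field_derivative_def)
qed

text \<open>A primitive of a periodic function is periodic up to a linear drift whose slope is the
  integral over one period. This reduces all x to the unit interval.\<close>

lemma antiderivative_shift: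
  assumes c: "continuous_on UNIV f" and p: "periodic1 f"
  shows "antiderivative f x = antiderivative f (frac x) + (x - frac x) * antiderivative f 1"
proof -
  have "((\<lambda>x. antiderivative f (x + 1) - antiderivative f x) has_real_derivative f (x + 1) - f x) (at x)" for x
    by (intro DERIV_diff antiderivative_has_derivative[OF c] DERIV_shift[THEN iffD1])
  then have "((\<lambda>x. antiderivative f (x + 1) - antiderivative f x) has_real_derivative 0) (at x)" for x
    using p by (simp add: periodic1_def)
  then have step: "antiderivative f (x + 1) - antiderivative f x = antiderivative f (0 + 1) - antiderivative f 0" for x
    using DERIV_isconst_all[of "\<lambda>x. antiderivative f (x + 1) - antiderivative f x"] by blast
  have "antiderivative f (x + 1) = antiderivative f x + antiderivative f 1" for x
    using step[of x] by (simp add: antiderivative_nonneg)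
  then have "periodic1 (\<lambda>x. antiderivative f x - x * antiderivative f 1)"
    by (simp add: periodic1_def algebra_simps)
  from periodic1_frac[OF this, of x] show ?thesis by (simp add: algebra_simps)
qed

text \<open>Periodicity of \<open>f\<close> forces the integral of \<open>k\<close> over a period to
  be zero, so the formula on [0,1] holds on the line and the derivative is two-sided also at the
  integers.\<close>

lemma periodic_primitive_has_derivative:
  assumes f: "periodic1 f" and k: "periodic1 k" "continuous_on UNIV k"
    and eq: "\<And>x. x \<in> {0..1} \<Longrightarrow> f x = f 0 + integral {0..x} k"
  shows "(f has_real_derivative k x) (at x)"
proof -
  have "f 1 = f 0" using f unfolding periodic1_def by (metis add_0)
  then have A1: "antiderivative k 1 = 0" using eq[of 1] by (simp add: antiderivative_nonneg)
  have "f = (\<lambda>x. f 0 + antiderivative k x)"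
  proof
    fix x
    have "f (frac x) = f 0 + antiderivative k (frac x)"
      using eq[of "frac x"] frac_lt_1[of x] by (simp add: antiderivative_nonneg less_imp_le)
    then show "f x = f 0 + antiderivative k x"
      using antiderivative_shift[OF k(2,1), of x] A1 periodic1_frac[OF f, of x] by simp
  qed
  moreover have "((\<lambda>x. f 0 + antiderivative k x) has_real_derivative 0 + k x) (at x)"
    by (intro DERIV_add DERIV_const antiderivative_has_derivative k)
  ultimately show ?thesis by simp
qed

lemma jointly_continuous_if_uniformly_continuous_in_time:
  fixes v :: "real \<Rightarrow> real \<Rightarrow> real"
  assumes c: "\<And>t. t \<in> S \<Longrightarrow> continuous_on UNIV (v t)"
    and N: "\<And>t. t \<in> S \<Longrightarrow> (N t \<longlongrightarrow> 0) (at t within S)"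
    and le: "\<And>t \<tau> x. t \<in> S \<Longrightarrow> \<tau> \<in> S \<Longrightarrow> \<bar>v \<tau> x - v t x\<bar> \<le> C * N t \<tau>"
  shows "continuous_on (S \<times> UNIV) (\<lambda>(t, x). v t x)"
  unfolding continuous_on_iff
proof (intro ballI allI impI)
  fix q :: "real \<times> real" and e :: real assume "q \<in> S \<times> UNIV" and e: "0 < e"
  then obtain t x where q: "q = (t, x)" and t: "t \<in> S" by auto
  have "((\<lambda>\<tau>. C * N t \<tau>) \<longlongrightarrow> C * 0) (at t within S)" by (intro tendsto_intros N t)
  then have "\<forall>\<^sub>F \<tau> in at t within S. dist (C * N t \<tau>) 0 < e / 2"
    using tendstoD[of _ "C * 0" _ "e / 2"] e by simp
  then obtain d1 where d1: "d1 > 0" "\<And>\<tau>. \<tau> \<in> S \<Longrightarrow> \<tau> \<noteq> t \<Longrightarrow> dist \<tau> t < d1 \<Longrightarrow> \<bar>C * N t \<tau>\<bar> < e / 2"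
    unfolding eventually_at by (auto simp: dist_real_def)
  have near: "\<bar>v \<tau> y - v t y\<bar> < e / 2" if "\<tau> \<in> S" "dist \<tau> t < d1" for \<tau> y
  proof (cases "\<tau> = t")
    case False
    then show ?thesis using d1(2)[OF that(1) False that(2)] le[OF t that(1), of y] by linarith
  qed (use e in simp)
  obtain d2 where d2: "d2 > 0" "\<And>y. dist y x < d2 \<Longrightarrow> dist (v t y) (v t x) < e / 2"
    using c[OF t] e unfolding continuous_on_iff by (metis UNIV_I half_gt_zero)
  show "\<exists>d>0. \<forall>p\<in>S \<times> UNIV. dist p q < d \<longrightarrow> dist (case p of (t, x) \<Rightarrow> v t x) (case q of (t, x) \<Rightarrow> v t x) < e"
    unfolding q prod.case
  proof (intro exI conjI ballI impI)
    show "0 < min d1 d2" using d1 d2 by simp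
    fix p assume p: "p \<in> S \<times> (UNIV :: real set)" "dist p (t, x) < min d1 d2"
    obtain \<tau> y where py: "p = (\<tau>, y)" by (cases p)
    have "dist \<tau> t \<le> dist p (t, x)" "dist y x \<le> dist p (t, x)"
      using dist_fst_le[of p "(t, x)"] dist_snd_le[of p "(t, x)"] by (simp_all add: py)
    then have "\<bar>v \<tau> y - v t y\<bar> < e / 2" "dist (v t y) (v t x) < e / 2"
      using near[of \<tau> y] d2(2)[of y] p py by auto
    then show "dist (case p of (t, x) \<Rightarrow> v t x) (v t x) < e"
      unfolding py dist_real_def prod.case by linarith
  qed
qed

section \<open>Curves in Sobolev spaces as functions of time and space\<close>

lemma time_interval_infinity: "time_interval \<infinity> = {0..}"
  by (auto simp: time_interval_def)

lemma sobolev_diff: "f \<in> sobolev r \<Longrightarrow> g \<in> sobolev r \<Longrightarrow> (\<lambda>x. f x - g x) \<in> sobolev r"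
  using sobolev_linear[of f r g 1 "- 1"] by simp

lemma sobolev_divide: "f \<in> sobolev r \<Longrightarrow> (\<lambda>x. f x / c) \<in> sobolev r"
  using sobolev_linear[of f r f "1 / c" 0] by simp

lemma sobolev_continuous_mem: "sobolev_continuous r \<infinity> v \<Longrightarrow> 0 \<le> t \<Longrightarrow> v t \<in> sobolev r"
  and sobolev_continuous_tendsto: "sobolev_continuous r \<infinity> v \<Longrightarrow> 0 \<le> t \<Longrightarrow>
    ((\<lambda>\<tau>. sobolev_norm r (\<lambda>x. v \<tau> x - v t x)) \<longlongrightarrow> 0) (at t within {0..})"
  by (auto simp: sobolev_continuous_def time_interval_infinity)

lemma strip_restrict:
  assumes "continuous_on ({0..} \<times> UNIV) (\<lambda>(t, x). f t x)" "\<And>t. 0 \<le> t \<Longrightarrow> periodic1 (f t)"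
  shows "strip T f"
  unfolding strip_def using assms by (auto intro: continuous_on_subset)

lemma sobolev_continuous_strip:
  assumes v: "sobolev_continuous r \<infinity> v" and r: "1 \<le> r"
  shows "strip T v"
proof (rule strip_restrict)
  note mem = sobolev_continuous_mem[OF v]
  show "continuous_on ({0..} \<times> UNIV) (\<lambda>(t, x). v t x)"
  proof (rule jointly_continuous_if_uniformly_continuous_in_time)
    show "continuous_on UNIV (v t)" if "t \<in> {0..}" for t
      using sobolev_continuous_on[OF mem] that r by simp
    show "((\<lambda>\<tau>. sobolev_norm r (\<lambda>x. v \<tau> x - v t x)) \<longlongrightarrow> 0) (at t within {0..})" if "t \<in> {0..}" for t
      using sobolev_continuous_tendsto[OF v] that by simp
    show "\<bar>v \<tau> x - v t x\<bar> \<le> embedding_const * sobolev_norm r (\<lambda>x. v \<tau> x - v t x)" if "t \<in> {0..}" "\<tau> \<in> {0..}" for t \<tau> x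
      using sobolev_sup_bound[OF sobolev_diff[OF mem mem] r] that by simp
  qed
  show "periodic1 (v t)" if "0 \<le> t" for t by (rule sobolev_periodic[OF mem[OF that]])
qed

lemma sobolev_has_deriv:
  assumes f: "f \<in> sobolev r" and r: "2 \<le> r"
  shows "(f has_real_derivative deriv f x) (at x)" "continuous_on UNIV (deriv f)" "periodic1 (deriv f)"
    "\<bar>deriv f x\<bar> \<le> 2 * pi * embedding_const * sobolev_norm r f"
proof -
  obtain f' where f': "continuous_on UNIV f'" "periodic1 f'" "\<And>x. (f has_real_derivative f' x) (at x)"
    "\<And>x. \<bar>f' x\<bar> \<le> 2 * pi * embedding_const * sobolev_norm r f"
    using sobolev_derivative[OF f r] by metis
  then have "deriv f = f'" by (intro ext DERIV_imp_deriv)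
  with f' show "(f has_real_derivative deriv f x) (at x)" "continuous_on UNIV (deriv f)" "periodic1 (deriv f)"
    "\<bar>deriv f x\<bar> \<le> 2 * pi * embedding_const * sobolev_norm r f" by simp_all
qed

lemma sobolev_continuous_deriv_strip:
  assumes v: "sobolev_continuous r \<infinity> v" and r: "2 \<le> r"
  shows "strip T (\<lambda>t. deriv (v t))"
proof (rule strip_restrict)
  note mem = sobolev_continuous_mem[OF v]
  show "continuous_on ({0..} \<times> UNIV) (\<lambda>(t, x). deriv (v t) x)"
  proof (rule jointly_continuous_if_uniformly_continuous_in_time)
    show "continuous_on UNIV (deriv (v t))" if "t \<in> {0..}" for t
      using sobolev_has_deriv(2)[OF mem r] that by simp
    show "((\<lambda>\<tau>. sobolev_norm r (\<lambda>x. v \<tau> x - v t x)) \<longlongrightarrow> 0) (at t within {0..})" if "t \<in> {0..}" for t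
      using sobolev_continuous_tendsto[OF v] that by simp
    show "\<bar>deriv (v \<tau>) x - deriv (v t) x\<bar> \<le> (2 * pi * embedding_const) * sobolev_norm r (\<lambda>x. v \<tau> x - v t x)"
      if "t \<in> {0..}" "\<tau> \<in> {0..}" for t \<tau> x
    proof -
      have "((\<lambda>x. v \<tau> x - v t x) has_real_derivative deriv (v \<tau>) x - deriv (v t) x) (at x)"
        using that by (intro DERIV_diff sobolev_has_deriv(1)[OF mem r]) auto
      then have "deriv (\<lambda>x. v \<tau> x - v t x) x = deriv (v \<tau>) x - deriv (v t) x" by (rule DERIV_imp_deriv)
      then show ?thesis using sobolev_has_deriv(4)[OF sobolev_diff[OF mem mem] r, of \<tau> t x] that by simp
    qed
  qed
  show "periodic1 (deriv (v t))" if "0 \<le> t" for t by (rule sobolev_has_deriv(3)[OF mem[OF that] r])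
qed

lemma sobolev_C1_quotient_mem:
  assumes v: "sobolev_C1 r \<infinity> v v'" and "0 \<le> t" "0 \<le> \<tau>"
  shows "(\<lambda>x. (v \<tau> x - v t x) / (\<tau> - t) - v' t x) \<in> sobolev r"
  using assms unfolding sobolev_C1_def
  by (intro sobolev_diff sobolev_divide) (auto intro: sobolev_continuous_mem)

lemma sobolev_C1_tendsto:
  assumes v: "sobolev_C1 r \<infinity> v v'" and t: "0 \<le> t"
  shows "((\<lambda>\<tau>. sobolev_norm r (\<lambda>x. (v \<tau> x - v t x) / (\<tau> - t) - v' t x)) \<longlongrightarrow> 0) (at t within {0..})"
  using assms by (auto simp: sobolev_C1_def time_interval_infinity)

lemma real_derivative_if_quotient_bound:
  fixes f :: "real \<Rightarrow> real"
  assumes N: "(N \<longlongrightarrow> 0) (at t within S)"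
    and le: "\<And>\<tau>. \<tau> \<in> S \<Longrightarrow> \<tau> \<noteq> t \<Longrightarrow> \<bar>(f \<tau> - f t) / (\<tau> - t) - D\<bar> \<le> C * N \<tau>"
  shows "(f has_real_derivative D) (at t within S)"
proof -
  have "((\<lambda>\<tau>. C * N \<tau>) \<longlongrightarrow> 0) (at t within S)" using tendsto_mult_left[OF N, of C] by simp
  then have "((\<lambda>\<tau>. (f \<tau> - f t) / (\<tau> - t) - D) \<longlongrightarrow> 0) (at t within S)"
    by (rule Lim_null_comparison[rotated]) (use le in \<open>auto simp: eventually_at_filter\<close>)
  then show ?thesis unfolding has_field_derivative_iff by (simp add: Lim_null[of _ D])
qed

lemma sobolev_C1_pointwise:
  assumes v: "sobolev_C1 r \<infinity> v v'" and r: "1 \<le> r" and t: "0 \<le> t"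
  shows "((\<lambda>\<tau>. v \<tau> x) has_real_derivative v' t x) (at t within {0..})"
  using sobolev_sup_bound[OF sobolev_C1_quotient_mem[OF v t] r]
  by (intro real_derivative_if_quotient_bound[OF sobolev_C1_tendsto[OF v t]]) auto

text \<open>Integration over [0, x] is bounded in every order from 0 on, so it commutes with the
  time derivative even where order 0 gives no control of point values. This is the case of \<rho>
  when s = 2.\<close>

lemma sobolev_C1_integral:
  assumes v: "sobolev_C1 r \<infinity> v v'" and r: "0 \<le> r" and t: "0 \<le> t" and x: "x \<in> {0..1}"
  shows "((\<lambda>\<tau>. integral {0..x} (v \<tau>)) has_real_derivative integral {0..x} (v' t)) (at t within {0..})"
proof (rule real_derivative_if_quotient_bound[OF sobolev_C1_tendsto[OF v t]])
  fix \<tau> :: real assume \<tau>: "\<tau> \<in> {0..}" "\<tau> \<noteq> t"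
  have i: "f integrable_on {0..x}" if "f \<in> sobolev r" for f
    by (rule integrable_on_subinterval[OF integrable_circle_imp(2)[OF L2_circle_integrable[OF sobolev_L2[OF that]]]])
       (use x in auto)
  have m: "v \<tau> \<in> sobolev r" "v t \<in> sobolev r" "v' t \<in> sobolev r"
    using v t \<tau> by (auto simp: sobolev_C1_def intro: sobolev_continuous_mem)
  have "integral {0..x} (\<lambda>x. (v \<tau> x - v t x) / (\<tau> - t) - v' t x)
      = (integral {0..x} (v \<tau>) - integral {0..x} (v t)) / (\<tau> - t) - integral {0..x} (v' t)"
    using has_integral_diff[OF has_integral_divide[OF has_integral_diff[OF integrable_integral[OF i[OF m(1)]] integrable_integral[OF i[OF m(2)]]], of "\<tau> - t"]
      integrable_integral[OF i[OF m(3)]]] by (rule integral_unique)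
  then show "\<bar>(integral {0..x} (v \<tau>) - integral {0..x} (v t)) / (\<tau> - t) - integral {0..x} (v' t)\<bar>
      \<le> (1 + 2 * embedding_const) * sobolev_norm r (\<lambda>x. (v \<tau> x - v t x) / (\<tau> - t) - v' t x)"
    using sobolev_integral_bound[OF sobolev_C1_quotient_mem[OF v t, of \<tau>] r x] \<tau> by simp
qed

section \<open>The equations at a fixed time\<close>

text \<open>The single \<gamma> stands for \<gamma>1 and for 2 \<gamma>2, so both equations have the
  transport velocity u + \<gamma>.\<close>

locale mu_HS_slice =
  fixes \<gamma>1 \<gamma>2 s \<gamma> :: real and u \<rho> ut \<rho>t :: "real \<Rightarrow> real"
  assumes s: "2 \<le> s" and g1: "\<gamma>1 = \<gamma>" and g2: "2 * \<gamma>2 = \<gamma>"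
    and u: "u \<in> sobolev s" and \<rho>: "\<rho> \<in> sobolev (s - 1)" and ut: "ut \<in> sobolev (s - 1)"
    and eqs: "mu_HS_equations \<gamma>1 \<gamma>2 s u \<rho> ut \<rho>t"
begin

lemma u_deriv: "(u has_real_derivative deriv u x) (at x)"
  by (rule sobolev_has_deriv(1)[OF u s])

lemma u_cont: "continuous_on S u"
  by (intro continuous_at_imp_continuous_on ballI DERIV_isCont[OF u_deriv])

lemma ux_cont: "continuous_on S (deriv u)"
  using continuous_on_subset[OF sobolev_has_deriv(2)[OF u s]] by auto

lemma \<rho>_cont: "continuous_on S \<rho>" and ut_cont: "continuous_on S ut"
  using s by (auto intro: continuous_on_subset[OF sobolev_continuous_on[OF \<rho>]] continuous_on_subset[OF sobolev_continuous_on[OF ut]])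

lemma periodic: "periodic1 u" "periodic1 (deriv u)" "periodic1 \<rho>" "periodic1 ut"
  using sobolev_periodic[OF u] sobolev_has_deriv(3)[OF u s] sobolev_periodic[OF \<rho>] sobolev_periodic[OF ut] by auto

lemma periodic_ends: "u 1 = u 0" "\<rho> 1 = \<rho> 0"
  using periodic(1,3)[unfolded periodic1_def, THEN spec, of 0] by simp_all

text \<open>The continuous representative of p_x, read off from the evolution equation because the
  pressure is only given through weak derivatives.\<close>

definition pressure_gradient :: "real \<Rightarrow> real" where
  "pressure_gradient x = ut x - (u x + \<gamma>) * deriv u x"

definition energy :: real where
  "energy = integral {0..1} (\<lambda>x. (deriv u x)\<^sup>2 + (\<rho> x)\<^sup>2)"

lemma pressure_gradient_cont: "continuous_on S pressure_gradient"
  unfolding pressure_gradient_def by (intro continuous_intros ut_cont u_cont ux_cont)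

lemma pressure_gradient_periodic: "periodic1 pressure_gradient"
  using periodic by (simp add: periodic1_def pressure_gradient_def)

text \<open>The equations with the weak slope replaced by \<open>deriv u\<close> and with one common
  weak derivative of the pressure.\<close>

lemma equations:
  obtains \<rho>x p px pxx where "weak_deriv \<rho> \<rho>x" "weak_deriv p px" "weak_deriv px pxx"
    "AE x in circle. mean p - pxx x = 2 * mean u * u x + (deriv u x)\<^sup>2 / 2 + (\<rho> x)\<^sup>2 / 2"
    "AE x in circle. pressure_gradient x = px x"
    "AE x in circle. \<rho>t x = (u x + \<gamma>) * \<rho>x x + deriv u x * \<rho> x"
proof -
  obtain ux \<rho>x p px where w: "weak_deriv u ux" "weak_deriv \<rho> \<rho>x" "weak_deriv p px"
    and inv: "mu_dxx_inverse (s + 1) (\<lambda>x. 2 * mean u * u x + (ux x)\<^sup>2 / 2 + (\<rho> x)\<^sup>2 / 2) p"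
    and e1: "AE x in circle. ut x - (u x + \<gamma>) * ux x = px x"
    and e2: "AE x in circle. \<rho>t x - (u x + \<gamma>) * \<rho>x x = ux x * \<rho> x"
    using eqs unfolding mu_HS_equations_def g1 g2 by blast
  obtain qx pxx where q: "weak_deriv p qx" "weak_deriv qx pxx"
    and e3: "AE x in circle. mean p - pxx x = 2 * mean u * u x + (ux x)\<^sup>2 / 2 + (\<rho> x)\<^sup>2 / 2"
    using inv unfolding mu_dxx_inverse_def by blast
  have ux: "AE x in circle. ux x = deriv u x"
    by (rule weak_deriv_unique_classical[OF w(1) has_field_derivative_at_within[OF u_deriv] ux_cont])
  \<comment> \<open>The inverse operator brings its own weak derivative of p; both candidates have
    the same Fourier coefficients.\<close>
  have "weak_deriv p qx \<Longrightarrow> weak_deriv p px \<Longrightarrow> AE x in circle. qx x - px x = 0"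
  proof (rule AE_zero_if_fourier_zero)
    assume pq: "weak_deriv p qx" "weak_deriv p px"
    then have L: "qx \<in> L2_circle" "px \<in> L2_circle" by (auto simp: weak_deriv_def)
    then show "integrable circle (\<lambda>x. qx x - px x)" using L2_circle_integrable by auto
    fix k
    have "integral {0..1} (\<lambda>x. of_real (qx x - px x) * wave k x) =
        integral {0..1} (\<lambda>x. of_real (qx x) * wave k x) - integral {0..1} (\<lambda>x. of_real (px x) * wave k x)"
      using integral_diff[OF integrable_circle_imp(2)[OF integrable_circle_wave[OF L(1)]] integrable_circle_imp(2)[OF integrable_circle_wave[OF L(2)]]]
      by (simp add: left_diff_distrib)
    also have "\<dots> = 0"
      using weak_deriv_fourier[OF pq(1), of k] weak_deriv_fourier[OF pq(2), of k] by simp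
    finally show "integral {0..1} (\<lambda>x. of_real (qx x - px x) * wave k x) = 0" .
  qed
  then have qp: "AE x in circle. qx x = px x" using q(1) w(3) by simp
  show thesis
  proof (rule that[OF w(2) q])
    show "AE x in circle. mean p - pxx x = 2 * mean u * u x + (deriv u x)\<^sup>2 / 2 + (\<rho> x)\<^sup>2 / 2"
      using e3 ux by eventually_elim simp
    show "AE x in circle. pressure_gradient x = qx x"
      using e1 ux qp by eventually_elim (simp add: pressure_gradient_def)
    show "AE x in circle. \<rho>t x = (u x + \<gamma>) * \<rho>x x + deriv u x * \<rho> x"
      using e2 ux by eventually_elim (simp add: algebra_simps)
  qed
qed

text \<open>Both terms of u_t are x-derivatives of periodic functions, namely of p and of (u +
  \<gamma>)^2 / 2.\<close>

lemma integral_ut: "integral {0..1} ut = 0"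
proof -
  obtain p px pxx where p: "weak_deriv p px" "weak_deriv px pxx" and ae: "AE x in circle. pressure_gradient x = px x"
    using equations by metis
  have "mean pressure_gradient = mean px"
    unfolding mean_def using ae p(1)
    by (intro integral_cong_AE)
       (auto simp: weak_deriv_def L2_circle_def intro!: continuous_imp_measurable_on_sets_lebesgue pressure_gradient_cont)
  also have "\<dots> = 0"
  proof -
    have L: "px \<in> L2_circle" using p by (simp add: weak_deriv_def)
    obtain c where "integral {0..1} px = 0" using weak_deriv_indefinite_integral[OF p(1)] by metis
    then show ?thesis by (simp add: mean_integral[OF L])
  qed
  finally have "integral {0..1} pressure_gradient = 0"
    using mean_integral[OF continuous_periodic_in_L2_circle[OF pressure_gradient_periodic pressure_gradient_cont]] by simp
  moreover have "((\<lambda>x. (u x + \<gamma>) * deriv u x) has_integral ((u 1 + \<gamma>)\<^sup>2 / 2 - (u 0 + \<gamma>)\<^sup>2 / 2)) {0..1}"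
  proof (rule fundamental_theorem_of_calculus)
    show "((\<lambda>x. (u x + \<gamma>)\<^sup>2 / 2) has_vector_derivative (u x + \<gamma>) * deriv u x) (at x within {0..1})" for x
      unfolding has_real_derivative_iff_has_vector_derivative[symmetric]
      using has_field_derivative_at_within[OF u_deriv, of x "{0..1}"]
      by (auto intro!: derivative_eq_intros)
  qed simp
  then have "((\<lambda>x. (u x + \<gamma>) * deriv u x) has_integral 0) {0..1}" by (simp add: periodic_ends)
  moreover have "(pressure_gradient has_integral integral {0..1} pressure_gradient) {0..1}"
    by (intro integrable_integral integrable_continuous_interval pressure_gradient_cont)
  ultimately have "((\<lambda>x. pressure_gradient x + (u x + \<gamma>) * deriv u x) has_integral (0 + 0)) {0..1}"
    by (intro has_integral_add) auto
  then show ?thesis by (simp add: pressure_gradient_def integral_unique)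
qed

text \<open>The density equation is the conservation law \<rho>_t = ((u + \<gamma>) \<rho>)_x. As
  \<rho>_x is only integrable, the product rule is the integration by parts for absolutely
  integrable functions.\<close>

lemma integral_\<rho>t:
  assumes x: "x \<in> {0..1}"
  shows "integral {0..x} \<rho>t = (u x + \<gamma>) * \<rho> x - (u 0 + \<gamma>) * \<rho> 0"
proof -
  obtain \<rho>x where w: "weak_deriv \<rho> \<rho>x" and ae: "AE x in circle. \<rho>t x = (u x + \<gamma>) * \<rho>x x + deriv u x * \<rho> x"
    using equations by metis
  have L: "\<rho>x \<in> L2_circle" using w by (simp add: weak_deriv_def)
  note \<rho>xi = integrable_circle_imp(1)[OF L2_circle_integrable[OF L]]
  have "((\<lambda>z. (u z + \<gamma>) * \<rho>x z + deriv u z * \<rho> z) has_integral ((u x + \<gamma>) * \<rho> x - (u 0 + \<gamma>) * \<rho> 0)) {0..x}"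
  proof (rule absolutely_integrable_by_parts)
    show "\<rho>x absolutely_integrable_on {0..x}"
      by (rule absolutely_integrable_on_subinterval[OF \<rho>xi]) (use x in auto)
    show "((\<lambda>z. u z + \<gamma>) has_vector_derivative deriv u z) (at z within {0..x})" for z
      unfolding has_real_derivative_iff_has_vector_derivative[symmetric]
      using has_field_derivative_at_within[OF u_deriv, of z "{0..x}"] by (auto intro!: derivative_eq_intros)
    show "\<rho> z = \<rho> 0 + integral {0..z} \<rho>x" if "z \<in> {0..x}" for z
      by (rule weak_deriv_continuous(1)[OF w \<rho>_cont]) (use that x in auto)
  qed (use x ux_cont in auto)
  moreover have "integral {0..x} \<rho>t = integral {0..x} (\<lambda>z. (u z + \<gamma>) * \<rho>x z + deriv u z * \<rho> z)"
  proof -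
    obtain N where N: "N \<in> null_sets circle" "{z \<in> space circle. \<not> (\<rho>t z = (u z + \<gamma>) * \<rho>x z + deriv u z * \<rho> z)} \<subseteq> N"
      using ae by (auto elim: AE_E simp: null_sets_def)
    have "negligible N"
      using N(1) by (simp add: null_sets_restrict_space negligible_iff_null_sets)
    then show ?thesis
      by (rule integral_spike) (use N(2) x in auto)
  qed
  ultimately show ?thesis by (simp add: integral_unique)
qed

text \<open>With mean zero, p_xx equals \<mu>(p) - (u_x^2 + \<rho>^2) / 2 almost everywhere. Since
  p_xx has integral zero, \<mu>(p) must be half the energy; the right side is then continuous, so
  the derivative is classical.\<close>

lemma pressure_gradient_deriv:
  assumes m: "integral {0..1} u = 0"
  shows "(pressure_gradient has_real_derivative energy / 2 - (deriv u x)\<^sup>2 / 2 - (\<rho> x)\<^sup>2 / 2) (at x)"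
proof -
  let ?f = "\<lambda>x. (deriv u x)\<^sup>2 / 2 + (\<rho> x)\<^sup>2 / 2"
  let ?k = "\<lambda>x. energy / 2 - ?f x"
  obtain \<rho>x p px pxx where p: "weak_deriv p px" "weak_deriv px pxx" and ae: "AE x in circle. pressure_gradient x = px x"
    and inv: "AE x in circle. mean p - pxx x = 2 * mean u * u x + (deriv u x)\<^sup>2 / 2 + (\<rho> x)\<^sup>2 / 2"
    by (rule equations) blast
  have fc: "continuous_on S ?f" for S by (intro continuous_intros ux_cont \<rho>_cont) auto
  have mu: "mean u = 0" using m by (simp add: mean_integral[OF sobolev_L2[OF u]])
  have pxx: "AE x in circle. pxx x = mean p - ?f x" using inv by eventually_elim (simp add: mu)
  obtain N where N: "N \<in> null_sets circle" "{z \<in> space circle. \<not> (pxx z = mean p - ?f z)} \<subseteq> N"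
    using pxx by (auto elim: AE_E simp: null_sets_def)
  have neg: "negligible N"
    using N(1) by (simp add: null_sets_restrict_space negligible_iff_null_sets)
  have pxxi: "integral {0..z} pxx = integral {0..z} (\<lambda>x. mean p - ?f x)" if "z \<in> {0..1}" for z
    by (rule integral_spike[OF neg]) (use N(2) that in auto)
  obtain c where c: "AE x in circle. px x = c + integral {0..x} pxx" and z: "integral {0..1} pxx = 0"
    using weak_deriv_indefinite_integral[OF p(2)] by metis
  have "integral {0..1} (\<lambda>x. mean p - ?f x) = mean p - integral {0..1} ?f"
    by (subst integral_diff) (auto intro!: integrable_continuous_interval fc)
  moreover have "integral {0..1} ?f = energy / 2"
    unfolding energy_def by (simp flip: integral_divide add: add_divide_distrib)
  ultimately have mp: "mean p = energy / 2" using pxxi[of 1] z by simp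
  have "pressure_gradient x = c + integral {0..x} ?k" if x: "x \<in> {0..1}" for x
  proof (rule continuous_AE_eq[OF pressure_gradient_cont _ _ x])
    show "continuous_on {0..1} (\<lambda>x. c + integral {0..x} ?k)"
      by (intro continuous_intros indefinite_integral_continuous_1 integrable_continuous_interval fc)
    show "AE x in circle. pressure_gradient x = c + integral {0..x} ?k"
      using ae c AE_space by eventually_elim (simp add: pxxi mp)
  qed
  note eq = this
  have "(pressure_gradient has_real_derivative ?k x) (at x)"
  proof (rule periodic_primitive_has_derivative[OF pressure_gradient_periodic])
    show "periodic1 ?k" using periodic by (simp add: periodic1_def)
    show "continuous_on UNIV ?k" by (intro continuous_intros fc)
    show "pressure_gradient x = pressure_gradient 0 + integral {0..x} ?k" if "x \<in> {0..1}" for x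
      using eq[OF that] eq[of 0] by simp
  qed
  then show ?thesis by (simp add: algebra_simps)
qed

end

section \<open>Global solutions\<close>

lemma constant_if_zero_derivative:
  fixes f :: "real \<Rightarrow> real"
  assumes "convex S" "\<And>t. t \<in> S \<Longrightarrow> (f has_real_derivative 0) (at t within S)" "s \<in> S" "t \<in> S"
  shows "f s = f t"
  using has_field_derivative_zero_constant[of S f] assms by metis

locale global_mu_HS_solution =
  fixes \<gamma>1 \<gamma>2 s \<gamma> :: real and u \<rho> ut \<rho>t :: "real \<Rightarrow> real \<Rightarrow> real"
  assumes s: "2 \<le> s" and g1: "\<gamma>1 = \<gamma>" and g2: "2 * \<gamma>2 = \<gamma>"
    and cu: "sobolev_continuous s \<infinity> u" and c\<rho>: "sobolev_continuous (s - 1) \<infinity> \<rho>"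
    and C1u: "sobolev_C1 (s - 1) \<infinity> u ut" and C1\<rho>: "sobolev_C1 (s - 2) \<infinity> \<rho> \<rho>t"
    and eqs: "\<And>t. 0 \<le> t \<Longrightarrow> mu_HS_equations \<gamma>1 \<gamma>2 s (u t) (\<rho> t) (ut t) (\<rho>t t)"
    and mean0: "integral {0..1} (u 0) = 0"
begin

lemma slice:
  assumes "0 \<le> t"
  shows "mu_HS_slice \<gamma>1 \<gamma>2 s \<gamma> (u t) (\<rho> t) (ut t) (\<rho>t t)"
proof
  show "u t \<in> sobolev s" "\<rho> t \<in> sobolev (s - 1)" using cu c\<rho> assms by (auto intro: sobolev_continuous_mem)
  show "ut t \<in> sobolev (s - 1)"
    using C1u assms unfolding sobolev_C1_def by (auto intro: sobolev_continuous_mem)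
qed (use s g1 g2 eqs assms in auto)

text \<open>Conservation of the mean keeps the term 2 \<mu>(u) u out of the pressure equation at all
  times.\<close>

lemma integral_u: "0 \<le> t \<Longrightarrow> integral {0..1} (u t) = 0"
proof -
  assume t: "0 \<le> t"
  have "((\<lambda>\<tau>. integral {0..1} (u \<tau>)) has_real_derivative 0) (at t within {0..})" if "t \<in> {0..}" for t
    using sobolev_C1_integral[OF C1u, of t 1] mu_HS_slice.integral_ut[OF slice[of t]] that s by simp
  from constant_if_zero_derivative[of "{0..}", OF _ this, of t 0] t mean0 show ?thesis by simp
qed

text \<open>In u_t - (u + \<gamma>) u_x the velocity carries a minus sign, so characteristics move
  with the negative of \<open>speed\<close>.\<close>

definition speed :: "real \<Rightarrow> real \<Rightarrow> real" where
  "speed t x = u t x + \<gamma>"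

definition energy :: "real \<Rightarrow> real" where
  "energy t = integral {0..1} (\<lambda>x. (deriv (u t) x)\<^sup>2 + (\<rho> t x)\<^sup>2)"

definition pressure_gradient :: "real \<Rightarrow> real \<Rightarrow> real" where
  "pressure_gradient t x = ut t x - (u t x + \<gamma>) * deriv (u t) x"

text \<open>The value of p_xx found in \<open>pressure_gradient_deriv\<close>. The energy is still
  taken at time t; its constancy is derived from this formula.\<close>

definition pressure_curvature :: "real \<Rightarrow> real \<Rightarrow> real" where
  "pressure_curvature t x = energy t / 2 - (deriv (u t) x)\<^sup>2 / 2 - (\<rho> t x)\<^sup>2 / 2"

lemma strips: "strip T u" "strip T (\<lambda>t. deriv (u t))" "strip T \<rho>" "strip T ut" "strip T speed"
proof -
  show u: "strip T u" and "strip T (\<lambda>t. deriv (u t))" and "strip T \<rho>"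
    using s by (auto intro: sobolev_continuous_strip[OF cu] sobolev_continuous_deriv_strip[OF cu] sobolev_continuous_strip[OF c\<rho>])
  show "strip T ut"
    using C1u s unfolding sobolev_C1_def by (auto intro: sobolev_continuous_strip)
  show "strip T speed"
    using u by (auto simp: strip_def speed_def periodic1_def split_beta' intro!: continuous_intros)
qed

lemma energy_split:
  assumes t: "t \<in> {0..T}"
  shows "energy t = integral {0..1} (\<lambda>x. (deriv (u t) x)\<^sup>2) + integral {0..1} (\<lambda>x. (\<rho> t x)\<^sup>2)"
  unfolding energy_def
  by (intro integral_add integrable_continuous_interval continuous_on_power
      strip_continuous_slice[OF strips(2) t] strip_continuous_slice[OF strips(3) t])

lemma strip_pressure_curvature: "strip T pressure_curvature"
proof -
  have sq: "continuous_on ({0..T} \<times> S) (\<lambda>p. (deriv (u (fst p)) (snd p))\<^sup>2 + (\<rho> (fst p) (snd p))\<^sup>2)" for S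
    by (intro continuous_intros strip_continuous_compose[OF strips(2)] strip_continuous_compose[OF strips(3)]) auto
  have "continuous_on {0..T} energy"
    unfolding energy_def
    using integral_continuous_on_param[of "{0..T}" 0 "1::real" "\<lambda>t x. (deriv (u t) x)\<^sup>2 + (\<rho> t x)\<^sup>2"] sq[of "{0..1}"]
    by (simp add: split_beta')
  then have "continuous_on ({0..T} \<times> UNIV) (\<lambda>p. energy (fst p))"
    by (rule continuous_on_compose2) (auto intro: continuous_intros)
  then have "continuous_on ({0..T} \<times> UNIV) (\<lambda>p. pressure_curvature (fst p) (snd p))"
    unfolding pressure_curvature_def
    by (intro continuous_intros strip_continuous_compose[OF strips(2)] strip_continuous_compose[OF strips(3)]) auto
  then show ?thesis
    using strips(2)[of T] strips(3)[of T] by (simp add: strip_def periodic1_def pressure_curvature_def split_beta')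
qed

lemma speed_x: "0 \<le> t \<Longrightarrow> (speed t has_real_derivative deriv (u t) x) (at x)"
  unfolding speed_def using DERIV_add[OF mu_HS_slice.u_deriv[OF slice] DERIV_const] by simp

text \<open>Velocity and transported function differ by the constant \<gamma>, so \<open>ax\<close>
  and \<open>v\<close> are both u_x. This produces the square of u_x along characteristics.\<close>

lemma transport_velocity:
  "transport T speed (\<lambda>t. deriv (u t)) u (\<lambda>t. deriv (u t)) pressure_gradient pressure_curvature"
proof
  show "continuous_on ({0..T} \<times> UNIV) (\<lambda>(t, x). pressure_gradient t x)"
    unfolding pressure_gradient_def split_beta'
    by (intro continuous_intros strip_continuous_compose[OF strips(1)] strip_continuous_compose[OF strips(2)]
        strip_continuous_compose[OF strips(4)]) auto
next
  fix t x assume t: "t \<in> {0..T}"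
  then have t0: "0 \<le> t" by simp
  show "(speed t has_real_derivative deriv (u t) x) (at x)" by (rule speed_x[OF t0])
  show "(u t has_real_derivative deriv (u t) x) (at x)" by (rule mu_HS_slice.u_deriv[OF slice[OF t0]])
  show "(pressure_gradient t has_real_derivative pressure_curvature t x) (at x)"
    using mu_HS_slice.pressure_gradient_deriv[OF slice[OF t0] integral_u[OF t0], of x]
    unfolding mu_HS_slice.pressure_gradient_def[OF slice[OF t0], abs_def] mu_HS_slice.energy_def[OF slice[OF t0]]
      pressure_gradient_def[abs_def] pressure_curvature_def energy_def .
  have "((\<lambda>\<tau>. u \<tau> x) has_real_derivative ut t x) (at t within {0..T})"
    using s by (intro DERIV_subset[OF sobolev_C1_pointwise[OF C1u _ t0]]) auto
  then show "((\<lambda>\<tau>. u \<tau> x) has_real_derivative speed t x * deriv (u t) x + pressure_gradient t x) (at t within {0..T})"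
    by (simp add: speed_def pressure_gradient_def)
qed (use strips strip_pressure_curvature in auto)

text \<open>The primitive is anchored at 0, so its time derivative is the flux at x minus the flux
  at 0. The latter is a source constant in x and contributes nothing to the equation for
  \<rho>.\<close>

lemma transport_density:
  "transport T speed (\<lambda>t. deriv (u t)) (\<lambda>t. antiderivative (\<rho> t)) \<rho> (\<lambda>t x. - (speed t 0 * \<rho> t 0)) (\<lambda>t x. 0)"
proof
  show "strip T (\<lambda>t x. 0)" by (simp add: strip_def periodic1_def split_beta')
  show "continuous_on ({0..T} \<times> UNIV) (\<lambda>(t, x). - (speed t 0 * \<rho> t 0))"
    unfolding split_beta'
    by (intro continuous_intros strip_continuous_compose[OF strips(3)] strip_continuous_compose[OF strips(5)]) auto
next
  fix t x assume t: "t \<in> {0..T}"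
  then have t0: "0 \<le> t" by simp
  have \<rho>c: "continuous_on UNIV (\<rho> t)" if "0 \<le> t" for t by (rule mu_HS_slice.\<rho>_cont[OF slice[OF that]])
  have \<rho>p: "periodic1 (\<rho> t)" if "0 \<le> t" for t by (rule mu_HS_slice.periodic[OF slice[OF that]])
  show "(speed t has_real_derivative deriv (u t) x) (at x)" by (rule speed_x[OF t0])
  show "(antiderivative (\<rho> t) has_real_derivative \<rho> t x) (at x)"
    by (rule antiderivative_has_derivative[OF \<rho>c[OF t0]])
  show "((\<lambda>x. - (speed t 0 * \<rho> t 0)) has_real_derivative 0) (at x)" by simp
  have unit: "((\<lambda>\<tau>. antiderivative (\<rho> \<tau>) y) has_real_derivative speed t y * \<rho> t y - speed t 0 * \<rho> t 0) (at t within {0..})"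
    if y: "y \<in> {0..1}" for y
    using sobolev_C1_integral[OF C1\<rho> _ t0 y] mu_HS_slice.integral_\<rho>t[OF slice[OF t0] y] s y
    by (simp add: antiderivative_nonneg speed_def)
  have fr: "frac x \<in> {0..1}" using frac_lt_1[of x] by (simp add: less_imp_le)
  \<comment> \<open>Equal fluxes at the ends of a period mean that the integral of \<rho> is
    conserved, so the linear drift of the primitive is constant in time.\<close>
  have "speed t 1 * \<rho> t 1 - speed t 0 * \<rho> t 0 = 0"
    using mu_HS_slice.periodic_ends[OF slice[OF t0]] by (simp add: speed_def)
  then have "((\<lambda>\<tau>. antiderivative (\<rho> \<tau>) (frac x) + (x - frac x) * antiderivative (\<rho> \<tau>) 1) has_real_derivative
      (speed t (frac x) * \<rho> t (frac x) - speed t 0 * \<rho> t 0) + (x - frac x) * 0) (at t within {0..})"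
    using unit[of 1] by (intro DERIV_add DERIV_cmult unit fr) simp
  moreover have "speed t (frac x) = speed t x" "\<rho> t (frac x) = \<rho> t x"
    using periodic1_frac[OF mu_HS_slice.periodic(1)[OF slice[OF t0]]] periodic1_frac[OF \<rho>p[OF t0]] by (simp_all add: speed_def)
  ultimately have d: "((\<lambda>\<tau>. antiderivative (\<rho> \<tau>) (frac x) + (x - frac x) * antiderivative (\<rho> \<tau>) 1) has_derivative
      (*) (speed t x * \<rho> t x - speed t 0 * \<rho> t 0)) (at t within {0..})"
    by (simp add: has_field_derivative_def)
  have "((\<lambda>\<tau>. antiderivative (\<rho> \<tau>) x) has_derivative (*) (speed t x * \<rho> t x - speed t 0 * \<rho> t 0)) (at t within {0..})"
  proof (rule has_derivative_transform[OF _ _ d])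
    show "antiderivative (\<rho> \<tau>) x = antiderivative (\<rho> \<tau>) (frac x) + (x - frac x) * antiderivative (\<rho> \<tau>) 1"
      if "\<tau> \<in> {0..}" for \<tau>
      using that by (intro antiderivative_shift \<rho>c \<rho>p) auto
  qed (use t0 in simp)
  then have "((\<lambda>\<tau>. antiderivative (\<rho> \<tau>) x) has_real_derivative speed t x * \<rho> t x - speed t 0 * \<rho> t 0) (at t within {0..})"
    by (simp add: has_field_derivative_def)
  from DERIV_subset[OF this, of "{0..T}"]
  show "((\<lambda>\<tau>. antiderivative (\<rho> \<tau>) x) has_real_derivative speed t x * \<rho> t x + - (speed t 0 * \<rho> t 0)) (at t within {0..T})"
    by auto
qed (use strips in auto)

text \<open>Inserting p_xx, the cubic terms u_x^3 and u_x \<rho>^2 cancel between the two energies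
  and E u_x remains, which integrates to zero by periodicity of u.\<close>

lemma energy_conserved:
  assumes t: "t \<in> {0..T}"
  shows "energy t = energy 0"
proof (rule constant_if_zero_derivative[of "{0..T}" energy])
  fix t assume t: "t \<in> {0..T}"
  let ?v = "deriv (u t)"
  have vc: "continuous_on {0..1} ?v" and rc: "continuous_on {0..1} (\<rho> t)" and kc: "continuous_on {0..1} (pressure_curvature t)"
    using strip_continuous_slice[OF strips(2) t] strip_continuous_slice[OF strips(3) t]
      strip_continuous_slice[OF strip_pressure_curvature t] by auto
  have "((\<lambda>t. integral {0..1} (\<lambda>x. (deriv (u t) x)\<^sup>2) + integral {0..1} (\<lambda>x. (\<rho> t x)\<^sup>2)) has_real_derivative
      integral {0..1} (\<lambda>x. ?v x * (?v x)\<^sup>2 + 2 * ?v x * pressure_curvature t x) +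
      integral {0..1} (\<lambda>x. ?v x * (\<rho> t x)\<^sup>2 + 2 * \<rho> t x * 0)) (at t within {0..T})"
    by (intro DERIV_add transport.energy_derivative[OF transport_velocity t] transport.energy_derivative[OF transport_density t])
  moreover have "integral {0..1} (\<lambda>x. ?v x * (?v x)\<^sup>2 + 2 * ?v x * pressure_curvature t x) +
      integral {0..1} (\<lambda>x. ?v x * (\<rho> t x)\<^sup>2 + 2 * \<rho> t x * 0) = integral {0..1} (\<lambda>x. energy t * ?v x)"
    by (subst integral_add[symmetric])
       (auto intro!: integrable_continuous_interval continuous_intros vc rc kc integral_cong
         simp: pressure_curvature_def field_simps power2_eq_square)
  moreover have "integral {0..1} ?v = 0"
  proof -
    have "(?v has_integral (u t 1 - u t 0)) {0..1}"
      using mu_HS_slice.u_deriv[OF slice[of t]] t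
      by (intro fundamental_theorem_of_calculus)
         (auto simp flip: has_real_derivative_iff_has_vector_derivative intro: has_field_derivative_at_within)
    then show ?thesis using mu_HS_slice.periodic_ends[OF slice[of t]] t by (auto intro: integral_unique)
  qed
  ultimately have d: "((\<lambda>t. integral {0..1} (\<lambda>x. (deriv (u t) x)\<^sup>2) + integral {0..1} (\<lambda>x. (\<rho> t x)\<^sup>2)) has_derivative (*) 0) (at t within {0..T})"
    by (simp add: has_field_derivative_def)
  have "(energy has_derivative (*) 0) (at t within {0..T})"
    by (rule has_derivative_transform[OF t energy_split d])
  then show "(energy has_real_derivative 0) (at t within {0..T})" by (simp add: has_field_derivative_def)
qed (use t in auto)

text \<open>Zero energy makes \<rho> vanish and u constant at time 0; mean zero then excludes every
  constant but 0.\<close>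

lemma energy_pos:
  assumes nz: "\<not> ((\<forall>x. u 0 x = 0) \<and> (\<forall>x. \<rho> 0 x = 0))"
  shows "0 < energy 0"
proof (rule ccontr)
  note sl = slice[of 0, OF order_refl]
  let ?e = "\<lambda>x. (deriv (u 0) x)\<^sup>2 + (\<rho> 0 x)\<^sup>2"
  have c: "continuous_on {0..1} ?e"
    by (intro continuous_intros mu_HS_slice.ux_cont[OF sl] mu_HS_slice.\<rho>_cont[OF sl])
  assume "\<not> 0 < energy 0"
  moreover have "0 \<le> energy 0"
    unfolding energy_def by (intro integral_nonneg integrable_continuous_interval c) simp
  ultimately have "integral {0..1} ?e = 0" by (simp add: energy_def)
  then have z: "?e x = 0" if "x \<in> {0..1}" for x
    using integral_eq_0_iff[OF c] that by simp
  have fr: "frac x \<in> {0..1}" for x :: real using frac_lt_1[of x] by (simp add: less_imp_le)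
  have r0: "\<rho> 0 x = 0" for x
    using z[OF fr[of x]] periodic1_frac[OF mu_HS_slice.periodic(3)[OF sl], of x] by (simp add: sum_power2_eq_zero_iff)
  have d0: "deriv (u 0) x = 0" for x
    using z[OF fr[of x]] periodic1_frac[OF mu_HS_slice.periodic(2)[OF sl], of x] by (simp add: sum_power2_eq_zero_iff)
  have "(u 0 has_real_derivative 0) (at x)" for x
    using mu_HS_slice.u_deriv[OF sl, of x] by (simp add: d0)
  then have const: "u 0 x = u 0 0" for x
    using DERIV_isconst_all[of "u 0"] by blast
  have "integral {0..1} (u 0) = u 0 0"
    by (subst integral_cong[OF const]) simp
  then show False using nz const r0 mean0 by simp
qed

lemma density_zero_blowup:
  assumes E: "0 < energy 0" and x0: "\<rho> 0 y0 = 0"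
  shows False
proof -
  \<comment> \<open>The first time at which the strict bound of \<open>Riccati_time_bound\<close> is
    violated.\<close>
  define T where "T = 2 * pi / sqrt (energy 0)"
  have T: "0 < T" using E by (simp add: T_def)
  \<comment> \<open>A bound for u_x on the strip is a Lipschitz constant for the velocity, which is
    what the characteristic needs to exist up to T.\<close>
  obtain L where L: "0 < L" "\<And>t x. t \<in> {0..T} \<Longrightarrow> \<bar>deriv (u t) x\<bar> \<le> L" using strip_bounded[OF strips(2)] by metis
  obtain M where M: "\<And>t x. t \<in> {0..T} \<Longrightarrow> \<bar>speed t x\<bar> \<le> M" using strip_bounded[OF strips(5)] by metis
  obtain q where q0: "q 0 = y0" and q: "\<And>t. t \<in> {0..T} \<Longrightarrow> (q has_real_derivative - speed t (q t)) (at t within {0..T})"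
  proof (rule bounded_ODE_solution[OF T L(1), of "\<lambda>t x. - speed t x" M y0])
    show "continuous_on ({0..T} \<times> UNIV) (\<lambda>(t, x). - speed t x)"
      using continuous_on_minus[OF strip_continuous[OF strips(5)]] by (simp add: split_beta')
    show "\<bar>- speed t x - - speed t y\<bar> \<le> L * \<bar>x - y\<bar>" if t: "t \<in> {0..T}" for t x y
    proof -
      have "norm (speed t x - speed t y) \<le> L * norm (x - y)"
        using t L(2)[OF t] by (intro field_differentiable_bound[of UNIV "speed t" "deriv (u t)"]) (auto intro: speed_x)
      then show ?thesis by (simp add: abs_minus_commute)
    qed
  qed (use M in auto)
  have qc: "continuous_on {0..T} q" by (rule DERIV_continuous_on[OF q])
  have r: "\<rho> t (q t) = 0" if "t \<in> {0..T}" for t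
  proof (rule vanishing_linear_ODE[OF _ _ _ that])
    show "continuous_on {0..T} (\<lambda>t. deriv (u t) (q t))"
      by (intro strip_continuous_compose[OF strips(2)] continuous_on_id qc)
    show "((\<lambda>t. \<rho> t (q t)) has_real_derivative deriv (u t) (q t) * \<rho> t (q t)) (at t within {0..T})" if "t \<in> {0..T}" for t
      using transport.along_characteristic[OF transport_density q that] by simp
  qed (simp add: q0 x0)
  have "sqrt (energy 0) * T < 2 * pi"
  proof (rule Riccati_time_bound[OF E T])
    fix t assume t: "t \<in> {0..T}"
    \<comment> \<open>On the characteristic \<rho> is zero, so p_xx + m^2 = E / 2 - m^2 / 2 +
      m^2.\<close>
    have riccati: "pressure_curvature t (q t) + deriv (u t) (q t) * deriv (u t) (q t) = (energy 0 + (deriv (u t) (q t))\<^sup>2) / 2"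
      by (simp add: pressure_curvature_def r[OF t] energy_conserved[OF t] power2_eq_square field_simps)
    show "((\<lambda>t. deriv (u t) (q t)) has_real_derivative (energy 0 + (deriv (u t) (q t))\<^sup>2) / 2) (at t within {0..T})"
      by (rule DERIV_cong[OF transport.along_characteristic[OF transport_velocity q t] riccati])
  qed
  then show False using E by (simp add: T_def)
qed

end

theorem theorem4p1:
  fixes \<gamma>1 \<gamma>2 s :: real and u0 \<rho>0 :: "real \<Rightarrow> real"
    and T :: ereal and u \<rho> :: "real \<Rightarrow> real \<Rightarrow> real"
  assumes "s \<ge> 2"
    and "u0 \<in> sobolev s" and "\<rho>0 \<in> sobolev (s - 1)"
    and "\<not> ((\<forall>x. u0 x = 0) \<and> (\<forall>x. \<rho>0 x = 0))"
    and "mu_HS_maximal_solution \<gamma>1 \<gamma>2 s u0 \<rho>0 T u \<rho>"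
    and "\<gamma>1 = 2 * \<gamma>2"
    and "mean u0 = 0"
    and "\<exists>x0. \<rho>0 (- x0) = 0"
  shows "T < \<infinity>"
proof (rule ccontr)
  assume "\<not> T < \<infinity>"
  then have "mu_HS_solution \<gamma>1 \<gamma>2 s u0 \<rho>0 \<infinity> u \<rho>"
    using assms(5) by (simp add: mu_HS_maximal_solution_def)
  then obtain ut \<rho>t where init: "u 0 = u0" "\<rho> 0 = \<rho>0"
    and c: "sobolev_continuous s \<infinity> u" "sobolev_continuous (s - 1) \<infinity> \<rho>"
      "sobolev_C1 (s - 1) \<infinity> u ut" "sobolev_C1 (s - 2) \<infinity> \<rho> \<rho>t"
    and eqs: "\<And>t. 0 \<le> t \<Longrightarrow> mu_HS_equations \<gamma>1 \<gamma>2 s (u t) (\<rho> t) (ut t) (\<rho>t t)"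
    unfolding mu_HS_solution_def time_interval_infinity by auto
  interpret global_mu_HS_solution \<gamma>1 \<gamma>2 s \<gamma>1 u \<rho> ut \<rho>t
  proof
    show "integral {0..1} (u 0) = 0"
      using assms(7) mean_integral[OF sobolev_L2[OF assms(2)]] by (simp add: init)
  qed (use assms(1,6) c eqs in auto)
  obtain x0 where "\<rho> 0 (- x0) = 0" using assms(8) by (auto simp: init)
  moreover have "0 < energy 0" using assms(4) by (intro energy_pos) (simp add: init)
  ultimately show False by (rule density_zero_blowup[rotated])
qed

end
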